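(* Let $\mathbf{u}=(u,v,w)$ be a time-independent divergence-free vector field in $L^2(\Omega;\mathbb{R}^3)$. Then \[ Nu(\mathbf{u})-1=\max_{\xi\in H^1_0(\Omega)\cap L^\infty(\Omega)}\ \fint_\Omega 2w\xi-|\nabla\xi|^2-\big|\nabla\Delta^{-1}\mathrm{div}(\mathbf{u}\xi)\big|^2, \] and the maximum is attained.
   Context: Let $\Omega=\mathbb{T}^2_{xy}\times[0,1]_z$ with $\mathbb{T}^2_{xy}\cong[0,l_x]\times[0,l_y]$ periodic; $\fint_\Omega=\frac1{|\Omega|}\int_\Omega$; $H^1_0(\Omega)$ consists of $H^1$ functions periodic in $x,y$ vanishing at $z=0,1$. $\Delta^{-1}$ is the inverse Dirichlet Laplacian on $\Omega$, $H^{-1}(\Omega)\to H^1_0(\Omega)$. For steady $\mathbf{u}$, $Nu(\mathbf{u})=\fint_\Omega|\nabla T|^2$, where $T$ is the steady weak essentially bounded solution of $\mathbf{u}\cdot\nabla T=\Delta T$ with $T|_{z=0}=1$, $T|_{z=1}=0$. *)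

theory Defs
  imports "HOL-Analysis.Analysis"
begin

text \<open>Points of R^3 are triples (x, y, z).  The domain Omega = T^2 x [0,1] is represented
  by its fundamental cell [0,lx] x [0,ly] x [0,1]; periodicity in x,y enters through the
  test functions, which are periodic in x and y.\<close>

type_synonym pt = "real \<times> real \<times> real"

definition Om :: "real \<Rightarrow> real \<Rightarrow> pt set" where
  "Om lx ly = {0..lx} \<times> {0..ly} \<times> {0..1}"

abbreviation MOm :: "real \<Rightarrow> real \<Rightarrow> pt measure" where
  "MOm lx ly \<equiv> lebesgue_on (Om lx ly)"

definition avg :: "real \<Rightarrow> real \<Rightarrow> (pt \<Rightarrow> real) \<Rightarrow> real" where
  "avg lx ly F = (LINT p|MOm lx ly. F p) / (lx * ly)"

definition zc :: "pt \<Rightarrow> real" where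
  "zc p = snd (snd p)"

text \<open>C^infinity: all iterated partial derivatives exist (D l is the partial derivative
  along the list of directions l; directions 0,1,2 = x,y,z).\<close>
definition smooth3 :: "(pt \<Rightarrow> real) \<Rightarrow> bool" where
  "smooth3 f \<longleftrightarrow> (\<exists>D :: nat list \<Rightarrow> pt \<Rightarrow> real. D [] = f \<and>
     (\<forall>l p. (D l has_derivative
        (\<lambda>h. D (0#l) p * fst h + D (1#l) p * fst (snd h) + D (2#l) p * snd (snd h))) (at p)))"

definition grad3 :: "(pt \<Rightarrow> real) \<Rightarrow> pt \<Rightarrow> pt" where
  "grad3 f p = (let L = frechet_derivative f (at p) in (L (1,0,0), L (0,1,0), L (0,0,1)))"

definition test_fun :: "real \<Rightarrow> real \<Rightarrow> (pt \<Rightarrow> real) \<Rightarrow> bool" where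
  "test_fun lx ly \<phi> \<longleftrightarrow> smooth3 \<phi> \<and>
     (\<forall>x y z. \<phi> (x + lx, y, z) = \<phi> (x, y, z) \<and> \<phi> (x, y + ly, z) = \<phi> (x, y, z)) \<and>
     (\<exists>\<delta>>0. \<forall>x y z. (z \<le> \<delta> \<or> 1 - \<delta> \<le> z) \<longrightarrow> \<phi> (x, y, z) = 0)"

definition L2 :: "real \<Rightarrow> real \<Rightarrow> (pt \<Rightarrow> 'a::euclidean_space) \<Rightarrow> bool" where
  "L2 lx ly f \<longleftrightarrow> f \<in> borel_measurable (MOm lx ly) \<and>
     integrable (MOm lx ly) (\<lambda>p. (norm (f p))\<^sup>2)"

definition Linf :: "real \<Rightarrow> real \<Rightarrow> (pt \<Rightarrow> real) \<Rightarrow> bool" where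
  "Linf lx ly f \<longleftrightarrow> f \<in> borel_measurable (MOm lx ly) \<and>
     (\<exists>C. AE p in MOm lx ly. \<bar>f p\<bar> \<le> C)"

definition weak_grad :: "real \<Rightarrow> real \<Rightarrow> (pt \<Rightarrow> real) \<Rightarrow> (pt \<Rightarrow> pt) \<Rightarrow> bool" where
  "weak_grad lx ly f g \<longleftrightarrow> (\<forall>\<phi>. test_fun lx ly \<phi> \<longrightarrow>
     (LINT p|MOm lx ly. f p *\<^sub>R grad3 \<phi> p) = - (LINT p|MOm lx ly. \<phi> p *\<^sub>R g p))"

definition H1 :: "real \<Rightarrow> real \<Rightarrow> (pt \<Rightarrow> real) \<Rightarrow> bool" where
  "H1 lx ly f \<longleftrightarrow> L2 lx ly f \<and> (\<exists>g. L2 lx ly g \<and> weak_grad lx ly f g)"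

definition H10 :: "real \<Rightarrow> real \<Rightarrow> (pt \<Rightarrow> real) \<Rightarrow> bool" where
  "H10 lx ly f \<longleftrightarrow> L2 lx ly f \<and> (\<exists>g. L2 lx ly g \<and> weak_grad lx ly f g \<and>
     (\<exists>\<phi>. (\<forall>n. test_fun lx ly (\<phi> n)) \<and>
        (\<lambda>n. LINT p|MOm lx ly. (\<phi> n p - f p)\<^sup>2) \<longlonglongrightarrow> 0 \<and>
        (\<lambda>n. LINT p|MOm lx ly. (norm (grad3 (\<phi> n) p - g p))\<^sup>2) \<longlonglongrightarrow> 0))"

text \<open>int_Omega |grad f|^2 (well defined for f in H^1, weak gradients being a.e. unique).\<close>
definition dirichlet :: "real \<Rightarrow> real \<Rightarrow> (pt \<Rightarrow> real) \<Rightarrow> real" where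
  "dirichlet lx ly f = (THE c. \<exists>g. L2 lx ly g \<and> weak_grad lx ly f g \<and>
      c = (LINT p|MOm lx ly. (norm (g p))\<^sup>2))"

definition inv_lap_div :: "real \<Rightarrow> real \<Rightarrow> (pt \<Rightarrow> pt) \<Rightarrow> (pt \<Rightarrow> real) \<Rightarrow> bool" where
  "inv_lap_div lx ly F \<psi> \<longleftrightarrow> H10 lx ly \<psi> \<and> (\<exists>g. L2 lx ly g \<and> weak_grad lx ly \<psi> g \<and>
     (\<forall>\<phi>. test_fun lx ly \<phi> \<longrightarrow>
        (LINT p|MOm lx ly. g p \<bullet> grad3 \<phi> p) = (LINT p|MOm lx ly. F p \<bullet> grad3 \<phi> p)))"

definition inv_lap_div_energy :: "real \<Rightarrow> real \<Rightarrow> (pt \<Rightarrow> pt) \<Rightarrow> real" where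
  "inv_lap_div_energy lx ly F = (THE c. \<exists>\<psi>. inv_lap_div lx ly F \<psi> \<and> c = dirichlet lx ly \<psi>)"

definition div_free :: "real \<Rightarrow> real \<Rightarrow> (pt \<Rightarrow> pt) \<Rightarrow> bool" where
  "div_free lx ly u \<longleftrightarrow> (\<forall>\<phi>. test_fun lx ly \<phi> \<longrightarrow> (LINT p|MOm lx ly. u p \<bullet> grad3 \<phi> p) = 0)"

text \<open>T is a steady, weak, essentially bounded solution of u . grad T = Delta T with
  T = 1 at z = 0 and T = 0 at z = 1; g is its weak gradient.\<close>
definition steady_sol :: "real \<Rightarrow> real \<Rightarrow> (pt \<Rightarrow> pt) \<Rightarrow> (pt \<Rightarrow> real) \<Rightarrow> (pt \<Rightarrow> pt) \<Rightarrow> bool" where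
  "steady_sol lx ly u T g \<longleftrightarrow> H1 lx ly T \<and> Linf lx ly T \<and> L2 lx ly g \<and> weak_grad lx ly T g \<and>
     H10 lx ly (\<lambda>p. T p - (1 - zc p)) \<and>
     (\<forall>\<phi>. test_fun lx ly \<phi> \<longrightarrow>
        (LINT p|MOm lx ly. g p \<bullet> grad3 \<phi> p) + (LINT p|MOm lx ly. (u p \<bullet> g p) * \<phi> p) = 0)"

definition Nu :: "real \<Rightarrow> real \<Rightarrow> (pt \<Rightarrow> pt) \<Rightarrow> real" where
  "Nu lx ly u = (THE c. \<exists>T g. steady_sol lx ly u T g \<and> c = avg lx ly (\<lambda>p. (norm (g p))\<^sup>2))"

definition Jfun :: "real \<Rightarrow> real \<Rightarrow> (pt \<Rightarrow> pt) \<Rightarrow> (pt \<Rightarrow> real) \<Rightarrow> real" where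
  "Jfun lx ly u \<xi> = ((LINT p|MOm lx ly. 2 * zc (u p) * \<xi> p) - dirichlet lx ly \<xi>
      - inv_lap_div_energy lx ly (\<lambda>p. \<xi> p *\<^sub>R u p)) / (lx * ly)"

end

theory Submission
  imports Defs
begin

text \<open>Write \<open>T = 1 - z + \<theta>\<close>, so that \<open>u \<cdot> \<nabla>\<theta> - \<Delta>\<theta> = w\<close> and \<open>Nu - 1\<close> is the mean of \<open>|\<nabla>\<theta>|\<^sup>2\<close>. With \<open>\<theta>'\<close> the solution
  of the same equation for \<open>- u \<cdot> \<nabla>\<close>, the functions \<open>\<xi> = (\<theta> + \<theta>')/2\<close> and \<open>\<eta> = (\<theta> - \<theta>')/2\<close> satisfy
  \<open>u \<cdot> \<nabla>\<eta> - \<Delta>\<xi> = w\<close> and \<open>\<Delta>\<eta> = div (u \<xi>)\<close>, which is the Euler--Lagrange equation of the concave functional.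
  Conversely, the functional is a linear form minus a closed quadratic form on the space of all
  \<open>\<xi> \<in> H\<^sup>1\<^sub>0\<close> for which \<open>div (u \<xi>)\<close> has a potential in \<open>H\<^sup>1\<^sub>0\<close>. An orthogonal projection in \<open>L\<^sup>2\<close> yields
  its maximiser, and with it both solutions \<open>\<xi> \<plusminus> \<eta>\<close>, without any regularisation of \<open>u\<close>. Boundedness comes from
  testing the equation of \<open>T\<close> with a bounded increasing smooth function of \<open>T\<close> that vanishes
  exactly on \<open>[0,1]\<close>; uniqueness of bounded solutions and orthogonality of \<open>\<nabla>\<xi>\<close> and \<open>\<nabla>\<eta>\<close> come from
  \<open>\<integral> \<xi> u \<cdot> \<nabla>\<xi> = 0\<close> for bounded \<open>\<xi> \<in> H\<^sup>1\<^sub>0\<close>.\<close>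

section \<open>Square-integrable functions\<close>

text \<open>For \<open>u\<close> merely in L2 the drift term \<open>u \<bullet> G\<close> is only
  integrable. For the same reason the map from \<xi> to the potential of
  \<open>div (u \<xi>)\<close> is unbounded, but its graph, recorded by the two gradients, is closed
  in L2, and closedness is all that a projection asks for. The field that is projected is
  \<open>(- z u, 0)\<close>: since \<open>u\<close> is divergence-free, \<open>\<integral> w \<xi> =
  - \<integral> z u \<bullet> \<nabla>\<xi>\<close>, which turns the linear form into an L2 pairing
  with a gradient. The projection is then varied along test functions; being bounded, they have
  potentials and so belong to the domain of the form. The equations of \<xi> and \<eta> are coupled,
  so the maximum principle applies to neither alone. It applies to \<xi> + \<eta> with drift
  \<open>u\<close> and to \<eta> - \<xi> with drift \<open>- u\<close>, and half the difference of
  the two returns \<xi>. Only at that point is the maximiser known to be an admissible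
  competitor.\<close>

definition sq_int :: "'a measure \<Rightarrow> ('a \<Rightarrow> 'b::euclidean_space) \<Rightarrow> bool" where
  "sq_int M f \<longleftrightarrow> f \<in> borel_measurable M \<and> integrable M (\<lambda>p. (norm (f p))\<^sup>2)"

definition l2norm :: "'a measure \<Rightarrow> ('a \<Rightarrow> 'b::euclidean_space) \<Rightarrow> real" where
  "l2norm M f = sqrt (LINT p|M. (norm (f p))\<^sup>2)"

text \<open>The integral of a nonintegrable function is 0 by convention, so this carries information
  only for square-integrable terms and limit. Hence the \<open>sq_int\<close> assumptions wherever
  such limits are added, paired or made pointwise.\<close>

definition l2lim :: "'a measure \<Rightarrow> (nat \<Rightarrow> 'a \<Rightarrow> 'b::euclidean_space) \<Rightarrow> ('a \<Rightarrow> 'b) \<Rightarrow> bool" where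
  "l2lim M F f \<longleftrightarrow> (\<lambda>n. LINT p|M. (norm (F n p - f p))\<^sup>2) \<longlonglongrightarrow> 0"

lemma sq_int_meas: "sq_int M f \<Longrightarrow> f \<in> borel_measurable M"
  and sq_int_integrable: "sq_int M f \<Longrightarrow> integrable M (\<lambda>p. (norm (f p))\<^sup>2)"
  by (auto simp: sq_int_def)

lemma norm_add_sq_le: "(norm (x + y :: 'b::real_inner))\<^sup>2 \<le> 2 * (norm x)\<^sup>2 + 2 * (norm y)\<^sup>2"
proof -
  have "0 \<le> (norm (x - y))\<^sup>2" by simp
  then show ?thesis
    unfolding power2_norm_eq_inner by (simp add: inner_simps inner_commute)
qed

lemma abs_inner_le_sq: "\<bar>(x :: 'b::real_inner) \<bullet> y\<bar> \<le> (norm x)\<^sup>2 + (norm y)\<^sup>2"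
proof -
  have "\<bar>x \<bullet> y\<bar> \<le> norm x * norm y" by (rule Cauchy_Schwarz_ineq2)
  also have "\<dots> \<le> (norm x)\<^sup>2 + (norm y)\<^sup>2"
    using sum_squares_bound[of "norm x" "norm y"] zero_le_power2[of "norm x"] zero_le_power2[of "norm y"]
      mult_nonneg_nonneg[OF norm_ge_zero[of x] norm_ge_zero[of y]] by linarith
  finally show ?thesis .
qed

lemma sq_int_bound:
  assumes "f \<in> borel_measurable M" "integrable M h" "AE p in M. (norm (f p))\<^sup>2 \<le> h p"
  shows "sq_int M f"
  unfolding sq_int_def
proof
  show "integrable M (\<lambda>p. (norm (f p))\<^sup>2)"
    by (rule Bochner_Integration.integrable_bound[OF assms(2)]) (use assms in auto)
qed (use assms in auto)

lemma sq_int_zero [simp]: "sq_int M (\<lambda>p. 0)"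
  by (simp add: sq_int_def)

lemma sq_int_add:
  assumes "sq_int M f" "sq_int M g"
  shows "sq_int M (\<lambda>p. f p + g p)"
proof (rule sq_int_bound)
  show "integrable M (\<lambda>p. 2 * (norm (f p))\<^sup>2 + 2 * (norm (g p))\<^sup>2)"
    using assms by (auto simp: sq_int_def)
qed (use assms in \<open>auto simp: sq_int_def norm_add_sq_le\<close>)

lemma sq_int_scaleR: "sq_int M f \<Longrightarrow> sq_int M (\<lambda>p. c *\<^sub>R f p)"
  by (auto simp: sq_int_def power_mult_distrib)

lemma sq_int_diff:
  assumes "sq_int M f" "sq_int M g"
  shows "sq_int M (\<lambda>p. f p - g p)"
  using sq_int_add[OF assms(1) sq_int_scaleR[OF assms(2), of "-1"]] by simp

lemma sq_int_minus: "sq_int M f \<Longrightarrow> sq_int M (\<lambda>p. - f p)"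
  using sq_int_scaleR[of M f "-1"] by simp

lemma integrable_sq_inner:
  assumes "sq_int M f" "sq_int M g"
  shows "integrable M (\<lambda>p. f p \<bullet> g p)"
proof (rule Bochner_Integration.integrable_bound)
  show "integrable M (\<lambda>p. (norm (f p))\<^sup>2 + (norm (g p))\<^sup>2)"
    using assms by (auto simp: sq_int_def)
qed (use assms in \<open>auto simp: sq_int_def abs_inner_le_sq\<close>)

lemma integrable_sq_scaleR:
  fixes f :: "'a \<Rightarrow> real"
  assumes "sq_int M f" "sq_int M g"
  shows "integrable M (\<lambda>p. f p *\<^sub>R g p)"
proof (rule Bochner_Integration.integrable_bound)
  show "integrable M (\<lambda>p. (norm (f p))\<^sup>2 + (norm (g p))\<^sup>2)"
    using assms by (auto simp: sq_int_def)
  show "AE p in M. norm (f p *\<^sub>R g p) \<le> norm ((norm (f p))\<^sup>2 + (norm (g p))\<^sup>2)"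
  proof (rule AE_I2)
    fix p
    show "norm (f p *\<^sub>R g p) \<le> norm ((norm (f p))\<^sup>2 + (norm (g p))\<^sup>2)"
      using abs_inner_le_sq[of "norm (f p)" "norm (g p)"] by (simp add: abs_mult)
  qed
qed (use assms in \<open>auto simp: sq_int_def\<close>)

lemma integrable_sq_mult:
  fixes f :: "'a \<Rightarrow> real"
  assumes "sq_int M f" "sq_int M g"
  shows "integrable M (\<lambda>p. f p * g p)"
  using integrable_sq_scaleR[OF assms] by simp

lemma sq_int_bdd_scaleR:
  assumes "sq_int M g" "h \<in> borel_measurable M" "AE p in M. \<bar>h p\<bar> \<le> C"
  shows "sq_int M (\<lambda>p. h p *\<^sub>R g p)"
proof (rule sq_int_bound)
  show "integrable M (\<lambda>p. C\<^sup>2 * (norm (g p))\<^sup>2)"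
    using assms by (auto simp: sq_int_def)
  show "AE p in M. (norm (h p *\<^sub>R g p))\<^sup>2 \<le> C\<^sup>2 * (norm (g p))\<^sup>2"
    using assms(3)
  proof eventually_elim
    case (elim p)
    then have "\<bar>h p\<bar>\<^sup>2 \<le> C\<^sup>2" by (intro power_mono) auto
    then show ?case by (simp add: power_mult_distrib mult_right_mono)
  qed
qed (use assms in \<open>auto simp: sq_int_def\<close>)

lemma integrable_bdd_mult:
  fixes f h :: "'a \<Rightarrow> real"
  assumes "integrable M f" "h \<in> borel_measurable M" "AE p in M. \<bar>h p\<bar> \<le> C"
  shows "integrable M (\<lambda>p. f p * h p)"
proof (rule Bochner_Integration.integrable_bound)
  show "integrable M (\<lambda>p. C * f p)" using assms by auto
  show "AE p in M. norm (f p * h p) \<le> norm (C * f p)"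
    using assms(3)
  proof eventually_elim
    case (elim p)
    then have "\<bar>h p\<bar> \<le> \<bar>C\<bar>" by linarith
    then have "\<bar>h p\<bar> * \<bar>f p\<bar> \<le> \<bar>C\<bar> * \<bar>f p\<bar>" by (rule mult_right_mono) simp
    then show ?case by (simp add: abs_mult mult.commute)
  qed
qed (use assms in auto)

lemma (in finite_measure) sq_int_bounded:
  assumes "f \<in> borel_measurable M" "AE p in M. norm (f p) \<le> C"
  shows "sq_int M f"
proof (rule sq_int_bound[OF assms(1)])
  show "integrable M (\<lambda>p. C\<^sup>2)" by simp
  show "AE p in M. (norm (f p))\<^sup>2 \<le> C\<^sup>2"
    using assms(2) by eventually_elim (intro power_mono, auto)
qed

lemma (in finite_measure) sq_int_imp_integrable:
  assumes "sq_int M f" shows "integrable M f"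
proof (rule Bochner_Integration.integrable_bound)
  show "integrable M (\<lambda>p. 1 + (norm (f p))\<^sup>2)"
    using assms by (auto simp: sq_int_def)
  show "AE p in M. norm (f p) \<le> norm (1 + (norm (f p))\<^sup>2)"
  proof (rule AE_I2)
    fix p
    have "0 \<le> (norm (f p) - 1)\<^sup>2" by simp
    then have "2 * norm (f p) \<le> 1 + (norm (f p))\<^sup>2" by (simp add: power2_diff)
    then have "norm (f p) \<le> 1 + (norm (f p))\<^sup>2" using norm_ge_zero[of "f p"] by linarith
    then show "norm (f p) \<le> norm (1 + (norm (f p))\<^sup>2)" by (rule order_trans) simp
  qed
qed (use assms in \<open>auto simp: sq_int_def\<close>)

lemma l2norm_nonneg [simp]: "0 \<le> l2norm M f"
  by (simp add: l2norm_def)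

lemma l2norm_power2: "(l2norm M f)\<^sup>2 = (LINT p|M. (norm (f p))\<^sup>2)"
  by (simp add: l2norm_def)

lemma l2_sq_add:
  assumes "sq_int M f" "sq_int M g"
  shows "(LINT p|M. (norm (f p + g p))\<^sup>2) =
    (LINT p|M. (norm (f p))\<^sup>2) + 2 * (LINT p|M. f p \<bullet> g p) + (LINT p|M. (norm (g p))\<^sup>2)"
proof -
  have "(norm (f p + g p))\<^sup>2 = (norm (f p))\<^sup>2 + 2 * (f p \<bullet> g p) + (norm (g p))\<^sup>2" for p
    by (simp add: power2_norm_eq_inner inner_simps inner_commute)
  then show ?thesis
    using assms integrable_sq_inner[OF assms] by (simp add: sq_int_integrable)
qed

lemma l2_sq_diff:
  assumes "sq_int M f" "sq_int M g"
  shows "(LINT p|M. (norm (f p - g p))\<^sup>2) =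
    (LINT p|M. (norm (f p))\<^sup>2) - 2 * (LINT p|M. f p \<bullet> g p) + (LINT p|M. (norm (g p))\<^sup>2)"
  using l2_sq_add[OF assms(1) sq_int_minus[OF assms(2)]] by simp

text \<open>The bound is the value at the minimum \<open>t = b / c\<close>; for \<open>c = 0\<close>
  an affine function of \<open>t\<close> that is bounded below is constant. It serves
  Cauchy--Schwarz and, with \<open>a = 0\<close>, the orthogonality of the residual of a
  projection.\<close>

lemma quadratic_nonneg_discriminant:
  fixes a b c :: real
  assumes quad: "\<And>t. 0 \<le> a - 2 * t * b + t\<^sup>2 * c" and c: "0 \<le> c"
  shows "b\<^sup>2 \<le> a * c"
proof (cases "c = 0")
  case True
  have "b = 0"
  proof (rule ccontr)
    assume "b \<noteq> 0"
    \<comment> \<open>At this \<open>t\<close> the affine function would equal -1.\<close>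
    then have "2 * ((a + 1) / (2 * b)) * b = a + 1" by simp
    then show False
      using quad[of "(a + 1) / (2 * b)"] True by simp
  qed
  then show ?thesis using True by simp
next
  case False
  then have pos: "c > 0" using c by linarith
  have "0 \<le> (a - 2 * (b / c) * b + (b / c)\<^sup>2 * c) * c"
    using quad[of "b / c"] c by (intro mult_nonneg_nonneg) auto
  also have "(a - 2 * (b / c) * b + (b / c)\<^sup>2 * c) * c = a * c - b\<^sup>2"
    using pos by (simp add: field_simps power2_eq_square)
  finally show ?thesis by simp
qed

lemma l2_cauchy_schwarz:
  assumes "sq_int M f" "sq_int M g"
  shows "\<bar>LINT p|M. f p \<bullet> g p\<bar> \<le> l2norm M f * l2norm M g"
proof -
  have "(LINT p|M. f p \<bullet> g p)\<^sup>2 \<le> (LINT p|M. (norm (f p))\<^sup>2) * (LINT p|M. (norm (g p))\<^sup>2)"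
  proof (rule quadratic_nonneg_discriminant)
    fix t :: real
    have "0 \<le> (LINT p|M. (norm (f p - t *\<^sub>R g p))\<^sup>2)" by simp
    then show "0 \<le> (LINT p|M. (norm (f p))\<^sup>2) - 2 * t * (LINT p|M. f p \<bullet> g p)
        + t\<^sup>2 * (LINT p|M. (norm (g p))\<^sup>2)"
      using l2_sq_diff[OF assms(1) sq_int_scaleR[OF assms(2), of t]]
      by (simp add: power_mult_distrib)
  qed simp
  then have "sqrt ((LINT p|M. f p \<bullet> g p)\<^sup>2)
      \<le> sqrt ((LINT p|M. (norm (f p))\<^sup>2) * (LINT p|M. (norm (g p))\<^sup>2))"
    by (rule real_sqrt_le_mono)
  then show ?thesis by (simp only: l2norm_def real_sqrt_mult real_sqrt_abs)
qed

lemma l2norm_triangle: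
  assumes "sq_int M f" "sq_int M g"
  shows "l2norm M (\<lambda>p. f p + g p) \<le> l2norm M f + l2norm M g"
proof (rule power2_le_imp_le)
  show "(l2norm M (\<lambda>p. f p + g p))\<^sup>2 \<le> (l2norm M f + l2norm M g)\<^sup>2"
    using l2_cauchy_schwarz[OF assms] abs_ge_self[of "LINT p|M. f p \<bullet> g p"]
    unfolding power2_sum l2norm_power2 l2_sq_add[OF assms] by linarith
qed simp

lemma l2norm_scaleR: "l2norm M (\<lambda>p. c *\<^sub>R f p) = \<bar>c\<bar> * l2norm M f"
  by (simp add: l2norm_def power_mult_distrib real_sqrt_mult)

lemma l2norm_commute: "l2norm M (\<lambda>p. f p - g p) = l2norm M (\<lambda>p. g p - f p)"
  by (simp add: l2norm_def norm_minus_commute)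

lemma l2norm_triangle_diff:
  assumes "sq_int M f" "sq_int M g" "sq_int M h"
  shows "l2norm M (\<lambda>p. f p - h p) \<le> l2norm M (\<lambda>p. f p - g p) + l2norm M (\<lambda>p. g p - h p)"
  using l2norm_triangle[OF sq_int_diff[OF assms(1,2)] sq_int_diff[OF assms(2,3)]] by simp

lemma l2lim_iff: "l2lim M F f \<longleftrightarrow> (\<lambda>n. l2norm M (\<lambda>p. F n p - f p)) \<longlonglongrightarrow> 0"
proof
  assume "l2lim M F f"
  then show "(\<lambda>n. l2norm M (\<lambda>p. F n p - f p)) \<longlonglongrightarrow> 0"
    unfolding l2lim_def l2norm_def using tendsto_real_sqrt by fastforce
next
  assume "(\<lambda>n. l2norm M (\<lambda>p. F n p - f p)) \<longlonglongrightarrow> 0"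
  then have "(\<lambda>n. (l2norm M (\<lambda>p. F n p - f p))\<^sup>2) \<longlonglongrightarrow> 0\<^sup>2" by (rule tendsto_power)
  then show "l2lim M F f" unfolding l2lim_def l2norm_power2 by simp
qed

lemma l2lim_const: "l2lim M (\<lambda>n. f) f"
  by (simp add: l2lim_def)

lemma l2lim_subseq: "l2lim M F f \<Longrightarrow> strict_mono r \<Longrightarrow> l2lim M (\<lambda>n. F (r n)) f"
  unfolding l2lim_def using LIMSEQ_subseq_LIMSEQ by (fastforce simp: o_def)

lemma l2lim_add:
  assumes "\<And>n. sq_int M (F n)" "\<And>n. sq_int M (G n)" "sq_int M f" "sq_int M g"
    and "l2lim M F f" "l2lim M G g"
  shows "l2lim M (\<lambda>n p. F n p + G n p) (\<lambda>p. f p + g p)"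
  unfolding l2lim_iff
proof (rule Lim_null_comparison[OF always_eventually])
  have "(\<lambda>n. l2norm M (\<lambda>p. F n p - f p) + l2norm M (\<lambda>p. G n p - g p)) \<longlonglongrightarrow> 0 + 0"
    using assms(5,6) unfolding l2lim_iff by (rule tendsto_add)
  then show "(\<lambda>n. l2norm M (\<lambda>p. F n p - f p) + l2norm M (\<lambda>p. G n p - g p)) \<longlonglongrightarrow> 0" by simp
  show "\<forall>n. norm (l2norm M (\<lambda>p. F n p + G n p - (f p + g p)))
      \<le> l2norm M (\<lambda>p. F n p - f p) + l2norm M (\<lambda>p. G n p - g p)"
    using l2norm_triangle[OF sq_int_diff[OF assms(1,3)] sq_int_diff[OF assms(2,4)]]
    by (simp add: algebra_simps)
qed

lemma l2lim_scaleR: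
  assumes "l2lim M F f"
  shows "l2lim M (\<lambda>n p. c *\<^sub>R F n p) (\<lambda>p. c *\<^sub>R f p)"
proof -
  have "l2norm M (\<lambda>p. c *\<^sub>R F n p - c *\<^sub>R f p) = \<bar>c\<bar> * l2norm M (\<lambda>p. F n p - f p)" for n
    by (simp add: l2norm_scaleR flip: scaleR_diff_right)
  then show ?thesis
    using tendsto_mult_left[OF assms[unfolded l2lim_iff], of "\<bar>c\<bar>"] by (simp add: l2lim_iff)
qed

lemma l2lim_inner:
  assumes "\<And>n. sq_int M (F n)" "sq_int M f" "sq_int M h" "l2lim M F f"
  shows "(\<lambda>n. LINT p|M. h p \<bullet> F n p) \<longlonglongrightarrow> (LINT p|M. h p \<bullet> f p)"
proof (rule LIM_zero_cancel, rule Lim_null_comparison[OF always_eventually])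
  show "\<forall>n. norm ((LINT p|M. h p \<bullet> F n p) - (LINT p|M. h p \<bullet> f p)) \<le> l2norm M h * l2norm M (\<lambda>p. F n p - f p)"
  proof
    fix n
    have "(LINT p|M. h p \<bullet> F n p) - (LINT p|M. h p \<bullet> f p) = (LINT p|M. h p \<bullet> (F n p - f p))"
      using integrable_sq_inner[OF assms(3,1)] integrable_sq_inner[OF assms(3,2)]
      by (simp add: inner_simps)
    then show "norm ((LINT p|M. h p \<bullet> F n p) - (LINT p|M. h p \<bullet> f p)) \<le> l2norm M h * l2norm M (\<lambda>p. F n p - f p)"
      using l2_cauchy_schwarz[OF assms(3) sq_int_diff[OF assms(1,2)]] by simp
  qed
  show "(\<lambda>n. l2norm M h * l2norm M (\<lambda>p. F n p - f p)) \<longlonglongrightarrow> 0"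
    using assms(4) unfolding l2lim_iff by (rule tendsto_mult_right_zero)
qed

lemma l2lim_l2norm:
  assumes "\<And>n. sq_int M (F n)" "sq_int M f" "l2lim M F f"
  shows "(\<lambda>n. l2norm M (F n)) \<longlonglongrightarrow> l2norm M f"
proof (rule LIM_zero_cancel, rule Lim_null_comparison[OF always_eventually])
  show "\<forall>n. norm (l2norm M (F n) - l2norm M f) \<le> l2norm M (\<lambda>p. F n p - f p)"
  proof
    fix n
    show "norm (l2norm M (F n) - l2norm M f) \<le> l2norm M (\<lambda>p. F n p - f p)"
      using l2norm_triangle[OF sq_int_diff[OF assms(1,2), of n] assms(2)]
        l2norm_triangle[OF sq_int_diff[OF assms(2,1), of n] assms(1)[of n]]
      by (simp add: l2norm_commute[of M f "F n"] abs_le_iff)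
  qed
  show "(\<lambda>n. l2norm M (\<lambda>p. F n p - f p)) \<longlonglongrightarrow> 0"
    using assms(3) unfolding l2lim_iff .
qed

section \<open>Almost everywhere limits, completeness and projection in L2\<close>

lemma l2_zero_AE:
  assumes "sq_int M f" "(LINT p|M. (norm (f p))\<^sup>2) = 0"
  shows "AE p in M. f p = 0"
  using assms integral_nonneg_eq_0_iff_AE[of M "\<lambda>p. (norm (f p))\<^sup>2"] by (auto simp: sq_int_def)

lemma l2lim_AE_subseq:
  assumes "\<And>n. sq_int M (F n)" "sq_int M f" "l2lim M F f"
  obtains r :: "nat \<Rightarrow> nat" where "strict_mono r" "AE p in M. (\<lambda>n. F (r n) p) \<longlonglongrightarrow> f p"
proof -
  have "\<exists>r::nat\<Rightarrow>nat. strict_mono r \<and> (AE x in M. (\<lambda>n. (norm (F (r n) x - f x))\<^sup>2) \<longlonglongrightarrow> 0)"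
  proof (rule tendsto_L1_AE_subseq)
    show "integrable M (\<lambda>x. (norm (F n x - f x))\<^sup>2)" for n
      using sq_int_diff[OF assms(1,2)] by (rule sq_int_integrable)
  qed (use assms(3) in \<open>auto simp: l2lim_def\<close>)
  then obtain r :: "nat \<Rightarrow> nat" where r: "strict_mono r" "AE x in M. (\<lambda>n. (norm (F (r n) x - f x))\<^sup>2) \<longlonglongrightarrow> 0"
    by blast
  have "AE p in M. (\<lambda>n. F (r n) p) \<longlonglongrightarrow> f p"
    using r(2)
  proof eventually_elim
    case (elim x)
    then have "(\<lambda>n. sqrt ((norm (F (r n) x - f x))\<^sup>2)) \<longlonglongrightarrow> sqrt 0" by (rule tendsto_real_sqrt)
    then show ?case by (auto intro: LIM_zero_cancel simp: tendsto_norm_zero_iff)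
  qed
  with r(1) that show ?thesis by blast
qed

text \<open>Riesz--Fischer. Along a fast subsequence the successive differences have summable L2
  norms. On a finite measure space the constant 1 is square integrable, so the L1 norms are summable
  too and the subsequence converges a.e. Fatou's lemma then turns the a.e. limit into an L2 limit of
  the whole sequence.\<close>

lemma (in finite_measure) l2_complete:
  fixes F :: "nat \<Rightarrow> 'a \<Rightarrow> 'b::euclidean_space"
  assumes F: "\<And>n. sq_int M (F n)"
    and cauchy: "\<And>e. e > 0 \<Longrightarrow> \<exists>N. \<forall>m\<ge>N. \<forall>n\<ge>N. l2norm M (\<lambda>p. F m p - F n p) < e"
  obtains f where "sq_int M f" "l2lim M F f"
proof -
  note [measurable] = sq_int_meas[OF F]
  define N where "N k = (SOME N. \<forall>m\<ge>N. \<forall>n\<ge>N. l2norm M (\<lambda>p. F m p - F n p) < (1/2)^k)" for k :: nat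
  have N: "l2norm M (\<lambda>p. F m p - F n p) < (1/2)^k" if "m \<ge> N k" "n \<ge> N k" for m n k
    using someI_ex[OF cauchy[of "(1/2)^k"]] that unfolding N_def by auto
  \<comment> \<open>The summand \<open>k\<close> makes \<open>r\<close> strictly increasing, and the
    sum keeps \<open>r k\<close> above \<open>N k\<close>.\<close>
  define r where "r k = k + (\<Sum>j\<le>k. N j)" for k
  have r_mono: "strict_mono r" by (rule strict_monoI_Suc) (simp add: r_def)
  have rN: "r k \<ge> N k" for k
    using member_le_sum[of k "{..k}" N] by (simp add: r_def trans_le_add2)
  define D where "D k p = F (r (Suc k)) p - F (r k) p" for k p
  have D: "sq_int M (D k)" for k unfolding D_def using F by (intro sq_int_diff)
  have Dk: "l2norm M (D k) \<le> (1/2)^k" for k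
  proof -
    have "r (Suc k) \<ge> N k" using rN[of k] strict_mono_less[OF r_mono, of k "Suc k"] by linarith
    then show ?thesis unfolding D_def using N[OF _ rN] by (simp add: less_imp_le)
  qed
  let ?C = "l2norm M (\<lambda>p. 1::real)"
  have intD: "(LINT p|M. norm (D k p)) \<le> ?C * (1/2)^k" for k
  proof -
    have "sq_int M (\<lambda>p. norm (D k p))" using D[of k] by (auto simp: sq_int_def)
    moreover have "sq_int M (\<lambda>p. 1::real)" by (rule sq_int_bounded[of _ 1]) auto
    ultimately have "(LINT p|M. norm (D k p)) \<le> ?C * l2norm M (\<lambda>p. norm (D k p))"
      using l2_cauchy_schwarz[of M "\<lambda>p. 1::real" "\<lambda>p. norm (D k p)"] by simp
    also have "\<dots> = ?C * l2norm M (D k)" by (simp add: l2norm_def)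
    also have "\<dots> \<le> ?C * (1/2)^k" by (intro mult_left_mono Dk) auto
    finally show ?thesis .
  qed
  have "(\<integral>\<^sup>+p. (\<Sum>k. ennreal (norm (D k p))) \<partial>M) = (\<Sum>k. \<integral>\<^sup>+p. ennreal (norm (D k p)) \<partial>M)"
    by (intro nn_integral_suminf) (auto simp: D_def)
  also have "\<dots> \<le> (\<Sum>k. ennreal (?C * (1/2)^k))"
  proof (intro suminf_le allI)
    fix k
    have "(\<integral>\<^sup>+p. ennreal (norm (D k p)) \<partial>M) = ennreal (LINT p|M. norm (D k p))"
      using sq_int_imp_integrable[OF D[of k]] by (intro nn_integral_eq_integral) auto
    then show "(\<integral>\<^sup>+p. ennreal (norm (D k p)) \<partial>M) \<le> ennreal (?C * (1/2)^k)"
      using intD[of k] by (simp add: ennreal_leI)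
  qed auto
  also have "\<dots> = ennreal (\<Sum>k. ?C * (1/2)^k)"
    by (rule suminf_ennreal2) (auto intro!: summable_mult summable_geometric)
  also have "\<dots> < \<infinity>" by simp
  finally have "AE p in M. (\<Sum>k. ennreal (norm (D k p))) \<noteq> \<infinity>"
    by (intro nn_integral_PInf_AE) (auto simp: D_def)
  then have conv: "AE p in M. convergent (\<lambda>k. F (r k) p)"
  proof eventually_elim
    case (elim p)
    then have "summable (\<lambda>k. norm (D k p))" by (intro summable_suminf_not_top) auto
    then have "summable (\<lambda>k. D k p)" by (rule summable_norm_cancel)
    then have "convergent (\<lambda>n. F (r 0) p + (\<Sum>k<n. D k p))"
      by (intro convergent_add convergent_const) (simp add: summable_iff_convergent)
    moreover have "F (r 0) p + (\<Sum>k<n. D k p) = F (r n) p" for n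
      using sum_lessThan_telescope[of "\<lambda>k. F (r k) p" n] by (simp add: D_def)
    ultimately show ?case by simp
  qed
  define f where "f p = lim (\<lambda>k. F (r k) p)" for p
  have lim: "AE p in M. (\<lambda>k. F (r k) p) \<longlonglongrightarrow> f p"
    using conv by eventually_elim (simp add: f_def convergent_LIMSEQ_iff)
  have [measurable]: "f \<in> borel_measurable M"
    unfolding f_def by (rule borel_measurable_lim_metric) simp
  \<comment> \<open>A bound on the distance from \<open>F n\<close> to all late terms survives the
    a.e. limit; it is stated with nonnegative integrals because integrability of the limit is not
    yet known.\<close>
  have fatou: "(\<integral>\<^sup>+p. ennreal ((norm (F n p - f p))\<^sup>2) \<partial>M) \<le> ennreal (e\<^sup>2)"
    if n: "\<And>m. m \<ge> K \<Longrightarrow> l2norm M (\<lambda>p. F n p - F m p) \<le> e" for n K e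
  proof -
    have "(\<integral>\<^sup>+p. ennreal ((norm (F n p - f p))\<^sup>2) \<partial>M)
        = (\<integral>\<^sup>+p. liminf (\<lambda>k. ennreal ((norm (F n p - F (r k) p))\<^sup>2)) \<partial>M)"
    proof (rule nn_integral_cong_AE)
      show "AE p in M. ennreal ((norm (F n p - f p))\<^sup>2) = liminf (\<lambda>k. ennreal ((norm (F n p - F (r k) p))\<^sup>2))"
        using lim
      proof eventually_elim
        case (elim p)
        then have "(\<lambda>k. ennreal ((norm (F n p - F (r k) p))\<^sup>2)) \<longlonglongrightarrow> ennreal ((norm (F n p - f p))\<^sup>2)"
          by (intro tendsto_intros)
        then show ?case by (rule lim_imp_Liminf[OF sequentially_bot, symmetric])
      qed
    qed
    also have "\<dots> \<le> liminf (\<lambda>k. \<integral>\<^sup>+p. ennreal ((norm (F n p - F (r k) p))\<^sup>2) \<partial>M)"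
      by (rule nn_integral_liminf) measurable
    also have "\<dots> \<le> ennreal (e\<^sup>2)"
    proof (rule Liminf_le)
      show "\<forall>\<^sub>F k in sequentially. (\<integral>\<^sup>+p. ennreal ((norm (F n p - F (r k) p))\<^sup>2) \<partial>M) \<le> ennreal (e\<^sup>2)"
        unfolding eventually_sequentially
      proof (intro exI allI impI)
        fix k assume "K \<le> k"
        then have "r k \<ge> K" using seq_suble[OF r_mono, of k] by linarith
        then have "(l2norm M (\<lambda>p. F n p - F (r k) p))\<^sup>2 \<le> e\<^sup>2"
          by (intro power_mono n) auto
        moreover have "(\<integral>\<^sup>+p. ennreal ((norm (F n p - F (r k) p))\<^sup>2) \<partial>M)
            = ennreal (LINT p|M. (norm (F n p - F (r k) p))\<^sup>2)"
          using sq_int_integrable[OF sq_int_diff[OF F F]] by (intro nn_integral_eq_integral) auto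
        ultimately show "(\<integral>\<^sup>+p. ennreal ((norm (F n p - F (r k) p))\<^sup>2) \<partial>M) \<le> ennreal (e\<^sup>2)"
          by (simp add: l2norm_power2 ennreal_leI)
      qed
    qed simp
    finally show ?thesis .
  qed
  have diff: "sq_int M (\<lambda>p. F n p - f p) \<and> l2norm M (\<lambda>p. F n p - f p) \<le> e"
    if n: "\<And>m. m \<ge> K \<Longrightarrow> l2norm M (\<lambda>p. F n p - F m p) \<le> e" for n K e
  proof
    have e: "0 \<le> e" using n[of K] l2norm_nonneg order_trans by blast
    have *: "(\<integral>\<^sup>+p. ennreal ((norm (F n p - f p))\<^sup>2) \<partial>M) \<le> ennreal (e\<^sup>2)" by (rule fatou[OF n])
    have int: "integrable M (\<lambda>p. (norm (F n p - f p))\<^sup>2)"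
    proof (rule integrableI_bounded)
      show "(\<integral>\<^sup>+p. ennreal (norm ((norm (F n p - f p))\<^sup>2)) \<partial>M) < \<infinity>"
        using * by (simp add: le_less_trans)
    qed simp
    then show "sq_int M (\<lambda>p. F n p - f p)" by (simp add: sq_int_def)
    have "(LINT p|M. (norm (F n p - f p))\<^sup>2) \<le> e\<^sup>2"
      using * nn_integral_eq_integral[OF int] by (simp add: ennreal_le_iff)
    then have "sqrt (LINT p|M. (norm (F n p - f p))\<^sup>2) \<le> sqrt (e\<^sup>2)" by (rule real_sqrt_le_mono)
    then show "l2norm M (\<lambda>p. F n p - f p) \<le> e" using e by (simp add: l2norm_def)
  qed
  have f: "sq_int M f"
  proof -
    \<comment> \<open>Only differences with \<open>f\<close> have been controlled, so
      \<open>f\<close> is recovered by subtraction; the bound 1 is \<open>(1/2)^0\<close>.\<close>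
    have "sq_int M (\<lambda>p. F (N 0) p - f p)"
      using diff[of "N 0" "N 0" 1] N[of 0 "N 0"] by (simp add: less_imp_le)
    then have "sq_int M (\<lambda>p. F (N 0) p - (F (N 0) p - f p))" by (rule sq_int_diff[OF F])
    then show ?thesis by simp
  qed
  moreover have "l2lim M F f"
    unfolding l2lim_iff
  proof (rule LIMSEQ_I)
    fix e :: real assume "e > 0"
    then obtain K where K: "\<forall>m\<ge>K. \<forall>n\<ge>K. l2norm M (\<lambda>p. F m p - F n p) < e/2"
      using cauchy[of "e/2"] by auto
    have "norm (l2norm M (\<lambda>p. F n p - f p) - 0) < e" if "n \<ge> K" for n
    proof -
      have "l2norm M (\<lambda>p. F n p - f p) \<le> e/2"
        using diff[of K n "e/2"] K that by (simp add: less_imp_le)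
      then show ?thesis using \<open>e > 0\<close> by simp
    qed
    then show "\<exists>no. \<forall>n\<ge>no. norm (l2norm M (\<lambda>p. F n p - f p) - 0) < e" by blast
  qed
  ultimately show ?thesis using that by blast
qed

text \<open>A closed subspace of L2, but a set of functions instead of classes: the last clause
  admits every representative of a limit, so membership is stable under a.e. changes.\<close>

definition l2_subspace :: "'a measure \<Rightarrow> ('a \<Rightarrow> 'b::euclidean_space) set \<Rightarrow> bool" where
  "l2_subspace M D \<longleftrightarrow> (\<forall>X\<in>D. sq_int M X) \<and> (\<lambda>p. 0) \<in> D \<and>
     (\<forall>X\<in>D. \<forall>Y\<in>D. (\<lambda>p. X p + Y p) \<in> D) \<and> (\<forall>X\<in>D. \<forall>c. (\<lambda>p. c *\<^sub>R X p) \<in> D) \<and>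
     (\<forall>F f. (\<forall>n. F n \<in> D) \<and> sq_int M f \<and> l2lim M F f \<longrightarrow> f \<in> D)"

lemma l2_subspaceI:
  assumes "\<And>X. X \<in> D \<Longrightarrow> sq_int M X" "(\<lambda>p. 0) \<in> D"
    and "\<And>X Y. X \<in> D \<Longrightarrow> Y \<in> D \<Longrightarrow> (\<lambda>p. X p + Y p) \<in> D"
    and "\<And>X c. X \<in> D \<Longrightarrow> (\<lambda>p. c *\<^sub>R X p) \<in> D"
    and "\<And>F f. (\<And>n. F n \<in> D) \<Longrightarrow> sq_int M f \<Longrightarrow> l2lim M F f \<Longrightarrow> f \<in> D"
  shows "l2_subspace M D"
  unfolding l2_subspace_def
proof (intro conjI ballI allI impI)
  fix F f assume "(\<forall>n. F n \<in> D) \<and> sq_int M f \<and> l2lim M F f"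
  then show "f \<in> D" by (elim conjE) (rule assms(5), erule spec)
qed (erule assms(1), rule assms(2), erule (1) assms(3), erule assms(4))

lemma l2_subspaceD:
  assumes "l2_subspace M D"
  shows "X \<in> D \<Longrightarrow> sq_int M X"
    and "(\<lambda>p. 0) \<in> D"
    and "X \<in> D \<Longrightarrow> Y \<in> D \<Longrightarrow> (\<lambda>p. X p + Y p) \<in> D"
    and "X \<in> D \<Longrightarrow> (\<lambda>p. c *\<^sub>R X p) \<in> D"
    and "(\<And>n. F n \<in> D) \<Longrightarrow> sq_int M f \<Longrightarrow> l2lim M F f \<Longrightarrow> f \<in> D"
proof -
  note D = assms[unfolded l2_subspace_def]
  show "X \<in> D \<Longrightarrow> sq_int M X" by (rule bspec[OF conjunct1[OF D]])
  show "(\<lambda>p. 0) \<in> D" by (rule conjunct1[OF conjunct2[OF D]])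
  show "X \<in> D \<Longrightarrow> Y \<in> D \<Longrightarrow> (\<lambda>p. X p + Y p) \<in> D"
    by (rule bspec[OF bspec[OF conjunct1[OF conjunct2[OF conjunct2[OF D]]]]])
  show "X \<in> D \<Longrightarrow> (\<lambda>p. c *\<^sub>R X p) \<in> D"
    by (rule spec[OF bspec[OF conjunct1[OF conjunct2[OF conjunct2[OF conjunct2[OF D]]]]]])
  show "(\<And>n. F n \<in> D) \<Longrightarrow> sq_int M f \<Longrightarrow> l2lim M F f \<Longrightarrow> f \<in> D"
    by (rule mp[OF spec[OF spec[OF conjunct2[OF conjunct2[OF conjunct2[OF conjunct2[OF D]]]]]]])
      (intro conjI allI)
qed

text \<open>The parallelogram law makes a minimising sequence of the distance to \<open>A\<close> a
  Cauchy sequence. At the minimiser the distance along any line in \<open>D\<close> is a quadratic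
  without decrease, which forces its linear coefficient to vanish.\<close>

lemma (in finite_measure) l2_projection:
  fixes D :: "('a \<Rightarrow> 'b::euclidean_space) set"
  assumes D: "l2_subspace M D" and A: "sq_int M A"
  obtains X where "X \<in> D" "\<And>Y. Y \<in> D \<Longrightarrow> (LINT p|M. A p \<bullet> Y p) = (LINT p|M. X p \<bullet> Y p)"
proof -
  note sq = l2_subspaceD(1)[OF D] and add = l2_subspaceD(3)[OF D] and scale = l2_subspaceD(4)[OF D]
  define q where "q X = (l2norm M (\<lambda>p. A p - X p))\<^sup>2" for X
  define d where "d = Inf (q ` D)"
  have bdd: "bdd_below (q ` D)" by (rule bdd_belowI[of _ 0]) (auto simp: q_def)
  have ne: "q ` D \<noteq> {}" using l2_subspaceD(2)[OF D] by blast
  have dle: "d \<le> q X" if "X \<in> D" for X unfolding d_def by (rule cInf_lower[OF _ bdd]) (use that in auto)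
  have "\<exists>X\<in>D. q X < d + 1 / real (Suc n)" for n
    using cInf_lessD[OF ne, of "d + 1 / real (Suc n)"] by (auto simp: d_def)
  then obtain X where XD: "\<And>n. X n \<in> D" and Xq: "\<And>n. q (X n) < d + 1 / real (Suc n)" by metis
  have par: "(l2norm M (\<lambda>p. X m p - X n p))\<^sup>2 \<le> 2 / real (Suc m) + 2 / real (Suc n)" for m n
  proof -
    let ?a = "\<lambda>p. A p - X m p" and ?b = "\<lambda>p. A p - X n p"
    \<comment> \<open>The two residuals add up to twice the residual of the midpoint
      \<open>?Z\<close>, which lies in \<open>D\<close>; hence the squared norm of the sum is at
      least \<open>4 * d\<close>.\<close>
    let ?Z = "\<lambda>p. (1/2) *\<^sub>R (X m p + X n p)"
    have a: "sq_int M ?a" "sq_int M ?b" using A sq[OF XD] by (auto intro: sq_int_diff)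
    have ZD: "?Z \<in> D" by (intro scale add XD)
    have "(\<lambda>p. ?a p + ?b p) = (\<lambda>p. 2 *\<^sub>R (A p - ?Z p))"
      by (auto simp: algebra_simps scaleR_2)
    then have "(l2norm M (\<lambda>p. ?a p + ?b p))\<^sup>2 = 4 * q ?Z"
      by (simp add: l2norm_scaleR q_def power_mult_distrib)
    then have 1: "4 * d \<le> (l2norm M (\<lambda>p. ?a p + ?b p))\<^sup>2" using dle[OF ZD] by simp
    have "(l2norm M (\<lambda>p. ?b p - ?a p))\<^sup>2 + (l2norm M (\<lambda>p. ?a p + ?b p))\<^sup>2 = 2 * q (X m) + 2 * q (X n)"
      using l2_sq_add[OF a] l2_sq_diff[OF a(2,1)]
      by (simp add: l2norm_power2 q_def inner_commute)
    moreover have "(\<lambda>p. ?b p - ?a p) = (\<lambda>p. X m p - X n p)" by auto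
    ultimately show ?thesis using 1 Xq[of m] Xq[of n] by simp
  qed
  obtain Y where Y: "sq_int M Y" "l2lim M X Y"
  proof (rule l2_complete[of X])
    fix e :: real assume "e > 0"
    \<comment> \<open>For indices beyond \<open>N\<close> the two terms in \<open>par\<close> are at
      most \<open>2 / N\<close> each.\<close>
    then obtain N where N: "4 / e\<^sup>2 < real N" using reals_Archimedean2 by blast
    have "l2norm M (\<lambda>p. X m p - X n p) < e" if "m \<ge> N" "n \<ge> N" for m n
    proof (rule power2_less_imp_less)
      have Npos: "real N > 0" using N \<open>e > 0\<close> by (meson divide_pos_pos order_less_trans zero_less_numeral zero_less_power)
      have "2 / real (Suc m) \<le> 2 / real N" "2 / real (Suc n) \<le> 2 / real N"
        using that Npos by (auto intro!: divide_left_mono)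
      moreover have "4 / real N < e\<^sup>2" using N Npos \<open>e > 0\<close> by (simp add: field_simps)
      ultimately show "(l2norm M (\<lambda>p. X m p - X n p))\<^sup>2 < e\<^sup>2" using par[of m n] by simp
    qed (use \<open>e > 0\<close> in simp)
    then show "\<exists>N. \<forall>m\<ge>N. \<forall>n\<ge>N. l2norm M (\<lambda>p. X m p - X n p) < e" by blast
  qed (use sq[OF XD] in auto)
  have YD: "Y \<in> D" by (rule l2_subspaceD(5)[OF D XD Y])
  have qY: "q Y = d"
  proof -
    have l: "l2lim M (\<lambda>n p. A p + (-1) *\<^sub>R X n p) (\<lambda>p. A p + (-1) *\<^sub>R Y p)"
      using A Y sq[OF XD] by (intro l2lim_add l2lim_const l2lim_scaleR sq_int_scaleR)
    have "(\<lambda>n. l2norm M (\<lambda>p. A p + (-1) *\<^sub>R X n p)) \<longlonglongrightarrow> l2norm M (\<lambda>p. A p + (-1) *\<^sub>R Y p)"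
      by (rule l2lim_l2norm[OF _ _ l]) (use A Y sq[OF XD] in \<open>auto intro!: sq_int_diff\<close>)
    then have 1: "(\<lambda>n. q (X n)) \<longlonglongrightarrow> q Y" unfolding q_def by (intro tendsto_power) simp
    have 2: "(\<lambda>n. d + 1 / real (Suc n)) \<longlonglongrightarrow> d + 0"
      by (intro tendsto_add tendsto_const LIMSEQ_Suc[OF lim_1_over_n])
    have "q Y \<le> d" using LIMSEQ_le[OF 1 2] Xq by (auto intro: less_imp_le)
    then show ?thesis using dle[OF YD] by simp
  qed
  have "(LINT p|M. A p \<bullet> Z p) = (LINT p|M. Y p \<bullet> Z p)" if Z: "Z \<in> D" for Z
  proof -
    have sAY: "sq_int M (\<lambda>p. A p - Y p)" using A Y(1) by (rule sq_int_diff)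
    let ?b = "LINT p|M. (A p - Y p) \<bullet> Z p"
    have "?b\<^sup>2 \<le> 0 * (LINT p|M. (norm (Z p))\<^sup>2)"
    proof (rule quadratic_nonneg_discriminant)
      fix t :: real
      have "d \<le> q (\<lambda>p. Y p + t *\<^sub>R Z p)" by (intro dle add scale YD Z)
      also have "\<dots> = (LINT p|M. (norm ((A p - Y p) - t *\<^sub>R Z p))\<^sup>2)"
        by (simp add: q_def l2norm_power2 algebra_simps)
      also have "\<dots> = q Y - 2 * t * ?b + t\<^sup>2 * (LINT p|M. (norm (Z p))\<^sup>2)"
        using l2_sq_diff[OF sAY sq_int_scaleR[OF sq[OF Z], of t]]
        by (simp add: q_def l2norm_power2 power_mult_distrib)
      finally show "0 \<le> 0 - 2 * t * ?b + t\<^sup>2 * (LINT p|M. (norm (Z p))\<^sup>2)" using qY by simp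
    qed simp
    then have "?b = 0" by simp
    then show ?thesis
      using integrable_sq_inner[OF A sq[OF Z]] integrable_sq_inner[OF Y(1) sq[OF Z]]
      by (simp add: inner_diff_left)
  qed
  then show ?thesis using that YD by blast
qed

section \<open>Smooth functions\<close>

text \<open>\<open>grad3\<close> is read off \<open>frechet_derivative\<close>, which is informative
  only where a derivative exists. A gradient asserted as a derivative can be assembled by calculus
  rules and converted to \<open>grad3\<close> afterwards.\<close>

definition has_grad :: "(pt \<Rightarrow> real) \<Rightarrow> pt \<Rightarrow> pt \<Rightarrow> bool" where
  "has_grad f g p \<longleftrightarrow> (f has_derivative (\<lambda>h. g \<bullet> h)) (at p)"

lemma inner_pt: "(a, b, c) \<bullet> (h :: pt) = a * fst h + b * fst (snd h) + c * snd (snd h)"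
  by (cases h) (simp add: inner_Pair)

lemma has_grad_imp_grad3: "has_grad f g p \<Longrightarrow> grad3 f p = g"
  unfolding has_grad_def grad3_def
  by (cases g) (auto simp: Let_def inner_Pair dest!: frechet_derivative_at[symmetric])

lemma has_grad_add: "has_grad f a p \<Longrightarrow> has_grad g b p \<Longrightarrow> has_grad (\<lambda>p. f p + g p) (a + b) p"
  unfolding has_grad_def by (auto intro!: derivative_eq_intros simp: inner_simps)

lemma has_grad_mult:
  "has_grad f a p \<Longrightarrow> has_grad g b p \<Longrightarrow> has_grad (\<lambda>p. f p * g p) (g p *\<^sub>R a + f p *\<^sub>R b) p"
  unfolding has_grad_def by (auto intro!: derivative_eq_intros simp: inner_simps algebra_simps)

lemma has_grad_const: "has_grad (\<lambda>p. c) 0 p"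
proof -
  have "((\<lambda>p. c) has_derivative (\<lambda>h. 0)) (at p)" by (rule has_derivative_const)
  then show ?thesis by (simp add: has_grad_def)
qed

lemma has_grad_compose:
  assumes "(S has_real_derivative s) (at (f p))" "has_grad f a p"
  shows "has_grad (\<lambda>p. S (f p)) (s *\<^sub>R a) p"
proof -
  have "((\<lambda>p. S (f p)) has_derivative (\<lambda>h. s * (a \<bullet> h))) (at p)"
    using has_derivative_compose[of f "\<lambda>h. a \<bullet> h" p UNIV S "(*) s"] assms
    by (simp add: has_grad_def has_field_derivative_def)
  then show ?thesis by (simp add: has_grad_def)
qed

definition smooth1 :: "(real \<Rightarrow> real) \<Rightarrow> bool" where
  "smooth1 S \<longleftrightarrow> (\<exists>D. D 0 = S \<and> (\<forall>n t. (D n has_real_derivative D (Suc n) t) (at t)))"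

text \<open>Iterating a chosen derivative never leaves a class that is closed under differentiation,
  so no formula for the higher derivatives is required.\<close>

lemma smooth1_coinduct:
  assumes "P S" and step: "\<And>S. P S \<Longrightarrow> \<exists>S'. P S' \<and> (\<forall>t. (S has_real_derivative S' t) (at t))"
  shows "smooth1 S"
proof -
  obtain d where d: "\<And>S. P S \<Longrightarrow> P (d S) \<and> (\<forall>t. (S has_real_derivative d S t) (at t))"
    using step by metis
  have "P ((d ^^ n) S)" for n by (induction n) (use assms(1) d in auto)
  then show ?thesis
    unfolding smooth1_def by (intro exI[of _ "\<lambda>n. (d ^^ n) S"]) (use d in auto)
qed

lemma smooth1_deriv:
  assumes "smooth1 S"
  obtains S' where "smooth1 S'" "\<And>t. (S has_real_derivative S' t) (at t)"
proof -
  from assms obtain D where D: "D 0 = S" "\<And>n t. (D n has_real_derivative D (Suc n) t) (at t)"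
    unfolding smooth1_def by auto
  have "smooth1 (D 1)"
    unfolding smooth1_def by (intro exI[of _ "\<lambda>n. D (Suc n)"]) (use D in auto)
  then show ?thesis using that[of "D 1"] D(2)[of 0] D(1) by simp
qed

text \<open>One choice of the three partial derivatives is folded along the list of directions.
  \<open>smooth3\<close> puts the latest direction at the head, which is the order in which
  \<open>foldr\<close> applies the choices.\<close>

lemma smooth3_coinduct:
  assumes "P f"
    and step: "\<And>f. P f \<Longrightarrow> \<exists>a b c. P a \<and> P b \<and> P c \<and> (\<forall>p. has_grad f (a p, b p, c p) p)"
  shows "smooth3 f"
proof -
  from step obtain a b c where *: "\<And>f. P f \<Longrightarrow>
      P (a f) \<and> P (b f) \<and> P (c f) \<and> (\<forall>p. has_grad f (a f p, b f p, c f p) p)"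
    by metis
  define d where "d i = (if i = 0 then a else if i = 1 then b else c)" for i :: nat
  define D where "D l = foldr d l f" for l
  have "P (D l)" for l
    unfolding D_def by (induction l) (use * assms(1) in \<open>auto simp: d_def\<close>)
  moreover have "D (0#l) = a (D l)" "D (1#l) = b (D l)" "D (2#l) = c (D l)" for l
    by (simp_all add: D_def d_def)
  ultimately have "has_grad (D l) (D (0#l) p, D (1#l) p, D (2#l) p) p" for l p
    using * by presburger
  then show ?thesis
    unfolding smooth3_def
    by (intro exI[of _ D]) (simp add: D_def has_grad_def inner_pt)
qed

text \<open>Closing the smooth functions under the algebraic operations gives a class that is closed under
  partial derivatives, so that smoothness of its members follows without any formula for iterated
  derivatives.\<close>

inductive smooth_cl :: "(pt \<Rightarrow> real) \<Rightarrow> bool" where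
  base: "smooth3 f \<Longrightarrow> smooth_cl f"
| const: "smooth_cl (\<lambda>p. c)"
| X: "smooth_cl (\<lambda>p. fst p)"
| Y: "smooth_cl (\<lambda>p. fst (snd p))"
| Z: "smooth_cl (\<lambda>p. snd (snd p))"
| add: "smooth_cl f \<Longrightarrow> smooth_cl g \<Longrightarrow> smooth_cl (\<lambda>p. f p + g p)"
| mult: "smooth_cl f \<Longrightarrow> smooth_cl g \<Longrightarrow> smooth_cl (\<lambda>p. f p * g p)"
| comp: "smooth1 S \<Longrightarrow> smooth_cl f \<Longrightarrow> smooth_cl (\<lambda>p. S (f p))"

lemma smooth3_partials:
  assumes "smooth3 f"
  obtains a b c where "smooth3 a" "smooth3 b" "smooth3 c" "\<And>p. has_grad f (a p, b p, c p) p"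
proof -
  from assms obtain D :: "nat list \<Rightarrow> pt \<Rightarrow> real"
    where D: "D [] = f" "\<And>l p. has_grad (D l) (D (0#l) p, D (1#l) p, D (2#l) p) p"
    unfolding smooth3_def has_grad_def inner_pt by blast
  \<comment> \<open>The derivative taken first sits at the end of the list, hence
    \<open>l @ [i]\<close>.\<close>
  have "smooth3 (D [i])" for i
    unfolding smooth3_def
    by (intro exI[of _ "\<lambda>l. D (l @ [i])"]) (use D(2) in \<open>simp add: has_grad_def inner_pt\<close>)
  then show ?thesis using that D(1) D(2)[of "[]"] by blast
qed

lemma smooth_cl_partials:
  assumes "smooth_cl f"
  shows "\<exists>a b c. smooth_cl a \<and> smooth_cl b \<and> smooth_cl c \<and> (\<forall>p. has_grad f (a p, b p, c p) p)"
  using assms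
proof induction
  case (base f)
  then show ?case by (metis smooth3_partials smooth_cl.base)
next
  case (const c)
  show ?case
    by (intro exI[of _ "\<lambda>p. 0"]) (auto intro: smooth_cl.const simp: has_grad_def inner_pt)
next
  case X
  show ?case
    by (rule exI[of _ "\<lambda>p. 1"], intro exI[of _ "\<lambda>p. 0"])
      (auto intro!: smooth_cl.const derivative_eq_intros simp: has_grad_def inner_pt)
next
  case Y
  show ?case
    by (rule exI[of _ "\<lambda>p. 0"], rule exI[of _ "\<lambda>p. 1"], rule exI[of _ "\<lambda>p. 0"])
      (auto intro!: smooth_cl.const derivative_eq_intros simp: has_grad_def inner_pt)
next
  case Z
  show ?case
    by (rule exI[of _ "\<lambda>p. 0"], rule exI[of _ "\<lambda>p. 0"], rule exI[of _ "\<lambda>p. 1"])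
      (auto intro!: smooth_cl.const derivative_eq_intros simp: has_grad_def inner_pt)
next
  case (add f g)
  then obtain a b c a' b' c' where *:
    "smooth_cl a" "smooth_cl b" "smooth_cl c" "smooth_cl a'" "smooth_cl b'" "smooth_cl c'"
    "\<And>p. has_grad f (a p, b p, c p) p" "\<And>p. has_grad g (a' p, b' p, c' p) p" by metis
  have "has_grad (\<lambda>p. f p + g p) (a p + a' p, b p + b' p, c p + c' p) p" for p
    using has_grad_add[OF *(7,8)[of p]] by simp
  with * show ?case by (blast intro: smooth_cl.add)
next
  case (mult f g)
  then obtain a b c a' b' c' where *:
    "smooth_cl a" "smooth_cl b" "smooth_cl c" "smooth_cl a'" "smooth_cl b'" "smooth_cl c'"
    "\<And>p. has_grad f (a p, b p, c p) p" "\<And>p. has_grad g (a' p, b' p, c' p) p" by metis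
  have **: "has_grad (\<lambda>p. f p * g p)
      (g p * a p + f p * a' p, g p * b p + f p * b' p, g p * c p + f p * c' p) p" for p
    using has_grad_mult[OF *(7,8)[of p]] by simp
  have cl: "smooth_cl (\<lambda>p. g p * x p + f p * y p)" if "smooth_cl x" "smooth_cl y" for x y
    by (rule smooth_cl.add[OF smooth_cl.mult[OF mult.hyps(2) that(1)] smooth_cl.mult[OF mult.hyps(1) that(2)]])
  show ?case
    by (intro exI conjI allI, rule cl[OF *(1,4)], rule cl[OF *(2,5)], rule cl[OF *(3,6)], rule **)
next
  case (comp S f)
  then obtain a b c where *: "smooth_cl a" "smooth_cl b" "smooth_cl c"
    "\<And>p. has_grad f (a p, b p, c p) p" by metis
  obtain S' where S': "smooth1 S'" "\<And>t. (S has_real_derivative S' t) (at t)"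
    using smooth1_deriv[OF comp.hyps(1)] by blast
  have **: "has_grad (\<lambda>p. S (f p)) (S' (f p) * a p, S' (f p) * b p, S' (f p) * c p) p" for p
    using has_grad_compose[OF S'(2) *(4)[of p]] by simp
  have cl: "smooth_cl (\<lambda>p. S' (f p) * x p)" if "smooth_cl x" for x
    by (rule smooth_cl.mult[OF smooth_cl.comp[OF S'(1) comp.hyps(2)] that])
  show ?case
    by (intro exI conjI allI, rule cl[OF *(1)], rule cl[OF *(2)], rule cl[OF *(3)], rule **)
qed

lemma smooth_cl_imp_smooth3: "smooth_cl f \<Longrightarrow> smooth3 f"
  by (rule smooth3_coinduct[where P = smooth_cl]) (use smooth_cl_partials in auto)

lemma smooth3_const: "smooth3 (\<lambda>p. c)"
  by (rule smooth_cl_imp_smooth3[OF smooth_cl.const])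

lemma smooth3_fst: "smooth3 (\<lambda>p. fst p)"
  by (rule smooth_cl_imp_smooth3[OF smooth_cl.X])

lemma smooth3_fst_snd: "smooth3 (\<lambda>p. fst (snd p))"
  by (rule smooth_cl_imp_smooth3[OF smooth_cl.Y])

lemma smooth3_snd_snd: "smooth3 (\<lambda>p. snd (snd p))"
  by (rule smooth_cl_imp_smooth3[OF smooth_cl.Z])

lemma smooth3_add: "smooth3 f \<Longrightarrow> smooth3 g \<Longrightarrow> smooth3 (\<lambda>p. f p + g p)"
  by (rule smooth_cl_imp_smooth3[OF smooth_cl.add[OF smooth_cl.base smooth_cl.base]])

lemma smooth3_mult: "smooth3 f \<Longrightarrow> smooth3 g \<Longrightarrow> smooth3 (\<lambda>p. f p * g p)"
  by (rule smooth_cl_imp_smooth3[OF smooth_cl.mult[OF smooth_cl.base smooth_cl.base]])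

lemma smooth3_compose: "smooth1 S \<Longrightarrow> smooth3 f \<Longrightarrow> smooth3 (\<lambda>p. S (f p))"
  by (rule smooth_cl_imp_smooth3[OF smooth_cl.comp[OF _ smooth_cl.base]])

lemma smooth3_has_grad:
  assumes "smooth3 f" shows "has_grad f (grad3 f p) p"
  by (metis assms has_grad_imp_grad3 smooth3_partials)

lemma has_grad_continuous:
  assumes "\<And>p. has_grad f (g p) p" shows "continuous_on A f"
  by (rule has_derivative_continuous_on[where f' = "\<lambda>p h. g p \<bullet> h"])
    (use assms in \<open>auto simp: has_grad_def intro: has_derivative_at_withinI\<close>)

lemma smooth3_continuous: "smooth3 f \<Longrightarrow> continuous_on A f"
  using has_grad_continuous smooth3_has_grad by blast

lemma smooth3_grad_continuous:
  assumes "smooth3 f" shows "continuous_on A (grad3 f)"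
proof -
  obtain a b c where *: "smooth3 a" "smooth3 b" "smooth3 c" "\<And>p. has_grad f (a p, b p, c p) p"
    using smooth3_partials[OF assms] by blast
  have "grad3 f = (\<lambda>p. (a p, b p, c p))" using has_grad_imp_grad3[OF *(4)] by auto
  then show ?thesis using smooth3_continuous *(1-3) by (auto intro!: continuous_on_Pair)
qed

lemma grad3_add: "smooth3 f \<Longrightarrow> smooth3 g \<Longrightarrow> grad3 (\<lambda>p. f p + g p) p = grad3 f p + grad3 g p"
  by (intro has_grad_imp_grad3 has_grad_add smooth3_has_grad)

lemma grad3_mult:
  "smooth3 f \<Longrightarrow> smooth3 g \<Longrightarrow> grad3 (\<lambda>p. f p * g p) p = g p *\<^sub>R grad3 f p + f p *\<^sub>R grad3 g p"
  by (intro has_grad_imp_grad3 has_grad_mult smooth3_has_grad)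

lemma grad3_const: "grad3 (\<lambda>p. c) p = 0"
  by (intro has_grad_imp_grad3 has_grad_const)

lemma grad3_scale: "smooth3 f \<Longrightarrow> grad3 (\<lambda>p. c * f p) p = c *\<^sub>R grad3 f p"
  by (simp add: grad3_mult smooth3_const grad3_const)

lemma grad3_compose:
  "(S has_real_derivative s) (at (f p)) \<Longrightarrow> smooth3 f \<Longrightarrow> grad3 (\<lambda>p. S (f p)) p = s *\<^sub>R grad3 f p"
  by (intro has_grad_imp_grad3 has_grad_compose smooth3_has_grad)

lemma grad3_snd_snd: "grad3 (\<lambda>p. snd (snd p)) p = (0, 0, 1)"
  by (rule has_grad_imp_grad3) (auto simp: has_grad_def inner_pt intro!: derivative_eq_intros)

section \<open>Smooth functions of one variable\<close>

lemma smooth1_sin_cos: "smooth1 (\<lambda>t. a * sin (b * t) + c * cos (b * t))"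
proof (rule smooth1_coinduct[where P = "\<lambda>S. \<exists>a c. S = (\<lambda>t. a * sin (b * t) + c * cos (b * t))"])
  fix S assume "\<exists>a c. S = (\<lambda>t. a * sin (b * t) + c * cos (b * t))"
  then obtain a c where S: "S = (\<lambda>t. a * sin (b * t) + c * cos (b * t))" by blast
  have "(S has_real_derivative (-(c * b)) * sin (b * t) + (a * b) * cos (b * t)) (at t)" for t
    unfolding S by (auto intro!: derivative_eq_intros simp: algebra_simps)
  then show "\<exists>S'. (\<exists>a c. S' = (\<lambda>t. a * sin (b * t) + c * cos (b * t))) \<and>
      (\<forall>t. (S has_real_derivative S' t) (at t))" by blast
qed blast

lemma smooth1_exp: "smooth1 (\<lambda>t. a * exp (b * t))"
proof (rule smooth1_coinduct[where P = "\<lambda>S. \<exists>a. S = (\<lambda>t. a * exp (b * t))"])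
  fix S assume "\<exists>a. S = (\<lambda>t. a * exp (b * t))"
  then obtain a where S: "S = (\<lambda>t. a * exp (b * t))" by blast
  have "(S has_real_derivative (a * b) * exp (b * t)) (at t)" for t
    unfolding S by (auto intro!: derivative_eq_intros simp: algebra_simps)
  then show "\<exists>S'. (\<exists>a. S' = (\<lambda>t. a * exp (b * t))) \<and>
      (\<forall>t. (S has_real_derivative S' t) (at t))" by blast
qed blast

text \<open>The classical flat function \<open>exp (- 1 / t)\<close>, extended by 0. The polynomial
  in \<open>1 / t\<close> makes the family closed under differentiation.\<close>

definition flat :: "real poly \<Rightarrow> real \<Rightarrow> real" where
  "flat q t = (if t > 0 then poly q (inverse t) * exp (- inverse t) else 0)"

lemma poly_times_exp_tendsto_0: "((\<lambda>x::real. poly q x * exp (- x)) \<longlongrightarrow> 0) at_top"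
proof -
  have "((\<lambda>x. \<Sum>i\<le>degree q. coeff q i * (x ^ i / exp x)) \<longlongrightarrow> (\<Sum>i\<le>degree q. coeff q i * 0)) at_top"
    by (intro tendsto_intros tendsto_power_div_exp_0)
  then show ?thesis
    by (simp add: poly_altdef sum_distrib_right exp_minus divide_inverse mult.assoc)
qed

lemma flat_tendsto_0: "((\<lambda>t. poly q (inverse t) * exp (- inverse t)) \<longlongrightarrow> (0::real)) (at_right 0)"
  by (rule filterlim_compose[OF poly_times_exp_tendsto_0 filterlim_inverse_at_top_right])

text \<open>With \<open>s = 1 / t\<close> one has \<open>ds / dt = - s^2\<close>, so
  \<open>q(s) exp (- s)\<close> has the derivative \<open>s^2 (q(s) - q'(s)) exp (- s)\<close>; the
  polynomial \<open>[:0, 0, 1:]\<close> is \<open>s^2\<close>. At 0 the exponential beats every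
  power of \<open>s\<close>.\<close>

lemma flat_deriv:
  "(flat q has_real_derivative flat ([:0, 0, 1:] * (q - pderiv q)) t) (at t)"
proof (cases t "0::real" rule: linorder_cases)
  case less
  have "((\<lambda>t. 0) has_real_derivative 0) (at t)" by simp
  then have "(flat q has_real_derivative 0) (at t)"
    by (rule has_field_derivative_transform_within_open[of _ _ _ "{..<0}"])
      (use less in \<open>auto simp: flat_def\<close>)
  then show ?thesis using less by (simp add: flat_def)
next
  case greater
  have "((\<lambda>t. poly q (inverse t) * exp (- inverse t)) has_real_derivative
      flat ([:0, 0, 1:] * (q - pderiv q)) t) (at t)"
    using greater
    by (auto intro!: derivative_eq_intros DERIV_chain2[OF poly_DERIV]
        simp: flat_def algebra_simps power2_eq_square)
  then show ?thesis
    by (rule has_field_derivative_transform_within_open[of _ _ _ "{0<..}"])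
      (use greater in \<open>auto simp: flat_def\<close>)
next
  case equal
  have right: "((\<lambda>h. (flat q (0 + h) - flat q 0) / h) \<longlongrightarrow> 0) (at_right 0)"
  \<comment> \<open>Dividing by \<open>t\<close> multiplies the polynomial by its variable, so the
    difference quotient is again of the flat form.\<close>
  proof (rule Lim_transform_eventually[OF flat_tendsto_0[of "[:0, 1:] * q"]])
    show "\<forall>\<^sub>F t in at_right 0. poly ([:0, 1:] * q) (inverse t) * exp (- inverse t)
        = (flat q (0 + t) - flat q 0) / t"
      unfolding eventually_at_filter by (rule always_eventually) (auto simp: flat_def field_simps)
  qed
  have left: "((\<lambda>h. (flat q (0 + h) - flat q 0) / h) \<longlongrightarrow> 0) (at_left 0)"
  proof (rule Lim_transform_eventually[OF tendsto_const])
    show "\<forall>\<^sub>F t in at_left 0. 0 = (flat q (0 + t) - flat q 0) / t"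
      unfolding eventually_at_filter by (rule always_eventually) (auto simp: flat_def)
  qed
  have "(flat q has_real_derivative 0) (at 0)"
    unfolding DERIV_def using left right by (rule filterlim_split_at)
  then show ?thesis using equal by (simp add: flat_def)
qed

lemma smooth1_flat: "smooth1 (flat q)"
proof (rule smooth1_coinduct[where P = "\<lambda>S. \<exists>q. S = flat q"])
  fix S assume "\<exists>q. S = flat q"
  then show "\<exists>S'. (\<exists>q. S' = flat q) \<and> (\<forall>t. (S has_real_derivative S' t) (at t))"
    using flat_deriv by blast
qed blast

section \<open>Test functions on the slab and uniqueness of weak gradients\<close>

text \<open>Open boxes are stable under intersection and generate the Borel sets, so a Dynkin
  induction carries the vanishing from boxes to all Borel sets. Its complement step needs the
  integral over the whole space, which is the limit over growing cubes.\<close>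

lemma AE_zero_if_box_integrals_zero:
  fixes g :: "'a::euclidean_space \<Rightarrow> real"
  assumes g: "integrable lborel g"
    and box: "\<And>a b. (LINT x:box a b|lborel. g x) = 0"
  shows "AE x in lborel. g x = 0"
proof (rule density_unique_real[OF g, of "\<lambda>x. 0"])
  have set_int: "set_integrable lborel A g" if "A \<in> sets borel" for A
    unfolding set_integrable_def using g that by (intro integrable_mult_indicator) auto
  have total: "(LINT x|lborel. g x) = 0"
  proof -
    let ?B = "\<lambda>n. box (- (real n *\<^sub>R One)) (real n *\<^sub>R One) :: 'a set"
    have "(\<lambda>n. LINT x|lborel. indicator (?B n) x *\<^sub>R g x) \<longlonglongrightarrow> (LINT x|lborel. g x)"
    proof (rule integral_dominated_convergence[where w = "\<lambda>x. norm (g x)"])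
      show "AE x in lborel. (\<lambda>n. indicator (?B n) x *\<^sub>R g x) \<longlonglongrightarrow> g x"
      proof (rule AE_I2, rule tendsto_eventually)
        fix x :: 'a
        obtain N where N: "norm x < real N" using reals_Archimedean2 by blast
        show "\<forall>\<^sub>F n in sequentially. indicator (?B n) x *\<^sub>R g x = g x"
          unfolding eventually_sequentially
        proof (intro exI allI impI)
          fix n assume "N \<le> n"
          then have "\<bar>x \<bullet> i\<bar> < real n" if "i \<in> Basis" for i
            using Basis_le_norm[OF that, of x] N by linarith
          then have "x \<in> ?B n" by (force simp: mem_box)
          then show "indicator (?B n) x *\<^sub>R g x = g x" by simp
        qed
      qed
    qed (use g in \<open>auto split: split_indicator\<close>)
    moreover have "(LINT x|lborel. indicator (?B n) x *\<^sub>R g x) = 0" for n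
      using box unfolding set_lebesgue_integral_def by blast
    ultimately show ?thesis by (simp add: LIMSEQ_const_iff)
  qed
  fix A :: "'a set" assume "A \<in> sets lborel"
  have A: "A \<in> sigma_sets UNIV (range (\<lambda>(a, b). box a b))"
    using \<open>A \<in> sets lborel\<close> by (simp add: borel_eq_box)
  have stable: "Int_stable (range (\<lambda>(a, b). box a b :: 'a set))"
    by (auto simp: Int_stable_def Int_interval box_Int_box)
  have sub: "range (\<lambda>(a, b). box a b :: 'a set) \<subseteq> Pow UNIV" by simp
  from stable sub A have "(LINT x:A|lborel. g x) = 0"
  proof (induction rule: sigma_sets_induct_disjoint)
    case (basic A)
    then show ?case using box by auto
  next
    case empty
    then show ?case by (simp add: set_lebesgue_integral_def)
  next
    case (compl A)
    then have A: "A \<in> sets borel" by (simp add: borel_eq_box)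
    have "(LINT x:UNIV - A|lborel. g x) = (LINT x:UNIV|lborel. g x) - (LINT x:A|lborel. g x)"
      unfolding set_lebesgue_integral_def
      using set_int[OF A] g
      by (subst Bochner_Integration.integral_diff[symmetric])
        (auto simp: set_integrable_def indicator_diff left_diff_distrib)
    then show ?case using compl total by (simp add: set_lebesgue_integral_def)
  next
    case (union A)
    then have A: "A i \<in> sets borel" for i by (auto simp: borel_eq_box)
    have "(LINT x:(\<Union>i. A i)|lborel. g x) = (\<Sum>i. LINT x:A i|lborel. g x)"
    proof (rule lebesgue_integral_countable_add)
      have "(\<Union>i. A i) \<in> sets borel" using A by blast
      then show "set_integrable lborel (\<Union>i. A i) g" by (rule set_int)
    qed (use A union(1) in \<open>auto simp: disjoint_family_on_def\<close>)
    then show ?case using union by simp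
  qed
  then show "(LINT x:A|lborel. g x) = (LINT x:A|lborel. 0)"
    by (simp add: set_lebesgue_integral_def)
qed simp

section \<open>Integration over the slab\<close>

locale slab =
  fixes lx ly :: real
  assumes lx: "lx > 0" and ly: "ly > 0"
begin

abbreviation "M \<equiv> MOm lx ly"
abbreviation "test \<equiv> test_fun lx ly"

lemma Om_cbox: "Om lx ly = cbox (0, 0, 0) (lx, ly, 1)"
  by (simp add: Om_def cbox_Pair_eq)

lemma Om_sets [simp]: "Om lx ly \<in> sets lebesgue"
  by (simp add: Om_cbox)

lemma mem_Om: "(x, y, z) \<in> Om lx ly \<longleftrightarrow> 0 \<le> x \<and> x \<le> lx \<and> 0 \<le> y \<and> y \<le> ly \<and> 0 \<le> z \<and> z \<le> 1"
  by (auto simp: Om_def)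

lemma space_M [simp]: "space M = Om lx ly"
  by (simp add: space_restrict_space)

lemma finite_measure_M: "finite_measure M"
proof
  have "emeasure M (Om lx ly) = emeasure lborel (cbox (0, 0, 0) (lx, ly, 1::real))"
    by (simp add: emeasure_restrict_space Om_cbox)
  also have "\<dots> \<noteq> \<infinity>"
    by (simp add: emeasure_lborel_cbox_eq)
  finally show "emeasure M (space M) \<noteq> \<infinity>" by simp
qed

sublocale finite_measure M
  by (rule finite_measure_M)

lemma measure_Om: "measure M (Om lx ly) = lx * ly"
proof -
  have "measure M (Om lx ly) = measure lborel (cbox (0, 0, 0) (lx, ly, 1::real))"
    by (simp add: measure_restrict_space Om_cbox)
  also have "\<dots> = lx * ly"
    using lx ly by (simp add: content_Pair)
  finally show ?thesis .
qed

lemma L2_sq_int: "L2 lx ly f \<longleftrightarrow> sq_int M f"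
  by (simp add: L2_def sq_int_def)

lemma cont_bounded:
  fixes f :: "pt \<Rightarrow> 'b::euclidean_space"
  assumes "continuous_on UNIV f"
  obtains C where "C > 0" "\<And>p. p \<in> Om lx ly \<Longrightarrow> norm (f p) \<le> C"
proof -
  have "continuous_on (Om lx ly) f" using assms continuous_on_subset by blast
  then have "compact (f ` Om lx ly)" by (intro compact_continuous_image) (simp_all add: Om_cbox)
  then have "bounded (f ` Om lx ly)" by (rule compact_imp_bounded)
  then show ?thesis using that unfolding bounded_pos by auto
qed

lemma cont_meas:
  fixes f :: "pt \<Rightarrow> 'b::euclidean_space"
  assumes "continuous_on UNIV f"
  shows "f \<in> borel_measurable M"
proof -
  have "f \<in> borel_measurable lebesgue"
    using borel_measurable_continuous_onI[OF assms] by (simp add: measurable_completion)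
  then show ?thesis by (simp add: measurable_restrict_space1)
qed

lemma cont_sq_int:
  fixes f :: "pt \<Rightarrow> 'b::euclidean_space"
  assumes "continuous_on UNIV f"
  shows "sq_int M f"
proof -
  obtain C where "\<And>p. p \<in> Om lx ly \<Longrightarrow> norm (f p) \<le> C" using cont_bounded[OF assms] by blast
  then show ?thesis by (intro sq_int_bounded[OF cont_meas[OF assms], of C] AE_I2) simp
qed

lemma cont_LINT:
  fixes f :: "pt \<Rightarrow> real"
  assumes "continuous_on UNIV f"
  shows "(LINT p|M. f p) = integral (cbox (0, 0, 0) (lx, ly, 1)) f"
  using sq_int_imp_integrable[OF cont_sq_int[OF assms]]
  by (simp add: lebesgue_integral_eq_integral flip: Om_cbox)

text \<open>The fundamental theorem of calculus in one variable, once Fubini has made that variable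
  the innermost one: \<open>x\<close> is swapped past the pair of the others, \<open>y\<close> past
  \<open>z\<close>, and \<open>z\<close> is innermost already.\<close>

lemma int_partial_zero:
  fixes f g :: "pt \<Rightarrow> real"
  assumes g: "continuous_on UNIV g"
  shows "(\<And>q x. ((\<lambda>x. f (x, q)) has_real_derivative g (x, q)) (at x)) \<Longrightarrow>
      (\<And>q. f (lx, q) = f (0, q)) \<Longrightarrow> (LINT p|M. g p) = 0"
    and "(\<And>x y z. ((\<lambda>y. f (x, y, z)) has_real_derivative g (x, y, z)) (at y)) \<Longrightarrow>
      (\<And>x z. f (x, ly, z) = f (x, 0, z)) \<Longrightarrow> (LINT p|M. g p) = 0"
    and "(\<And>x y z. ((\<lambda>z. f (x, y, z)) has_real_derivative g (x, y, z)) (at z)) \<Longrightarrow>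
      (\<And>x y. f (x, y, 1) = f (x, y, 0)) \<Longrightarrow> (LINT p|M. g p) = 0"
proof -
  have FTC: "integral (cbox 0 l) G = 0"
    if "\<And>t. (F has_real_derivative G t) (at t)" "F l = F 0" "l > 0" for F G :: "real \<Rightarrow> real" and l
  proof -
    have "(G has_integral (F l - F 0)) {0..l}"
      using that
      by (intro fundamental_theorem_of_calculus)
        (auto simp: has_real_derivative_iff_has_vector_derivative intro: has_vector_derivative_at_within)
    then show ?thesis using that by (auto simp: integral_unique)
  qed
  have sub: "continuous_on A (\<lambda>q. g (h q))" if "continuous_on A h" for h :: "'c::topological_space \<Rightarrow> pt" and A
    using that continuous_on_compose2[OF g] by blast
  have gA: "continuous_on A g" for A using g continuous_on_subset by blast
  have *: "(LINT p|M. g p) = integral (cbox 0 lx) (\<lambda>x. integral (cbox (0,0) (ly,1)) (\<lambda>q. g (x, q)))"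
    unfolding cont_LINT[OF g] by (rule integral_prod_continuous[OF gA])
  {
    assume d: "\<And>q x. ((\<lambda>x. f (x, q)) has_real_derivative g (x, q)) (at x)" "\<And>q. f (lx, q) = f (0, q)"
    have "integral (cbox 0 lx) (\<lambda>x. integral (cbox (0,0) (ly,1)) (\<lambda>q. g (x, q)))
        = integral (cbox (0,0) (ly,1)) (\<lambda>q. integral (cbox 0 lx) (\<lambda>x. g (x, q)))"
      by (rule integral_swap_continuous) (simp add: case_prod_eta gA)
    moreover have "integral (cbox 0 lx) (\<lambda>x. g (x, q)) = 0" for q
      by (rule FTC[OF d lx])
    ultimately show "(LINT p|M. g p) = 0" unfolding * by simp
  next
    assume d: "\<And>x y z. ((\<lambda>y. f (x, y, z)) has_real_derivative g (x, y, z)) (at y)"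
      "\<And>x z. f (x, ly, z) = f (x, 0, z)"
    have "integral (cbox (0,0) (ly,1)) (\<lambda>q. g (x, q)) = 0" for x
    proof -
      have "integral (cbox (0,0) (ly,1)) (\<lambda>q. g (x, q))
          = integral (cbox 0 ly) (\<lambda>y. integral (cbox 0 1) (\<lambda>z. g (x, y, z)))"
        by (rule integral_prod_continuous) (intro sub continuous_intros)
      also have "\<dots> = integral (cbox 0 1) (\<lambda>z. integral (cbox 0 ly) (\<lambda>y. g (x, y, z)))"
        by (rule integral_swap_continuous) (auto simp: case_prod_beta intro!: sub continuous_intros)
      also have "\<dots> = 0" using FTC[OF d(1) d(2) ly] by simp
      finally show ?thesis .
    qed
    then show "(LINT p|M. g p) = 0" unfolding * by simp
  next
    assume d: "\<And>x y z. ((\<lambda>z. f (x, y, z)) has_real_derivative g (x, y, z)) (at z)"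
      "\<And>x y. f (x, y, 1) = f (x, y, 0)"
    have "integral (cbox (0,0) (ly,1)) (\<lambda>q. g (x, q)) = 0" for x
    proof -
      have "integral (cbox (0,0) (ly,1)) (\<lambda>q. g (x, q))
          = integral (cbox 0 ly) (\<lambda>y. integral (cbox 0 1) (\<lambda>z. g (x, y, z)))"
        by (rule integral_prod_continuous) (intro sub continuous_intros)
      also have "\<dots> = 0" using FTC[OF d(1) d(2)] by simp
      finally show ?thesis .
    qed
    then show "(LINT p|M. g p) = 0" unfolding * by simp
  }
qed

lemma test_smooth: "test \<phi> \<Longrightarrow> smooth3 \<phi>"
  by (simp add: test_fun_def)

text \<open>Periodicity cancels the boundary terms in \<open>x\<close> and \<open>y\<close>,
  vanishing near the plates those in \<open>z\<close>.\<close>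

lemma LINT_grad_test:
  assumes \<zeta>: "test \<zeta>"
  shows "(LINT p|M. grad3 \<zeta> p) = 0"
proof -
  note sm = test_smooth[OF \<zeta>]
  obtain a b c where *: "smooth3 a" "smooth3 b" "smooth3 c" "\<And>p. has_grad \<zeta> (a p, b p, c p) p"
    using smooth3_partials[OF sm] by blast
  have g: "grad3 \<zeta> = (\<lambda>p. (a p, b p, c p))" using has_grad_imp_grad3[OF *(4)] by auto
  have D: "(\<zeta> has_derivative (\<lambda>h. a p * fst h + b p * fst (snd h) + c p * snd (snd h))) (at p)" for p
    using *(4)[of p] unfolding has_grad_def inner_pt .
  have dx: "((\<lambda>x. \<zeta> (x, q)) has_real_derivative a (x, q)) (at x)" for x q
  proof -
    have "((\<lambda>x. (x, q)) has_derivative (\<lambda>h. (h, 0))) (at x)"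
      by (intro has_derivative_Pair has_derivative_const has_derivative_ident)
    from has_derivative_compose[OF this D] show ?thesis by (simp add: has_field_derivative_def mult_commute_abs)
  qed
  have dy: "((\<lambda>y. \<zeta> (x, y, z)) has_real_derivative b (x, y, z)) (at y)" for x y z
  proof -
    have "((\<lambda>y. (x, y, z)) has_derivative (\<lambda>h. (0, h, 0))) (at y)"
      by (intro has_derivative_Pair has_derivative_const has_derivative_ident)
    from has_derivative_compose[OF this D] show ?thesis by (simp add: has_field_derivative_def mult_commute_abs)
  qed
  have dz: "((\<lambda>z. \<zeta> (x, y, z)) has_real_derivative c (x, y, z)) (at z)" for x y z
  proof -
    have "((\<lambda>z. (x, y, z)) has_derivative (\<lambda>h. (0, 0, h))) (at z)"
      by (intro has_derivative_Pair has_derivative_const has_derivative_ident)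
    from has_derivative_compose[OF this D] show ?thesis by (simp add: has_field_derivative_def mult_commute_abs)
  qed
  have per: "\<zeta> (x + lx, y, z) = \<zeta> (x, y, z)" "\<zeta> (x, y + ly, z) = \<zeta> (x, y, z)" for x y z
    using \<zeta> by (auto simp: test_fun_def)
  obtain \<delta> where "\<delta> > 0" and \<delta>: "\<And>x y z. z \<le> \<delta> \<or> 1 - \<delta> \<le> z \<Longrightarrow> \<zeta> (x, y, z) = 0"
    using \<zeta> unfolding test_fun_def by blast
  have "\<zeta> (x, y, 1) = \<zeta> (x, y, 0)" for x y
    using \<delta>[of 1 x y] \<delta>[of 0 x y] \<open>\<delta> > 0\<close> by simp
  then have "(LINT p|M. c p) = 0"
    by (intro int_partial_zero(3)[OF smooth3_continuous[OF *(3)] dz])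
  moreover have "(LINT p|M. b p) = 0"
    using per(2)[of _ 0] by (intro int_partial_zero(2)[OF smooth3_continuous[OF *(2)] dy]) simp
  moreover have "(LINT p|M. a p) = 0"
    using per(1)[of 0] by (intro int_partial_zero(1)[OF smooth3_continuous[OF *(1)] dx]) (auto simp: split_paired_all)
  moreover have int: "integrable M a" "integrable M b" "integrable M c"
    using * by (auto intro!: sq_int_imp_integrable cont_sq_int smooth3_continuous)
  ultimately show ?thesis
  proof -
    have int2: "integrable M (grad3 \<zeta>)"
      by (intro sq_int_imp_integrable cont_sq_int smooth3_grad_continuous sm)
    have "(LINT p|M. grad3 \<zeta> p) \<bullet> i = (LINT p|M. grad3 \<zeta> p \<bullet> i)" for i
      using int2 by (cases "i = 0") auto
    then have "(LINT p|M. grad3 \<zeta> p) \<bullet> (i, j, k) = (LINT p|M. i * a p + j * b p + k * c p)" for i j k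
      by (simp add: g inner_Pair mult.commute add.assoc)
    then have "(LINT p|M. grad3 \<zeta> p) \<bullet> (i, j, k) = 0" for i j k
      using int \<open>(LINT p|M. a p) = 0\<close> \<open>(LINT p|M. b p) = 0\<close> \<open>(LINT p|M. c p) = 0\<close> by simp
    then have "(LINT p|M. grad3 \<zeta> p) \<bullet> (LINT p|M. grad3 \<zeta> p) = 0"
      by (metis prod.collapse)
    then show ?thesis by simp
  qed
qed

end

lemma has_grad_transform_open:
  assumes "has_grad f g p" "open A" "p \<in> A" "\<And>q. q \<in> A \<Longrightarrow> f q = h q"
  shows "has_grad h g p"
  using assms unfolding has_grad_def by (auto intro: has_derivative_transform_within_open)

lemma has_grad_unique: "has_grad f a p \<Longrightarrow> has_grad f b p \<Longrightarrow> a = b"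
  using has_grad_imp_grad3 by metis

lemma open_zstrip: "open {p. l < snd (snd p) \<and> snd (snd p) < (r::real)}"
  and open_z_below: "open {p. snd (snd p) < (r::real)}"
  and open_z_above: "open {p. (l::real) < snd (snd p)}"
  by (auto intro!: open_Collect_conj open_Collect_less continuous_intros)

text \<open>Test functions have to vanish at all heights outside \<open>(0,1)\<close>, not only on the slab.\<close>

lemma smooth3_cut:
  assumes f: "smooth3 f" and "\<delta> > 0"
    and z: "\<And>x y z. 0 < z \<and> z < \<delta> \<or> 1 - \<delta> < z \<and> z < 1 \<Longrightarrow> f (x, y, z) = 0"
  shows "smooth3 (\<lambda>p. if 0 < snd (snd p) \<and> snd (snd p) < 1 then f p else 0)"
proof -
  define cut :: "(pt \<Rightarrow> real) \<Rightarrow> pt \<Rightarrow> real"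
    where "cut f = (\<lambda>p. if 0 < snd (snd p) \<and> snd (snd p) < 1 then f p else 0)" for f
  let ?U = "{p::pt. 0 < snd (snd p) \<and> snd (snd p) < \<delta>}" and ?V = "{p::pt. 1 - \<delta> < snd (snd p) \<and> snd (snd p) < 1}"
  define vanish :: "(pt \<Rightarrow> real) \<Rightarrow> bool" where "vanish f \<longleftrightarrow> (\<forall>p\<in>?U \<union> ?V. f p = 0)" for f
  have oUV: "open (?U \<union> ?V)" by (intro open_Un open_zstrip)
  have "smooth3 (cut f)"
  \<comment> \<open>The coinduction has to remember that the uncut function vanishes on both strips.
    As the strips are open, this passes to its partial derivatives.\<close>
  proof (rule smooth3_coinduct[where P = "\<lambda>g. \<exists>f. smooth3 f \<and> vanish f \<and> g = cut f"])
    show "\<exists>f'. smooth3 f' \<and> vanish f' \<and> cut f = cut f'"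
      using f z by (intro exI[of _ f]) (auto simp: vanish_def)
    fix g assume "\<exists>f. smooth3 f \<and> vanish f \<and> g = cut f"
    then obtain f where f: "smooth3 f" "vanish f" "g = cut f" by blast
    obtain a b c where *: "smooth3 a" "smooth3 b" "smooth3 c" "\<And>p. has_grad f (a p, b p, c p) p"
      using smooth3_partials[OF f(1)] by blast
    have "(a p, b p, c p) = 0" if "p \<in> ?U \<union> ?V" for p
    proof -
      have "has_grad (\<lambda>p. 0) (a p, b p, c p) p"
        by (rule has_grad_transform_open[OF *(4) oUV that]) (use f(2) in \<open>auto simp: vanish_def\<close>)
      then show ?thesis by (rule has_grad_unique[OF _ has_grad_const])
    qed
    then have abc0: "a p = 0" "b p = 0" "c p = 0" if "p \<in> ?U \<union> ?V" for p
      using that by (auto simp: zero_prod_def)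
    have van: "vanish a" "vanish b" "vanish c" using abc0 by (auto simp: vanish_def)
    have "has_grad g (cut a p, cut b p, cut c p) p" for p
    proof -
      \<comment> \<open>Each case places \<open>p\<close> in an open set on which the cut function
        agrees with \<open>f\<close> or with 0. The planes \<open>z = 0\<close> and
        \<open>z = 1\<close> are interior to the second and third of these sets.\<close>
      have "(0 < snd (snd p) \<and> snd (snd p) < 1) \<or> snd (snd p) < \<delta> \<and> snd (snd p) \<le> 0 \<or> 1 - \<delta> < snd (snd p) \<and> 1 \<le> snd (snd p)"
        using \<open>\<delta> > 0\<close> by linarith
      then consider (mid) "0 < snd (snd p) \<and> snd (snd p) < 1"
        | (low) "snd (snd p) < min \<delta> 1 \<and> snd (snd p) \<le> 0" | (high) "max (1 - \<delta>) 0 < snd (snd p) \<and> 1 \<le> snd (snd p)"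
        using \<open>\<delta> > 0\<close> by fastforce
      then show ?thesis
      proof cases
        case mid
        have "has_grad g (a p, b p, c p) p"
          by (rule has_grad_transform_open[OF *(4) open_zstrip[of 0 1]]) (use mid f(3) in \<open>auto simp: cut_def\<close>)
        then show ?thesis using mid by (simp add: cut_def)
      next
        case low
        have "has_grad g 0 p"
          by (rule has_grad_transform_open[OF has_grad_const open_z_below[of "min \<delta> 1"]])
            (use low f(2,3) in \<open>auto simp: cut_def vanish_def\<close>)
        then show ?thesis using low by (simp add: cut_def zero_prod_def)
      next
        case high
        have "has_grad g 0 p"
          by (rule has_grad_transform_open[OF has_grad_const open_z_above[of "max (1 - \<delta>) 0"]])
            (use high f(2,3) in \<open>auto simp: cut_def vanish_def\<close>)
        then show ?thesis using high by (simp add: cut_def zero_prod_def)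
      qed
    qed
    with * van show "\<exists>a b c. (\<exists>f. smooth3 f \<and> vanish f \<and> a = cut f) \<and> (\<exists>f. smooth3 f \<and> vanish f \<and> b = cut f) \<and>
        (\<exists>f. smooth3 f \<and> vanish f \<and> c = cut f) \<and> (\<forall>p. has_grad g (a p, b p, c p) p)"
      by blast
  qed
  then show ?thesis by (simp add: cut_def)
qed

lemma flat_1: "flat 1 t = (if t > 0 then exp (- inverse t) else 0)"
  by (simp add: flat_def)

lemma flat_1_pos: "flat 1 t > 0 \<longleftrightarrow> t > 0"
  by (simp add: flat_1)

lemma flat_1_nonneg: "flat 1 t \<ge> 0"
  by (simp add: flat_1)

lemma flat_continuous: "continuous_on A (flat q)"
  using flat_deriv by (meson DERIV_isCont continuous_at_imp_continuous_on)

text \<open>On the circle of length \<open>l\<close>, the arc from \<open>a\<close> to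
  \<open>b\<close> consists of the points whose angle \<open>s\<close> from the midpoint is below
  half the angular length \<open>r\<close>. Cosine decreases on \<open>[0, pi]\<close>; angles
  beyond \<open>pi\<close> are reflected to \<open>2 * pi - s\<close>, which is still at least
  \<open>r\<close> because the arc and \<open>x\<close> lie within one period.\<close>

lemma arc_iff:
  fixes a b l x :: real
  assumes "l > 0" "0 \<le> a" "a < b" "b \<le> l" "0 \<le> x" "x \<le> l"
  shows "cos (pi * (b - a) / l) < cos (2 * pi / l * (x - (a + b) / 2)) \<longleftrightarrow> a < x \<and> x < b"
proof -
  define r where "r = pi * (b - a) / l"
  define s where "s = 2 * pi / l * \<bar>x - (a + b) / 2\<bar>"
  have s: "cos (2 * pi / l * (x - (a + b) / 2)) = cos s"
  proof -
    have "s = \<bar>2 * pi / l * (x - (a + b) / 2)\<bar>" using assms(1) by (simp add: s_def abs_mult)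
    then show ?thesis by (simp only: cos_abs_real)
  qed
  have s0: "0 \<le> s" using assms(1) by (simp add: s_def)
  have r_eq: "r = 2 * pi / l * ((b - a) / 2)" by (simp add: r_def)
  have rpi: "0 < r" "r \<le> pi"
  proof -
    show "0 < r" using assms by (simp add: r_def)
    have "pi * ((b - a) / l) \<le> pi * 1" using assms by (intro mult_left_mono) auto
    then show "r \<le> pi" by (simp add: r_def)
  qed
  have pos: "2 * pi / l > 0" using assms(1) by simp
  have iff: "s < r \<longleftrightarrow> a < x \<and> x < b"
    unfolding s_def r_eq mult_less_cancel_left_pos[OF pos] by (auto simp: abs_less_iff field_simps)
  have "s \<le> 2 * pi / l * (l - (b - a) / 2)"
    unfolding s_def mult_le_cancel_left_pos[OF pos] using assms by (auto simp: abs_le_iff field_simps)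
  also have "\<dots> = 2 * pi - r" using assms(1) by (simp add: r_def field_simps)
  finally have s2: "s \<le> 2 * pi - r" .
  have "cos r < cos s \<longleftrightarrow> s < r"
  proof
    assume "s < r" then show "cos r < cos s" using s0 rpi by (intro cos_monotone_0_pi) auto
  next
    assume less: "cos r < cos s"
    show "s < r"
    proof (rule ccontr)
      assume "\<not> s < r"
      then have rs: "r \<le> s" by simp
      show False
      proof (cases "s \<le> pi")
        case True
        then show False using cos_monotone_0_pi_le[of r s] rs rpi less by simp
      next
        case False
        have "cos (2 * pi - s) = cos s" by (simp add: cos_diff)
        then show False using cos_monotone_0_pi_le[of r "2 * pi - s"] s2 rpi less False by simp
      qed
    qed
  qed
  then show ?thesis using s iff by (simp add: r_def)
qed

section \<open>The algebra of test functions and the Poincare inequality\<close>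

context slab
begin

text \<open>The multipliers of test functions: no vanishing at the plates is imposed, so the height
  \<open>zc\<close> and functions of it qualify.\<close>

definition per_smooth :: "(pt \<Rightarrow> real) \<Rightarrow> bool" where
  "per_smooth f \<longleftrightarrow> smooth3 f \<and> (\<forall>x y z. f (x + lx, y, z) = f (x, y, z) \<and> f (x, y + ly, z) = f (x, y, z))"

lemma test_iff: "test \<phi> \<longleftrightarrow> per_smooth \<phi> \<and>
    (\<exists>\<delta>>0. \<forall>x y z. (z \<le> \<delta> \<or> 1 - \<delta> \<le> z) \<longrightarrow> \<phi> (x, y, z) = 0)"
  by (simp add: test_fun_def per_smooth_def)

lemma per_smooth_smooth: "per_smooth f \<Longrightarrow> smooth3 f"
  by (simp add: per_smooth_def)

lemma test_per_smooth: "test \<phi> \<Longrightarrow> per_smooth \<phi>"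
  by (simp add: test_iff)

lemma per_smooth_const: "per_smooth (\<lambda>p. c)"
  by (simp add: per_smooth_def smooth3_const)

lemma per_smooth_zc: "per_smooth zc"
  using smooth3_snd_snd by (simp add: per_smooth_def zc_def[abs_def])

lemma per_smooth_add: "per_smooth f \<Longrightarrow> per_smooth g \<Longrightarrow> per_smooth (\<lambda>p. f p + g p)"
  by (simp add: per_smooth_def smooth3_add)

lemma per_smooth_mult: "per_smooth f \<Longrightarrow> per_smooth g \<Longrightarrow> per_smooth (\<lambda>p. f p * g p)"
  by (simp add: per_smooth_def smooth3_mult)

lemma per_smooth_compose: "smooth1 S \<Longrightarrow> per_smooth f \<Longrightarrow> per_smooth (\<lambda>p. S (f p))"
  by (simp add: per_smooth_def smooth3_compose)

lemma test_add:
  assumes "test \<phi>" "test \<psi>" shows "test (\<lambda>p. \<phi> p + \<psi> p)"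
proof -
  obtain d e where "d > 0" "e > 0"
    and d: "\<And>x y z. z \<le> d \<or> 1 - d \<le> z \<Longrightarrow> \<phi> (x, y, z) = 0"
    and e: "\<And>x y z. z \<le> e \<or> 1 - e \<le> z \<Longrightarrow> \<psi> (x, y, z) = 0"
    using assms unfolding test_iff by blast
  have "\<phi> (x, y, z) + \<psi> (x, y, z) = 0" if "z \<le> min d e \<or> 1 - min d e \<le> z" for x y z
    using d[of z x y] e[of z x y] that by (auto simp: min_def split: if_splits)
  then show ?thesis
    using assms \<open>d > 0\<close> \<open>e > 0\<close> per_smooth_add
    unfolding test_iff by (intro conjI exI[of _ "min d e"]) auto
qed

lemma test_mult:
  assumes "per_smooth f" "test \<phi>" shows "test (\<lambda>p. f p * \<phi> p)"
  using assms per_smooth_mult unfolding test_iff by fastforce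

lemma test_cmult: "test \<phi> \<Longrightarrow> test (\<lambda>p. c * \<phi> p)"
  using test_mult[OF per_smooth_const] .

lemma test_zero: "test (\<lambda>p. 0)"
  unfolding test_iff using per_smooth_const[of 0] by (intro conjI exI[of _ 1]) auto

lemma test_compose:
  assumes "smooth1 S" "S 0 = 0" "test \<phi>" shows "test (\<lambda>p. S (\<phi> p))"
  using assms per_smooth_compose[of S \<phi>] unfolding test_iff by fastforce

lemma test_cont: "test \<phi> \<Longrightarrow> continuous_on A \<phi>"
  by (intro smooth3_continuous test_smooth)

lemma test_grad_cont: "test \<phi> \<Longrightarrow> continuous_on A (grad3 \<phi>)"
  by (intro smooth3_grad_continuous test_smooth)

lemma test_sq_int: "test \<phi> \<Longrightarrow> sq_int M \<phi>"
  by (intro cont_sq_int test_cont)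

lemma test_grad_sq_int: "test \<phi> \<Longrightarrow> sq_int M (grad3 \<phi>)"
  by (intro cont_sq_int test_grad_cont)

lemma test_AE_bounded:
  assumes "test \<phi>" obtains C where "C > 0" "AE p in M. \<bar>\<phi> p\<bar> \<le> C"
  using cont_bounded[OF test_cont[OF assms]] by (metis AE_I2 real_norm_def space_M)

lemma test_by_parts:
  assumes "per_smooth f" "test \<phi>"
  shows "(LINT p|M. f p *\<^sub>R grad3 \<phi> p) = - (LINT p|M. \<phi> p *\<^sub>R grad3 f p)"
proof -
  note sm = per_smooth_smooth[OF assms(1)] test_smooth[OF assms(2)]
  have "(LINT p|M. \<phi> p *\<^sub>R grad3 f p + f p *\<^sub>R grad3 \<phi> p) = 0"
    using LINT_grad_test[OF test_mult[OF assms]] by (simp add: grad3_mult sm)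
  moreover have "integrable M (\<lambda>p. \<phi> p *\<^sub>R grad3 f p)" "integrable M (\<lambda>p. f p *\<^sub>R grad3 \<phi> p)"
    by (intro integrable_sq_scaleR cont_sq_int smooth3_continuous smooth3_grad_continuous sm)+
  ultimately show ?thesis by (simp add: eq_neg_iff_add_eq_0 add.commute)
qed

text \<open>Integrating \<open>\<phi>^2\<close> against the derivative of \<open>z\<close> by parts
  gives \<open>\<integral> \<phi>^2 = - 2 \<integral> z \<phi> \<partial>\<phi>/\<partial>z\<close>.
  As \<open>z\<close> is at most 1 on the slab, Cauchy--Schwarz yields the constant 2.\<close>

lemma test_poincare:
  assumes "test \<phi>" shows "l2norm M \<phi> \<le> 2 * l2norm M (grad3 \<phi>)"
proof -
  note sm = test_smooth[OF assms]
  let ?e = "(0, 0, 1) :: pt"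
  let ?h = "\<lambda>p. (zc p * \<phi> p) *\<^sub>R ?e"
  have g: "grad3 (\<lambda>p. \<phi> p * \<phi> p) p = (2 * \<phi> p) *\<^sub>R grad3 \<phi> p" for p
    by (simp add: grad3_mult sm scaleR_2 flip: scaleR_add_left)
  have gz: "grad3 zc p = ?e" for p
    using grad3_snd_snd by (simp add: zc_def[abs_def])
  have tt: "test (\<lambda>p. \<phi> p * \<phi> p)" by (intro test_mult test_per_smooth assms)
  have "(LINT p|M. zc p *\<^sub>R grad3 (\<lambda>p. \<phi> p * \<phi> p) p) = - (LINT p|M. (\<phi> p * \<phi> p) *\<^sub>R grad3 zc p)"
    by (rule test_by_parts[OF per_smooth_zc tt])
  then have "(LINT p|M. (\<phi> p * \<phi> p) *\<^sub>R ?e) = - (LINT p|M. (2 * zc p * \<phi> p) *\<^sub>R grad3 \<phi> p)"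
    unfolding g gz by (simp add: mult.assoc mult.left_commute)
  then have "(LINT p|M. (\<phi> p * \<phi> p) *\<^sub>R ?e) \<bullet> ?e = - (LINT p|M. (2 * zc p * \<phi> p) *\<^sub>R grad3 \<phi> p) \<bullet> ?e"
    by simp
  moreover have zsq: "sq_int M (\<lambda>p. zc p * \<phi> p)" "sq_int M ?h"
    by (intro cont_sq_int continuous_intros test_cont assms
        smooth3_continuous[OF per_smooth_smooth[OF per_smooth_zc]])+
  moreover have "integrable M (\<lambda>p. (2 * zc p * \<phi> p) *\<^sub>R grad3 \<phi> p)"
    using integrable_sq_scaleR[OF sq_int_scaleR[OF zsq(1), of 2] test_grad_sq_int[OF assms]]
    by (simp add: mult.assoc)
  moreover have "integrable M (\<lambda>p. (\<phi> p * \<phi> p) *\<^sub>R ?e)"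
    by (intro sq_int_imp_integrable cont_sq_int continuous_intros test_cont assms)
  ultimately have "(LINT p|M. \<phi> p * \<phi> p) = - (LINT p|M. 2 * (?h p \<bullet> grad3 \<phi> p))"
  proof -
    assume 1: "(LINT p|M. (\<phi> p * \<phi> p) *\<^sub>R ?e) \<bullet> ?e = - (LINT p|M. (2 * zc p * \<phi> p) *\<^sub>R grad3 \<phi> p) \<bullet> ?e"
      and 2: "integrable M (\<lambda>p. (2 * zc p * \<phi> p) *\<^sub>R grad3 \<phi> p)"
      and 3: "integrable M (\<lambda>p. (\<phi> p * \<phi> p) *\<^sub>R ?e)"
    have "(LINT p|M. ((\<phi> p * \<phi> p) *\<^sub>R ?e) \<bullet> ?e) = - (LINT p|M. ((2 * zc p * \<phi> p) *\<^sub>R grad3 \<phi> p) \<bullet> ?e)"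
      using 1 integral_inner_left[OF 2, of ?e] integral_inner_left[OF 3, of ?e] by simp
    moreover have "((\<phi> p * \<phi> p) *\<^sub>R ?e) \<bullet> ?e = \<phi> p * \<phi> p" for p by (simp add: inner_Pair)
    moreover have "((2 * zc p * \<phi> p) *\<^sub>R grad3 \<phi> p) \<bullet> ?e = 2 * (?h p \<bullet> grad3 \<phi> p)" for p
      by (cases "grad3 \<phi> p") (simp add: inner_Pair)
    ultimately show ?thesis by (simp only:)
  qed
  moreover have "(l2norm M \<phi>)\<^sup>2 = (LINT p|M. \<phi> p * \<phi> p)"
    unfolding l2norm_power2 by (simp add: power2_eq_square)
  ultimately have "(l2norm M \<phi>)\<^sup>2 \<le> 2 * \<bar>LINT p|M. ?h p \<bullet> grad3 \<phi> p\<bar>"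
    using abs_ge_minus_self[of "LINT p|M. ?h p \<bullet> grad3 \<phi> p"]
    by simp
  also have "\<dots> \<le> 2 * (l2norm M ?h * l2norm M (grad3 \<phi>))"
    using l2_cauchy_schwarz[OF zsq(2) test_grad_sq_int[OF assms]] by simp
  also have "l2norm M ?h \<le> l2norm M \<phi>"
    unfolding l2norm_def
  proof (intro real_sqrt_le_mono integral_mono)
    fix p assume "p \<in> space M"
    then have "\<bar>zc p\<bar> \<le> 1" by (cases p) (simp add: mem_Om zc_def)
    then have "(zc p)\<^sup>2 \<le> 1" by (simp add: abs_square_le_1)
    then show "(norm (?h p))\<^sup>2 \<le> (norm (\<phi> p))\<^sup>2"
      by (simp add: power_mult_distrib norm_Pair mult_left_le_one_le)
  qed (use zsq test_sq_int[OF assms] in \<open>auto simp: sq_int_def\<close>)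
  finally have "l2norm M \<phi> * l2norm M \<phi> \<le> l2norm M \<phi> * (2 * l2norm M (grad3 \<phi>))"
    by (simp add: power2_eq_square mult_right_mono mult.left_commute)
  then show ?thesis
    by (cases "l2norm M \<phi> = 0") (auto simp: mult_le_cancel_left order_less_le)
qed


section \<open>Test functions separate integrable functions\<close>

lemma AE_M_interior: "AE p in M. p \<in> box (0, 0, 0) (lx, ly, 1)"
proof -
  have "negligible (cbox (0, 0, 0) (lx, ly, 1::real) - box (0, 0, 0) (lx, ly, 1))"
    by (rule negligible_frontier_interval)
  then have "AE p in lebesgue. p \<notin> cbox (0, 0, 0) (lx, ly, 1::real) - box (0, 0, 0) (lx, ly, 1)"
    unfolding negligible_iff_null_sets by (rule AE_not_in)
  then have "AE p in lebesgue. p \<in> Om lx ly \<longrightarrow> p \<in> box (0, 0, 0) (lx, ly, 1)"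
    by (auto simp: Om_cbox)
  then show ?thesis by (simp add: AE_restrict_space_iff)
qed

text \<open>With \<open>\<psi> \<ge> 0\<close> a smooth function whose positivity set is the box, \<open>1 - exp (- n \<psi>)\<close>
  converges to the indicator of the box. The first two factors are functions of a cosine and hence
  periodic; the third one depends on \<open>n\<close> to keep the support away from the plates.\<close>

lemma box_test_approx:
  assumes a: "0 \<le> a1" "a1 < b1" "b1 \<le> lx" "0 \<le> a2" "a2 < b2" "b2 \<le> ly" "0 \<le> a3" "b3 \<le> 1"
  obtains \<phi> where "\<And>n. test (\<phi> n)" "\<And>n p. 0 \<le> \<phi> n p \<and> \<phi> n p \<le> 1"
    "\<And>p. p \<in> Om lx ly \<Longrightarrow> (\<lambda>n. \<phi> n p) \<longlonglongrightarrow> indicator (box (a1, a2, a3) (b1, b2, b3)) p"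
proof -
  define e :: "nat \<Rightarrow> real" where "e n = 1 / (real n + 2)" for n
  define A where "A p = flat 1 (cos (2 * pi / lx * (fst p - (a1 + b1) / 2)) + - cos (pi * (b1 - a1) / lx))" for p :: pt
  define B where "B p = flat 1 (cos (2 * pi / ly * (fst (snd p) - (a2 + b2) / 2)) + - cos (pi * (b2 - a2) / ly))" for p :: pt
  \<comment> \<open>Positive exactly for \<open>z\<close> between \<open>a3 + d\<close> and
    \<open>b3 - d\<close>; as \<open>0 <= a3\<close> and \<open>b3 <= 1\<close>, it vanishes within
    distance \<open>d\<close> of the plates.\<close>
  define C where "C d p = flat 1 (zc p + - (a3 + d)) * flat 1 (b3 - d + (-1) * zc p)" for d and p :: pt
  define \<psi> where "\<psi> n p = A p * (B p * C (e n) p)" for n p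
  define \<phi> where "\<phi> n p = 1 + (-1) * exp ((- real n) * \<psi> n p)" for n p
  have e0: "e n > 0" for n by (simp add: e_def)
  have e_lim: "e \<longlonglongrightarrow> 0" unfolding e_def
    using LIMSEQ_ignore_initial_segment[OF lim_1_over_n, of 2] by (simp add: add.commute)
  have cos1: "smooth1 (\<lambda>t. cos (k * t))" for k using smooth1_sin_cos[of 0 k 1] by simp
  have per: "cos (2 * pi / l * (x + l - c)) = cos (2 * pi / l * (x - c))" if "l > 0" for l x c :: real
  proof -
    have "2 * pi / l * (x + l - c) = 2 * pi / l * (x - c) + 2 * pi" using that by (simp add: field_simps)
    then show ?thesis by simp
  qed
  have smX: "smooth3 (\<lambda>p. fst p - c)" "smooth3 (\<lambda>p. fst (snd p) - c)" for c
    using smooth3_add[OF smooth3_fst smooth3_const[of "- c"]] smooth3_add[OF smooth3_fst_snd smooth3_const[of "- c"]]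
    by simp_all
  have "per_smooth (\<lambda>p. cos (2 * pi / lx * (fst p - (a1 + b1) / 2)))"
    using smooth3_compose[OF cos1 smX(1)[of "(a1 + b1) / 2"], of "2 * pi / lx"] per[OF lx]
    unfolding per_smooth_def by simp
  then have A: "per_smooth A"
    unfolding A_def by (intro per_smooth_compose[OF smooth1_flat] per_smooth_add per_smooth_const)
  have "per_smooth (\<lambda>p. cos (2 * pi / ly * (fst (snd p) - (a2 + b2) / 2)))"
    using smooth3_compose[OF cos1 smX(2)[of "(a2 + b2) / 2"], of "2 * pi / ly"] per[OF ly]
    unfolding per_smooth_def by simp
  then have B: "per_smooth B"
    unfolding B_def by (intro per_smooth_compose[OF smooth1_flat] per_smooth_add per_smooth_const)
  have C: "per_smooth (C d)" for d
    unfolding C_def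
    by (rule per_smooth_mult[OF per_smooth_compose[OF smooth1_flat per_smooth_add[OF per_smooth_zc per_smooth_const]]
          per_smooth_compose[OF smooth1_flat per_smooth_add[OF per_smooth_const per_smooth_mult[OF per_smooth_const per_smooth_zc]]]])
  have \<psi>: "per_smooth (\<psi> n)" for n
    unfolding \<psi>_def by (rule per_smooth_mult[OF A per_smooth_mult[OF B C]])
  have exp1: "smooth1 (\<lambda>t. exp (k * t))" for k using smooth1_exp[of 1 k] by simp
  have \<phi>: "per_smooth (\<phi> n)" for n
    unfolding \<phi>_def
    by (rule per_smooth_add[OF per_smooth_const per_smooth_mult[OF per_smooth_const per_smooth_compose[OF exp1 \<psi>]]])
  have Cpos: "C d p > 0 \<longleftrightarrow> a3 + d < zc p \<and> zc p < b3 - d" for d p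
    unfolding C_def by (auto simp: flat_1 zero_less_mult_iff)
  have C0: "C d p = 0" if "\<not> (a3 + d < zc p \<and> zc p < b3 - d)" for d p
    using that unfolding C_def by (auto simp: flat_1)
  have \<psi>0: "\<psi> n p \<ge> 0" for n p
    unfolding \<psi>_def A_def B_def C_def by (intro mult_nonneg_nonneg flat_1_nonneg)
  show ?thesis
  proof (rule that[of \<phi>])
    show "test (\<phi> n)" for n
      unfolding test_iff
    proof (intro conjI exI[of _ "e n"] allI impI)
      fix x y z :: real assume z: "z \<le> e n \<or> 1 - e n \<le> z"
      have "C (e n) (x, y, z) = 0"
        by (rule C0) (use z a e0[of n] in \<open>auto simp: zc_def\<close>)
      then show "\<phi> n (x, y, z) = 0" by (simp add: \<phi>_def \<psi>_def)
    qed (use \<phi> e0 in auto)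
    show "0 \<le> \<phi> n p \<and> \<phi> n p \<le> 1" for n p
      using \<psi>0[of n p] by (simp add: \<phi>_def)
    fix p assume p: "p \<in> Om lx ly"
    obtain x y z where xyz: "p = (x, y, z)" by (cases p)
    have x: "0 \<le> x" "x \<le> lx" "0 \<le> y" "y \<le> ly" "0 \<le> z" "z \<le> 1" using p by (auto simp: xyz mem_Om)
    have Apos: "A p > 0 \<longleftrightarrow> a1 < x \<and> x < b1"
      using arc_iff[OF lx a(1-3) x(1,2)] by (simp add: A_def flat_1_pos xyz)
    have Bpos: "B p > 0 \<longleftrightarrow> a2 < y \<and> y < b2"
      using arc_iff[OF ly a(4-6) x(3,4)] by (simp add: B_def flat_1_pos xyz)
    have box: "p \<in> box (a1, a2, a3) (b1, b2, b3) \<longleftrightarrow> a1 < x \<and> x < b1 \<and> a2 < y \<and> y < b2 \<and> a3 < z \<and> z < b3"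
      by (auto simp: xyz box_prod)
    show "(\<lambda>n. \<phi> n p) \<longlonglongrightarrow> indicator (box (a1, a2, a3) (b1, b2, b3)) p"
    proof (cases "p \<in> box (a1, a2, a3) (b1, b2, b3)")
      case False
      have "A p \<ge> 0" "B p \<ge> 0" by (simp_all add: A_def B_def flat_1_nonneg)
      then have AB: "A p = 0 \<or> B p = 0 \<or> \<not> (a3 < z \<and> z < b3)"
        using False Apos Bpos box by auto
      have "C (e n) p = 0" if "\<not> (a3 < z \<and> z < b3)" for n
        by (rule C0) (use that e0[of n] in \<open>auto simp: zc_def xyz\<close>)
      then have "\<psi> n p = 0" for n using AB by (auto simp: \<psi>_def)
      then show ?thesis using False by (simp add: \<phi>_def)
    next
      case True
      have P: "isCont (flat 1) t" for t using flat_deriv DERIV_isCont by blast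
      have "(\<lambda>n. C (e n) p) \<longlonglongrightarrow> C 0 p"
        unfolding C_def
        by (intro tendsto_mult isCont_tendsto_compose[OF P] tendsto_intros e_lim)
      then have lim: "(\<lambda>n. \<psi> n p) \<longlonglongrightarrow> A p * (B p * C 0 p)"
        unfolding \<psi>_def by (intro tendsto_intros)
      have "C 0 p > 0" using True box Cpos[of 0 p] by (simp add: zc_def xyz)
      then have pos: "A p * (B p * C 0 p) > 0"
        using True box Apos Bpos by simp
      \<comment> \<open>\<open>\<psi> n p\<close> moves with \<open>n\<close>, but its limit is
        positive inside the box, so the product with \<open>n\<close> still tends to
        infinity.\<close>
      have "filterlim (\<lambda>n. \<psi> n p * real n) at_top sequentially"
        by (rule filterlim_tendsto_pos_mult_at_top[OF lim pos filterlim_real_sequentially])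
      then have "filterlim (\<lambda>n. - (\<psi> n p * real n)) at_bot sequentially"
        by (simp add: filterlim_uminus_at_top)
      then have "(\<lambda>n. exp (- (\<psi> n p * real n))) \<longlonglongrightarrow> 0"
        by (rule filterlim_compose[OF exp_at_bot])
      then have "(\<lambda>n. 1 + (-1) * exp (- (\<psi> n p * real n))) \<longlonglongrightarrow> 1 + (-1) * 0"
        by (intro tendsto_intros)
      then show ?thesis using True by (simp add: \<phi>_def mult.commute)
    qed
  qed
qed

lemma indicator_box_meas: "indicat_real (box a b) \<in> borel_measurable M"
  by (intro measurable_restrict_space1 borel_measurable_indicator) auto

text \<open>Dominated convergence along \<open>box_test_approx\<close> gives zero integrals over
  boxes inside the slab. Boxes then determine an integrable function a.e.\<close>

lemma AE_zero_if_orthogonal_to_tests: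
  fixes f :: "pt \<Rightarrow> real"
  assumes f: "integrable M f" and orth: "\<And>\<phi>. test \<phi> \<Longrightarrow> (LINT p|M. f p * \<phi> p) = 0"
  shows "AE p in M. f p = 0"
proof -
  have small_box: "(LINT p|M. f p * indicator (box (a1, a2, a3) (b1, b2, b3)) p) = 0"
    if a: "0 \<le> a1" "b1 \<le> lx" "0 \<le> a2" "b2 \<le> ly" "0 \<le> a3" "b3 \<le> 1" for a1 b1 a2 b2 a3 b3
  proof (cases "a1 < b1 \<and> a2 < b2")
    case False
    then have "box (a1, a2, a3) (b1, b2, b3) = {}" by (auto simp: box_prod)
    then show ?thesis by simp
  next
    case True
    with a obtain \<phi> where \<phi>: "\<And>n. test (\<phi> n)" "\<And>n p. 0 \<le> \<phi> n p \<and> \<phi> n p \<le> 1"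
      "\<And>p. p \<in> Om lx ly \<Longrightarrow> (\<lambda>n. \<phi> n p) \<longlonglongrightarrow> indicator (box (a1, a2, a3) (b1, b2, b3)) p"
      using box_test_approx[of a1 b1 a2 b2 a3 b3] by blast
    have "(\<lambda>n. LINT p|M. f p * \<phi> n p) \<longlonglongrightarrow> (LINT p|M. f p * indicator (box (a1, a2, a3) (b1, b2, b3)) p)"
    proof (rule integral_dominated_convergence[where w = "\<lambda>p. norm (f p)"])
      show "(\<lambda>p. f p * indicator (box (a1, a2, a3) (b1, b2, b3)) p) \<in> borel_measurable M"
        using f by (intro borel_measurable_times indicator_box_meas) auto
      show "(\<lambda>p. f p * \<phi> n p) \<in> borel_measurable M" for n
        by (rule borel_measurable_times[OF borel_measurable_integrable[OF f] cont_meas[OF test_cont[OF \<phi>(1)]]])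
      show "AE p in M. (\<lambda>n. f p * \<phi> n p) \<longlonglongrightarrow> f p * indicator (box (a1, a2, a3) (b1, b2, b3)) p"
        by (rule AE_I2) (auto intro!: tendsto_mult \<phi>(3))
      show "AE p in M. norm (f p * \<phi> n p) \<le> norm (f p)" for n
        using \<phi>(2)[of n] by (intro AE_I2) (auto simp: abs_mult intro!: mult_right_le_one_le)
    qed (use f in auto)
    then show ?thesis using orth[OF \<phi>(1)] by (simp add: LIMSEQ_const_iff)
  qed
  \<comment> \<open>An arbitrary box is clipped to the slab; this changes nothing at interior points
    of the slab, and its faces are null.\<close>
  have box0: "(LINT p|M. f p * indicator (box a b) p) = 0" for a b
  proof -
    obtain a1 a2 a3 b1 b2 b3 where ab: "a = (a1, a2, a3)" "b = (b1, b2, b3)" by (metis prod.collapse)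
    have "(LINT p|M. f p * indicator (box a b) p)
        = (LINT p|M. f p * indicator (box (max 0 a1, max 0 a2, max 0 a3) (min lx b1, min ly b2, min 1 b3)) p)"
    proof (rule integral_cong_AE)
      have ind: "(\<lambda>p. f p * indicator (box c d) p) \<in> borel_measurable M" for c d
        using f by (intro borel_measurable_times indicator_box_meas) auto
      show "(\<lambda>p. f p * indicator (box a b) p) \<in> borel_measurable M"
        "(\<lambda>p. f p * indicator (box (max 0 a1, max 0 a2, max 0 a3) (min lx b1, min ly b2, min 1 b3)) p) \<in> borel_measurable M"
        by (rule ind)+
      show "AE p in M. f p * indicator (box a b) p
          = f p * indicator (box (max 0 a1, max 0 a2, max 0 a3) (min lx b1, min ly b2, min 1 b3)) p"
        using AE_M_interior
        by eventually_elim (auto simp: ab box_prod split: split_indicator)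
    qed
    also have "\<dots> = 0" by (rule small_box) auto
    finally show ?thesis .
  qed
  \<comment> \<open>\<open>f\<close> is only Lebesgue measurable, whereas the box criterion is about
    Borel functions. The extension by zero is therefore replaced by a Borel representative
    \<open>g\<close>.\<close>
  let ?F = "\<lambda>p. indicator (Om lx ly) p *\<^sub>R f p"
  have F: "integrable lebesgue ?F"
    using f by (simp add: integrable_restrict_space)
  obtain g where g: "g \<in> borel_measurable lborel" "AE p in lborel. ?F p = g p"
    using completion_ex_borel_measurable_real[OF borel_measurable_integrable[OF F]] by blast
  have gm: "g \<in> borel_measurable lebesgue" using g(1) by (rule measurable_completion)
  have gAE: "AE p in lebesgue. ?F p = g p" using g(2) by (rule AE_completion)
  have "integrable lebesgue g"
    by (rule integrable_cong_AE_imp[OF F gm]) (use gAE in auto)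
  then have gint: "integrable lborel g" using g(1) by (simp add: integrable_completion)
  have "AE p in lborel. g p = 0"
  proof (rule AE_zero_if_box_integrals_zero[OF gint])
    fix a b :: pt
    have "(LINT x:box a b|lborel. g x) = (LINT x|lebesgue. indicator (box a b) x *\<^sub>R g x)"
      unfolding set_lebesgue_integral_def
      by (rule integral_completion[symmetric]) (use g(1) in measurable)
    also have "\<dots> = (LINT x|lebesgue. indicator (Om lx ly) x *\<^sub>R (f x * indicator (box a b) x))"
    proof (rule integral_cong_AE)
      show "AE x in lebesgue. indicat_real (box a b) x *\<^sub>R g x = indicator (Om lx ly) x *\<^sub>R (f x * indicator (box a b) x)"
        using gAE by eventually_elim (simp add: mult.commute mult.left_commute)
      show "(\<lambda>x. indicat_real (box a b) x *\<^sub>R g x) \<in> borel_measurable lebesgue"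
        by (intro borel_measurable_scaleR borel_measurable_indicator gm) auto
      have "(\<lambda>x. indicator (box a b) x *\<^sub>R ?F x) \<in> borel_measurable lebesgue"
        by (intro borel_measurable_scaleR borel_measurable_indicator borel_measurable_integrable[OF F]) auto
      then show "(\<lambda>x. indicator (Om lx ly) x *\<^sub>R (f x * indicator (box a b) x)) \<in> borel_measurable lebesgue"
        by (simp add: mult.commute mult.left_commute)
    qed
    also have "\<dots> = (LINT p|M. f p * indicator (box a b) p)"
      by (rule integral_restrict_space[symmetric]) simp
    finally show "(LINT x:box a b|lborel. g x) = 0" using box0 by simp
  qed
  then have "AE p in lebesgue. g p = 0" by (rule AE_completion)
  with gAE have "AE p in lebesgue. p \<in> Om lx ly \<longrightarrow> f p = 0"
    by eventually_elim auto
  then show ?thesis by (simp add: AE_restrict_space_iff)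
qed

lemma AE_zero_if_orthogonal_to_tests_vec:
  fixes g :: "pt \<Rightarrow> 'b::euclidean_space"
  assumes g: "sq_int M g" and orth: "\<And>\<phi>. test \<phi> \<Longrightarrow> (LINT p|M. \<phi> p *\<^sub>R g p) = 0"
  shows "AE p in M. g p = 0"
proof -
  have "AE p in M. g p \<bullet> i = 0" if "i \<in> Basis" for i
  proof (rule AE_zero_if_orthogonal_to_tests)
    show "integrable M (\<lambda>p. g p \<bullet> i)"
      by (rule integrable_inner_left) (rule sq_int_imp_integrable[OF g])
    fix \<phi> assume \<phi>: "test \<phi>"
    have "(LINT p|M. (\<phi> p *\<^sub>R g p) \<bullet> i) = (LINT p|M. \<phi> p *\<^sub>R g p) \<bullet> i"
      by (rule integral_inner_left) (rule integrable_sq_scaleR[OF test_sq_int[OF \<phi>] g])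
    then have "(LINT p|M. (\<phi> p *\<^sub>R g p) \<bullet> i) = 0" unfolding orth[OF \<phi>] by simp
    moreover have "(\<phi> p *\<^sub>R g p) \<bullet> i = (g p \<bullet> i) * \<phi> p" for p by (simp add: mult.commute)
    ultimately show "(LINT p|M. (g p \<bullet> i) * \<phi> p) = 0" by (simp only:)
  qed
  then have "AE p in M. \<forall>i\<in>Basis. g p \<bullet> i = 0" by (intro AE_finite_allI) auto
  then show ?thesis by eventually_elim (metis euclidean_all_zero_iff)
qed

lemma weak_grad_unique:
  assumes "sq_int M g" "sq_int M h" "weak_grad lx ly f g" "weak_grad lx ly f h"
  shows "AE p in M. g p = h p"
proof -
  have "AE p in M. g p - h p = 0"
  proof (rule AE_zero_if_orthogonal_to_tests_vec[OF sq_int_diff[OF assms(1,2)]])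
    fix \<phi> assume \<phi>: "test \<phi>"
    have "(LINT p|M. \<phi> p *\<^sub>R g p) = (LINT p|M. \<phi> p *\<^sub>R h p)"
      using assms(3)[unfolded weak_grad_def, rule_format, OF \<phi>]
        assms(4)[unfolded weak_grad_def, rule_format, OF \<phi>] by (simp only: neg_equal_iff_equal)
    then show "(LINT p|M. \<phi> p *\<^sub>R (g p - h p)) = 0"
      using Bochner_Integration.integral_diff[OF integrable_sq_scaleR[OF test_sq_int[OF \<phi>] assms(1)]
          integrable_sq_scaleR[OF test_sq_int[OF \<phi>] assms(2)]]
      by (simp only: scaleR_diff_right diff_self)
  qed
  then show ?thesis by simp
qed

text \<open>The definite description has a single value because two weak gradients in L2 agree
  a.e.\<close>

lemma dirichlet_eq:
  assumes "sq_int M g" "weak_grad lx ly f g"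
  shows "dirichlet lx ly f = (LINT p|M. (norm (g p))\<^sup>2)"
  unfolding dirichlet_def
proof (rule the_equality)
  show "\<exists>ga. L2 lx ly ga \<and> weak_grad lx ly f ga \<and> (LINT p|M. (norm (g p))\<^sup>2) = (LINT p|M. (norm (ga p))\<^sup>2)"
    using assms by (auto simp: L2_sq_int)
  fix c assume "\<exists>g. L2 lx ly g \<and> weak_grad lx ly f g \<and> c = (LINT p|M. (norm (g p))\<^sup>2)"
  then obtain h where h: "sq_int M h" "weak_grad lx ly f h" "c = (LINT p|M. (norm (h p))\<^sup>2)"
    by (auto simp: L2_sq_int)
  have "AE p in M. g p = h p" using weak_grad_unique assms h by blast
  then have "(LINT p|M. (norm (h p))\<^sup>2) = (LINT p|M. (norm (g p))\<^sup>2)"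
    using assms(1) h(1) by (intro integral_cong_AE) (auto simp: sq_int_def)
  with h show "c = (LINT p|M. (norm (g p))\<^sup>2)" by simp
qed

end

section \<open>The space of functions with zero boundary values\<close>

lemma l2norm_le:
  assumes "sq_int M f" "sq_int M g" "AE p in M. norm (f p) \<le> K * norm (g p)" "0 \<le> K"
  shows "l2norm M f \<le> K * l2norm M g"
proof -
  have "(LINT p|M. (norm (f p))\<^sup>2) \<le> (LINT p|M. K\<^sup>2 * (norm (g p))\<^sup>2)"
  proof (rule integral_mono_AE)
    show "AE p in M. (norm (f p))\<^sup>2 \<le> K\<^sup>2 * (norm (g p))\<^sup>2"
      using assms(3) by eventually_elim (metis norm_ge_zero power_mono power_mult_distrib)
    show "integrable M (\<lambda>p. K\<^sup>2 * (norm (g p))\<^sup>2)"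
      by (intro integrable_mult_right sq_int_integrable assms)
  qed (rule sq_int_integrable[OF assms(1)])
  also have "\<dots> = K\<^sup>2 * (LINT p|M. (norm (g p))\<^sup>2)" by simp
  finally have "sqrt (LINT p|M. (norm (f p))\<^sup>2) \<le> sqrt (K\<^sup>2 * (LINT p|M. (norm (g p))\<^sup>2))"
    by (rule real_sqrt_le_mono)
  then show ?thesis using assms(4) by (simp add: l2norm_def real_sqrt_mult)
qed

lemma l2norm_zero_AE:
  assumes "sq_int M f" "l2norm M f = 0"
  shows "AE p in M. f p = 0"
  by (rule l2_zero_AE[OF assms(1)]) (metis assms(2) l2norm_power2 power_zero_numeral)

lemma l2_cauchy:
  assumes F: "\<And>n. sq_int M (F n)" and f: "sq_int M f" and lim: "l2lim M F f" and "e > 0"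
  shows "\<exists>N. \<forall>m\<ge>N. \<forall>n\<ge>N. l2norm M (\<lambda>p. F m p - F n p) < e"
proof -
  have "(\<lambda>n. l2norm M (\<lambda>p. F n p - f p)) \<longlonglongrightarrow> 0" using lim by (simp only: l2lim_iff)
  from order_tendstoD(2)[OF this, of "e / 2"]
  obtain N where N: "\<And>n. n \<ge> N \<Longrightarrow> l2norm M (\<lambda>p. F n p - f p) < e / 2"
    unfolding eventually_sequentially using \<open>e > 0\<close> by auto
  have "l2norm M (\<lambda>p. F m p - F n p) < e" if "m \<ge> N" "n \<ge> N" for m n
    using l2norm_triangle_diff[OF F f F, of m n] N[OF that(1)] N[OF that(2)] l2norm_commute[of M f "F n"]
    by linarith
  then show ?thesis by blast
qed

context slab
begin

text \<open>Membership in \<open>H\<^sup>1\<^sub>0\<close> with the gradient made explicit.\<close>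

definition hg :: "(pt \<Rightarrow> real) \<Rightarrow> (pt \<Rightarrow> pt) \<Rightarrow> bool" where
  "hg f g \<longleftrightarrow> sq_int M f \<and> sq_int M g \<and>
    (\<exists>\<phi>. (\<forall>n. test (\<phi> n)) \<and> l2lim M \<phi> f \<and> l2lim M (\<lambda>n. grad3 (\<phi> n)) g)"

lemma hg_sq_int: "hg f g \<Longrightarrow> sq_int M f" "hg f g \<Longrightarrow> sq_int M g"
  by (simp_all add: hg_def)

lemma hgE:
  assumes "hg f g"
  obtains \<phi> where "\<And>n. test (\<phi> n)" "l2lim M \<phi> f" "l2lim M (\<lambda>n. grad3 (\<phi> n)) g"
  using assms unfolding hg_def by blast

lemma hgI:
  assumes "sq_int M f" "sq_int M g" "\<And>n. test (\<phi> n)" "l2lim M \<phi> f" "l2lim M (\<lambda>n. grad3 (\<phi> n)) g"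
  shows "hg f g"
  using assms unfolding hg_def by blast

lemma hg_test: "test \<phi> \<Longrightarrow> hg \<phi> (grad3 \<phi>)"
  by (rule hgI[where \<phi> = "\<lambda>n. \<phi>"]) (auto intro: test_sq_int test_grad_sq_int l2lim_const)

lemma hg_add:
  assumes "hg f g" "hg f' g'" shows "hg (\<lambda>p. f p + f' p) (\<lambda>p. g p + g' p)"
proof -
  obtain \<phi> where \<phi>: "\<And>n. test (\<phi> n)" "l2lim M \<phi> f" "l2lim M (\<lambda>n. grad3 (\<phi> n)) g"
    using hgE[OF assms(1)] by blast
  obtain \<psi> where \<psi>: "\<And>n. test (\<psi> n)" "l2lim M \<psi> f'" "l2lim M (\<lambda>n. grad3 (\<psi> n)) g'"
    using hgE[OF assms(2)] by blast
  note sq = hg_sq_int[OF assms(1)] hg_sq_int[OF assms(2)]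
  have g: "grad3 (\<lambda>p. \<phi> n p + \<psi> n p) = (\<lambda>p. grad3 (\<phi> n) p + grad3 (\<psi> n) p)" for n
    by (rule ext) (rule grad3_add[OF test_smooth[OF \<phi>(1)] test_smooth[OF \<psi>(1)]])
  show ?thesis
  proof (rule hgI[where \<phi> = "\<lambda>n p. \<phi> n p + \<psi> n p"])
    show "l2lim M (\<lambda>n p. \<phi> n p + \<psi> n p) (\<lambda>p. f p + f' p)"
      by (rule l2lim_add[OF test_sq_int[OF \<phi>(1)] test_sq_int[OF \<psi>(1)] sq(1,3) \<phi>(2) \<psi>(2)])
    show "l2lim M (\<lambda>n. grad3 (\<lambda>p. \<phi> n p + \<psi> n p)) (\<lambda>p. g p + g' p)"
      unfolding g
      by (rule l2lim_add[OF test_grad_sq_int[OF \<phi>(1)] test_grad_sq_int[OF \<psi>(1)] sq(2,4) \<phi>(3) \<psi>(3)])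
  qed (rule sq_int_add[OF sq(1,3)] sq_int_add[OF sq(2,4)] test_add[OF \<phi>(1) \<psi>(1)])+
qed

lemma hg_scale:
  assumes "hg f g" shows "hg (\<lambda>p. c * f p) (\<lambda>p. c *\<^sub>R g p)"
proof -
  obtain \<phi> where \<phi>: "\<And>n. test (\<phi> n)" "l2lim M \<phi> f" "l2lim M (\<lambda>n. grad3 (\<phi> n)) g"
    using hgE[OF assms(1)] by blast
  have g: "grad3 (\<lambda>p. c * \<phi> n p) = (\<lambda>p. c *\<^sub>R grad3 (\<phi> n) p)" for n
    by (rule ext) (rule grad3_scale[OF test_smooth[OF \<phi>(1)]])
  show ?thesis
  proof (rule hgI[where \<phi> = "\<lambda>n p. c * \<phi> n p"])
    show "l2lim M (\<lambda>n p. c * \<phi> n p) (\<lambda>p. c * f p)"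
      using l2lim_scaleR[OF \<phi>(2), of c] by simp
    show "l2lim M (\<lambda>n. grad3 (\<lambda>p. c * \<phi> n p)) (\<lambda>p. c *\<^sub>R g p)"
      unfolding g by (rule l2lim_scaleR[OF \<phi>(3)])
    show "sq_int M (\<lambda>p. c * f p)" using sq_int_scaleR[OF hg_sq_int(1)[OF assms], of c] by simp
  qed (rule sq_int_scaleR[OF hg_sq_int(2)[OF assms]] test_cmult[OF \<phi>(1)])+
qed

lemma hg_diff:
  assumes "hg f g" "hg f' g'" shows "hg (\<lambda>p. f p - f' p) (\<lambda>p. g p - g' p)"
  using hg_add[OF assms(1) hg_scale[OF assms(2), of "-1"]] by simp

text \<open>Both terms are continuous under L2 convergence of the approximants and their gradients,
  so an identity on test functions passes to all of H1_0. This requires \<open>B\<close> in L2; for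
  \<open>B\<close> merely integrable see \<open>hg_functional_bounded\<close>.\<close>

lemma hg_functional:
  assumes A: "sq_int M A" and B: "sq_int M B"
    and zero: "\<And>\<phi>. test \<phi> \<Longrightarrow> (LINT p|M. A p \<bullet> grad3 \<phi> p) + (LINT p|M. B p * \<phi> p) = 0"
    and h: "hg f g"
  shows "(LINT p|M. A p \<bullet> g p) + (LINT p|M. B p * f p) = 0"
proof -
  obtain \<phi> where \<phi>: "\<And>n. test (\<phi> n)" "l2lim M \<phi> f" "l2lim M (\<lambda>n. grad3 (\<phi> n)) g"
    using hgE[OF h] by blast
  have "(\<lambda>n. (LINT p|M. A p \<bullet> grad3 (\<phi> n) p) + (LINT p|M. B p \<bullet> \<phi> n p))
      \<longlonglongrightarrow> (LINT p|M. A p \<bullet> g p) + (LINT p|M. B p \<bullet> f p)"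
    by (rule tendsto_add[OF l2lim_inner[OF test_grad_sq_int[OF \<phi>(1)] hg_sq_int(2)[OF h] A \<phi>(3)]
          l2lim_inner[OF test_sq_int[OF \<phi>(1)] hg_sq_int(1)[OF h] B \<phi>(2)]])
  then have "(\<lambda>n. 0) \<longlonglongrightarrow> (LINT p|M. A p \<bullet> g p) + (LINT p|M. B p * f p)"
    by (simp only: inner_real_def zero[OF \<phi>(1)])
  then show ?thesis by (simp add: LIMSEQ_const_iff)
qed

lemma hg_functional_grad:
  assumes A: "sq_int M A"
    and zero: "\<And>\<phi>. test \<phi> \<Longrightarrow> (LINT p|M. A p \<bullet> grad3 \<phi> p) = 0"
    and h: "hg f g"
  shows "(LINT p|M. A p \<bullet> g p) = 0"
  using hg_functional[OF A sq_int_zero _ h] zero by simp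

lemma hg_poincare:
  assumes h: "hg f g" shows "l2norm M f \<le> 2 * l2norm M g"
proof -
  obtain \<phi> where \<phi>: "\<And>n. test (\<phi> n)" "l2lim M \<phi> f" "l2lim M (\<lambda>n. grad3 (\<phi> n)) g"
    using hgE[OF h] by blast
  have 1: "(\<lambda>n. l2norm M (\<phi> n)) \<longlonglongrightarrow> l2norm M f"
    by (rule l2lim_l2norm[OF test_sq_int[OF \<phi>(1)] hg_sq_int(1)[OF h] \<phi>(2)])
  have 2: "(\<lambda>n. 2 * l2norm M (grad3 (\<phi> n))) \<longlonglongrightarrow> 2 * l2norm M g"
    by (intro tendsto_mult_left l2lim_l2norm[OF test_grad_sq_int[OF \<phi>(1)] hg_sq_int(2)[OF h] \<phi>(3)])
  show ?thesis
    by (rule LIMSEQ_le[OF 1 2]) (use test_poincare[OF \<phi>(1)] in blast)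
qed

text \<open>For a fixed test function \<psi> and direction \<open>i\<close>, the claim is a
  continuous linear identity in \<open>f\<close> and its gradient. For smooth \<open>f\<close> it is
  integration by parts.\<close>

lemma hg_weak_grad:
  assumes h: "hg f g" shows "weak_grad lx ly f g"
  unfolding weak_grad_def
proof (intro allI impI)
  fix \<psi> assume \<psi>: "test \<psi>"
  have i1: "integrable M (\<lambda>p. f p *\<^sub>R grad3 \<psi> p)"
    by (rule integrable_sq_scaleR[OF hg_sq_int(1)[OF h] test_grad_sq_int[OF \<psi>]])
  have i2: "integrable M (\<lambda>p. \<psi> p *\<^sub>R g p)"
    by (rule integrable_sq_scaleR[OF test_sq_int[OF \<psi>] hg_sq_int(2)[OF h]])
  show "(LINT p|M. f p *\<^sub>R grad3 \<psi> p) = - (LINT p|M. \<psi> p *\<^sub>R g p)"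
  proof (rule euclidean_eqI)
    fix i :: pt assume "i \<in> Basis"
    have c1: "continuous_on UNIV (\<lambda>p. \<psi> p *\<^sub>R i)" "continuous_on UNIV (\<lambda>p. grad3 \<psi> p \<bullet> i)"
      by (intro continuous_intros test_cont test_grad_cont \<psi>)+
    have "(LINT p|M. (\<psi> p *\<^sub>R i) \<bullet> g p) + (LINT p|M. (grad3 \<psi> p \<bullet> i) * f p) = 0"
    proof (rule hg_functional[OF cont_sq_int[OF c1(1)] cont_sq_int[OF c1(2)] _ h])
      fix \<phi> assume \<phi>: "test \<phi>"
      have j1: "integrable M (\<lambda>p. \<psi> p *\<^sub>R grad3 \<phi> p)"
        by (rule integrable_sq_scaleR[OF test_sq_int[OF \<psi>] test_grad_sq_int[OF \<phi>]])
      have j2: "integrable M (\<lambda>p. \<phi> p *\<^sub>R grad3 \<psi> p)"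
        by (rule integrable_sq_scaleR[OF test_sq_int[OF \<phi>] test_grad_sq_int[OF \<psi>]])
      have "(LINT p|M. \<psi> p *\<^sub>R grad3 \<phi> p) \<bullet> i = - (LINT p|M. \<phi> p *\<^sub>R grad3 \<psi> p) \<bullet> i"
        using test_by_parts[OF test_per_smooth[OF \<psi>] \<phi>] by simp
      then have "(LINT p|M. (\<psi> p *\<^sub>R grad3 \<phi> p) \<bullet> i) = - (LINT p|M. (\<phi> p *\<^sub>R grad3 \<psi> p) \<bullet> i)"
        using integral_inner_left[OF j1, of i] integral_inner_left[OF j2, of i] by simp
      then show "(LINT p|M. (\<psi> p *\<^sub>R i) \<bullet> grad3 \<phi> p) + (LINT p|M. (grad3 \<psi> p \<bullet> i) * \<phi> p) = 0"
        by (simp add: inner_commute mult.commute)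
    qed
    then have "(LINT p|M. (f p *\<^sub>R grad3 \<psi> p) \<bullet> i) = - (LINT p|M. (\<psi> p *\<^sub>R g p) \<bullet> i)"
      by (simp add: inner_commute mult.commute)
    then show "(LINT p|M. f p *\<^sub>R grad3 \<psi> p) \<bullet> i = (- (LINT p|M. \<psi> p *\<^sub>R g p)) \<bullet> i"
      using integral_inner_left[OF i1, of i] integral_inner_left[OF i2, of i] by simp
  qed
qed

text \<open>A diagonal choice: the n-th test function is within \<open>1 / (n + 1)\<close> of
  \<open>F n\<close>, in value and in gradient.\<close>

lemma hg_closed:
  assumes h: "\<And>n. hg (F n) (G n)" and sq: "sq_int M f" "sq_int M g"
    and lim: "l2lim M F f" "l2lim M G g"
  shows "hg f g"
proof -
  have "\<exists>\<phi>. test \<phi> \<and> l2norm M (\<lambda>p. \<phi> p - F n p) < 1 / real (Suc n) \<and>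
      l2norm M (\<lambda>p. grad3 \<phi> p - G n p) < 1 / real (Suc n)" for n
  proof -
    obtain \<phi> where \<phi>: "\<And>n. test (\<phi> n)" "l2lim M \<phi> (F n)" "l2lim M (\<lambda>n. grad3 (\<phi> n)) (G n)"
      using hgE[OF h[of n]] by blast
    have "\<forall>\<^sub>F k in sequentially. l2norm M (\<lambda>p. \<phi> k p - F n p) < 1 / real (Suc n)"
      by (rule order_tendstoD(2)[OF \<phi>(2)[unfolded l2lim_iff]]) simp
    moreover have "\<forall>\<^sub>F k in sequentially. l2norm M (\<lambda>p. grad3 (\<phi> k) p - G n p) < 1 / real (Suc n)"
      by (rule order_tendstoD(2)[OF \<phi>(3)[unfolded l2lim_iff]]) simp
    ultimately have "\<forall>\<^sub>F k in sequentially. l2norm M (\<lambda>p. \<phi> k p - F n p) < 1 / real (Suc n) \<and>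
        l2norm M (\<lambda>p. grad3 (\<phi> k) p - G n p) < 1 / real (Suc n)"
      by (rule eventually_conj)
    then obtain k where "l2norm M (\<lambda>p. \<phi> k p - F n p) < 1 / real (Suc n) \<and>
        l2norm M (\<lambda>p. grad3 (\<phi> k) p - G n p) < 1 / real (Suc n)"
      unfolding eventually_sequentially by blast
    then show ?thesis using \<phi>(1) by blast
  qed
  then have "\<forall>n. \<exists>\<phi>. test \<phi> \<and> l2norm M (\<lambda>p. \<phi> p - F n p) < 1 / real (Suc n) \<and>
      l2norm M (\<lambda>p. grad3 \<phi> p - G n p) < 1 / real (Suc n)" by blast
  from choice[OF this] obtain \<phi> where \<phi>: "\<And>n. test (\<phi> n)"
    "\<And>n. l2norm M (\<lambda>p. \<phi> n p - F n p) < 1 / real (Suc n)"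
    "\<And>n. l2norm M (\<lambda>p. grad3 (\<phi> n) p - G n p) < 1 / real (Suc n)"
    by blast
  have e: "(\<lambda>n. 1 / real (Suc n)) \<longlonglongrightarrow> 0" by (rule LIMSEQ_Suc[OF lim_1_over_n])
  show ?thesis
  proof (rule hgI[OF sq \<phi>(1)])
    show "l2lim M \<phi> f"
      unfolding l2lim_iff
    proof (rule Lim_null_comparison[OF always_eventually])
      show "\<forall>n. norm (l2norm M (\<lambda>p. \<phi> n p - f p)) \<le> 1 / real (Suc n) + l2norm M (\<lambda>p. F n p - f p)"
      proof
        fix n
        show "norm (l2norm M (\<lambda>p. \<phi> n p - f p)) \<le> 1 / real (Suc n) + l2norm M (\<lambda>p. F n p - f p)"
          using l2norm_triangle_diff[OF test_sq_int[OF \<phi>(1)] hg_sq_int(1)[OF h] sq(1), of n n] \<phi>(2)[of n]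
          unfolding real_norm_def abs_of_nonneg[OF l2norm_nonneg] by linarith
      qed
      show "(\<lambda>n. 1 / real (Suc n) + l2norm M (\<lambda>p. F n p - f p)) \<longlonglongrightarrow> 0"
        using tendsto_add[OF e lim(1)[unfolded l2lim_iff]] by simp
    qed
    show "l2lim M (\<lambda>n. grad3 (\<phi> n)) g"
      unfolding l2lim_iff
    proof (rule Lim_null_comparison[OF always_eventually])
      show "\<forall>n. norm (l2norm M (\<lambda>p. grad3 (\<phi> n) p - g p)) \<le> 1 / real (Suc n) + l2norm M (\<lambda>p. G n p - g p)"
      proof
        fix n
        show "norm (l2norm M (\<lambda>p. grad3 (\<phi> n) p - g p)) \<le> 1 / real (Suc n) + l2norm M (\<lambda>p. G n p - g p)"
          using l2norm_triangle_diff[OF test_grad_sq_int[OF \<phi>(1)] hg_sq_int(2)[OF h] sq(2), of n n] \<phi>(3)[of n]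
          unfolding real_norm_def abs_of_nonneg[OF l2norm_nonneg] by linarith
      qed
      show "(\<lambda>n. 1 / real (Suc n) + l2norm M (\<lambda>p. G n p - g p)) \<longlonglongrightarrow> 0"
        using tendsto_add[OF e lim(2)[unfolded l2lim_iff]] by simp
    qed
  qed
qed

text \<open>By the Poincare inequality, convergence of the gradients alone makes the functions a
  Cauchy sequence. This is why subspaces can be described by gradients only.\<close>

lemma hg_complete:
  assumes h: "\<And>n. hg (F n) (G n)" and g: "sq_int M g" "l2lim M G g"
  obtains f where "hg f g" "l2lim M F f"
proof -
  obtain f where f: "sq_int M f" "l2lim M F f"
  proof (rule l2_complete[of F])
    show "sq_int M (F n)" for n by (rule hg_sq_int(1)[OF h])
    fix e :: real assume "e > 0"
    then obtain N where N: "\<And>m n. m \<ge> N \<Longrightarrow> n \<ge> N \<Longrightarrow> l2norm M (\<lambda>p. G m p - G n p) < e / 2"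
      using l2_cauchy[OF hg_sq_int(2)[OF h] g, of "e / 2"] by (meson half_gt_zero)
    have "l2norm M (\<lambda>p. F m p - F n p) < e" if "m \<ge> N" "n \<ge> N" for m n
      using hg_poincare[OF hg_diff[OF h h], of m n] N[OF that] by linarith
    then show "\<exists>N. \<forall>m\<ge>N. \<forall>n\<ge>N. l2norm M (\<lambda>p. F m p - F n p) < e" by blast
  qed
  show ?thesis by (rule that[OF hg_closed[OF h f(1) g(1) f(2) g(2)] f(2)])
qed

lemma H10_iff_hg: "H10 lx ly f \<longleftrightarrow> (\<exists>g. hg f g)"
proof
  assume "H10 lx ly f"
  then show "\<exists>g. hg f g"
    unfolding H10_def hg_def l2lim_def L2_sq_int real_norm_def power2_abs by blast
next
  assume "\<exists>g. hg f g"
  then obtain g where g: "hg f g" by blast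
  with hg_weak_grad[OF g] show "H10 lx ly f"
    unfolding H10_def hg_def l2lim_def L2_sq_int real_norm_def power2_abs by blast
qed

lemma hg_AE_unique:
  assumes "hg f g" "weak_grad lx ly f h" "sq_int M h"
  shows "AE p in M. g p = h p"
  by (rule weak_grad_unique[OF hg_sq_int(2)[OF assms(1)] assms(3) hg_weak_grad[OF assms(1)] assms(2)])

lemma hg_zero_grad:
  assumes h: "hg f g" and "AE p in M. g p = 0" shows "AE p in M. f p = 0"
proof (rule l2norm_zero_AE[OF hg_sq_int(1)[OF h]])
  have "(LINT p|M. (norm (g p))\<^sup>2) = (LINT p|M. 0)"
    using hg_sq_int(2)[OF h] assms(2) by (intro integral_cong_AE) (auto simp: sq_int_def)
  then have "l2norm M g = 0" by (simp add: l2norm_def)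
  then show "l2norm M f = 0" using hg_poincare[OF h] l2norm_nonneg[of M f] by linarith
qed

section \<open>The inverse Dirichlet Laplacian of a divergence\<close>

lemma grads_subspace: "l2_subspace M {g. \<exists>f. hg f g}"
proof (rule l2_subspaceI)
  show "(\<lambda>p. 0) \<in> {g. \<exists>f. hg f g}"
    using hg_test[OF test_zero] unfolding grad3_const[abs_def] by blast
  fix G :: "nat \<Rightarrow> pt \<Rightarrow> pt" and g assume "\<And>n. G n \<in> {g. \<exists>f. hg f g}" and g: "sq_int M g" "l2lim M G g"
  then have "\<forall>n. \<exists>f. hg f (G n)" by blast
  from choice[OF this] obtain F where "\<And>n. hg (F n) (G n)" by blast
  then show "g \<in> {g. \<exists>f. hg f g}" using hg_complete[OF _ g] by blast
next
  fix g assume "g \<in> {g. \<exists>f. hg f g}"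
  then show "sq_int M g" by (auto dest: hg_sq_int(2))
next
  fix g h assume "g \<in> {g. \<exists>f. hg f g}" "h \<in> {g. \<exists>f. hg f g}"
  then obtain f f' where "hg f g" "hg f' h" by blast
  from hg_add[OF this] show "(\<lambda>p. g p + h p) \<in> {g. \<exists>f. hg f g}" by blast
next
  fix g c assume "g \<in> {g. \<exists>f. hg f g}"
  then obtain f where "hg f g" by blast
  from hg_scale[OF this, of c] show "(\<lambda>p. c *\<^sub>R g p) \<in> {g. \<exists>f. hg f g}" by blast
qed

text \<open>The weak equation \<open>\<Delta>\<psi> = div F\<close> says that \<open>F\<close> minus
  the gradient of \<psi> is orthogonal to all gradients from H1_0. So the solution is the orthogonal
  projection of \<open>F\<close> onto these gradients.\<close>

lemma inv_lap_div_exists: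
  assumes "sq_int M F"
  obtains \<psi> k where "hg \<psi> k" "\<And>f g. hg f g \<Longrightarrow> (LINT p|M. F p \<bullet> g p) = (LINT p|M. k p \<bullet> g p)"
proof -
  obtain k where k: "k \<in> {g. \<exists>f. hg f g}"
    "\<And>g. g \<in> {g. \<exists>f. hg f g} \<Longrightarrow> (LINT p|M. F p \<bullet> g p) = (LINT p|M. k p \<bullet> g p)"
    using l2_projection[OF grads_subspace assms] by blast
  from k(1) obtain \<psi> where "hg \<psi> k" by blast
  with that k(2) show ?thesis by blast
qed

text \<open>The description is single-valued: the difference of two solution gradients is orthogonal
  to gradients of test functions, hence by density to itself.\<close>

lemma inv_lap_div_energy_eq:
  assumes h: "hg \<psi> k" and eq: "\<And>\<phi>. test \<phi> \<Longrightarrow> (LINT p|M. k p \<bullet> grad3 \<phi> p) = (LINT p|M. F p \<bullet> grad3 \<phi> p)"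
  shows "inv_lap_div_energy lx ly F = (LINT p|M. (norm (k p))\<^sup>2)"
  unfolding inv_lap_div_energy_def
proof (rule the_equality)
  have "inv_lap_div lx ly F \<psi>"
    unfolding inv_lap_div_def H10_iff_hg L2_sq_int
    using h hg_sq_int(2)[OF h] hg_weak_grad[OF h] eq by blast
  moreover have "(LINT p|M. (norm (k p))\<^sup>2) = dirichlet lx ly \<psi>"
    by (rule dirichlet_eq[symmetric, OF hg_sq_int(2)[OF h] hg_weak_grad[OF h]])
  ultimately show "\<exists>\<psi>. inv_lap_div lx ly F \<psi> \<and> (LINT p|M. (norm (k p))\<^sup>2) = dirichlet lx ly \<psi>" by blast
  fix c assume "\<exists>\<psi>. inv_lap_div lx ly F \<psi> \<and> c = dirichlet lx ly \<psi>"
  then obtain \<psi>' k' g where \<psi>': "hg \<psi>' k'" "c = dirichlet lx ly \<psi>'"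
    and g: "sq_int M g" "weak_grad lx ly \<psi>' g"
    and eq': "\<And>\<phi>. test \<phi> \<Longrightarrow> (LINT p|M. g p \<bullet> grad3 \<phi> p) = (LINT p|M. F p \<bullet> grad3 \<phi> p)"
    unfolding inv_lap_div_def H10_iff_hg L2_sq_int by blast
  have gk: "AE p in M. k' p = g p" by (rule hg_AE_unique[OF \<psi>'(1) g(2,1)])
  note k = hg_sq_int(2)[OF h] and k' = hg_sq_int(2)[OF \<psi>'(1)]
  have "(LINT p|M. (k p - k' p) \<bullet> (k p - k' p)) = 0"
  proof (rule hg_functional_grad[OF sq_int_diff[OF k k'] _ hg_diff[OF h \<psi>'(1)]])
    fix \<phi> assume \<phi>: "test \<phi>"
    note t = test_grad_sq_int[OF \<phi>]
    have "(LINT p|M. k' p \<bullet> grad3 \<phi> p) = (LINT p|M. g p \<bullet> grad3 \<phi> p)"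
      by (rule integral_cong_AE)
        (use gk borel_measurable_integrable[OF integrable_sq_inner[OF k' t]]
          borel_measurable_integrable[OF integrable_sq_inner[OF g(1) t]] in auto)
    then show "(LINT p|M. (k p - k' p) \<bullet> grad3 \<phi> p) = 0"
      using Bochner_Integration.integral_diff[OF integrable_sq_inner[OF k t] integrable_sq_inner[OF k' t]]
        eq[OF \<phi>] eq'[OF \<phi>] by (simp only: inner_diff_left diff_self)
  qed
  then have "AE p in M. k p - k' p = 0"
    by (intro l2_zero_AE[OF sq_int_diff[OF k k']]) (simp only: power2_norm_eq_inner)
  then have "(LINT p|M. (norm (k' p))\<^sup>2) = (LINT p|M. (norm (k p))\<^sup>2)"
    using k k' by (intro integral_cong_AE) (auto simp: sq_int_def)
  then show "c = (LINT p|M. (norm (k p))\<^sup>2)"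
    using \<psi>'(2) dirichlet_eq[OF k' hg_weak_grad[OF \<psi>'(1)]] by simp
qed


text \<open>\<open>S'\<close> and \<open>db\<close> stand for the derivatives of \<open>S\<close> and \<open>b\<close>. The test function need only agree
  with the truncation on the slab, outside of which \<open>S(b)\<close> need not vanish.\<close>

definition admissible :: "(pt \<Rightarrow> real) \<Rightarrow> (pt \<Rightarrow> pt) \<Rightarrow> (real \<Rightarrow> real) \<Rightarrow> (real \<Rightarrow> real) \<Rightarrow> bool" where
  "admissible b db S S' \<longleftrightarrow> (\<forall>\<phi>. test \<phi> \<longrightarrow> (\<exists>\<psi>. test \<psi> \<and> (\<forall>p\<in>Om lx ly. \<psi> p = S (b p + \<phi> p) \<and>
    grad3 \<psi> p = S' (b p + \<phi> p) *\<^sub>R (db p + grad3 \<phi> p))))"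

text \<open>The approximants of \<open>\<theta>\<close> need not be bounded, but those of the truncation \<open>S(b + \<theta>)\<close> take values
  in the range of \<open>S\<close>.\<close>

lemma truncation_approx:
  assumes h: "hg \<theta> G" and b: "continuous_on UNIV b" and db: "continuous_on UNIV db"
    and S: "\<And>t. (S has_real_derivative S' t) (at t)" and S'c: "continuous_on UNIV S'" and S'b: "\<And>t. \<bar>S' t\<bar> \<le> K"
    and adm: "admissible b db S S'"
  obtains \<psi> where "\<And>n. test (\<psi> n)" "\<And>n p. p \<in> Om lx ly \<Longrightarrow> \<psi> n p \<in> range S"
    "AE p in M. (\<lambda>n. \<psi> n p) \<longlonglongrightarrow> S (b p + \<theta> p)"
    "sq_int M (\<lambda>p. S (b p + \<theta> p))" "sq_int M (\<lambda>p. S' (b p + \<theta> p) *\<^sub>R (db p + G p))"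
    "l2lim M \<psi> (\<lambda>p. S (b p + \<theta> p))"
    "l2lim M (\<lambda>n. grad3 (\<psi> n)) (\<lambda>p. S' (b p + \<theta> p) *\<^sub>R (db p + G p))"
proof -
  obtain \<phi>0 where \<phi>0: "\<And>n. test (\<phi>0 n)" "l2lim M \<phi>0 \<theta>" "l2lim M (\<lambda>n. grad3 (\<phi>0 n)) G"
    using hgE[OF h] by blast
  \<comment> \<open>Pointwise convergence is needed for the coefficient
    \<open>S' (b + \<phi>)\<close>, since \<open>S'\<close> is only assumed continuous and
    bounded.\<close>
  obtain r :: "nat \<Rightarrow> nat" where r: "strict_mono r" "AE p in M. (\<lambda>n. \<phi>0 (r n) p) \<longlonglongrightarrow> \<theta> p"
    using l2lim_AE_subseq[OF test_sq_int[OF \<phi>0(1)] hg_sq_int(1)[OF h] \<phi>0(2)] by blast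
  define \<phi> where "\<phi> n = \<phi>0 (r n)" for n
  have \<phi>: "test (\<phi> n)" "l2lim M \<phi> \<theta>" "l2lim M (\<lambda>n. grad3 (\<phi> n)) G" "AE p in M. (\<lambda>n. \<phi> n p) \<longlonglongrightarrow> \<theta> p" for n
    unfolding \<phi>_def using \<phi>0(1) l2lim_subseq[OF \<phi>0(2) r(1)] l2lim_subseq[OF \<phi>0(3) r(1)] r(2) by simp_all
  have "\<forall>n. \<exists>\<psi>. test \<psi> \<and> (\<forall>p\<in>Om lx ly. \<psi> p = S (b p + \<phi> n p) \<and>
      grad3 \<psi> p = S' (b p + \<phi> n p) *\<^sub>R (db p + grad3 (\<phi> n) p))"
    using adm \<phi>(1) unfolding admissible_def by blast
  from choice[OF this] obtain \<psi> where \<psi>: "\<And>n. test (\<psi> n)"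
    "\<And>n p. p \<in> Om lx ly \<Longrightarrow> \<psi> n p = S (b p + \<phi> n p)"
    "\<And>n p. p \<in> Om lx ly \<Longrightarrow> grad3 (\<psi> n) p = S' (b p + \<phi> n p) *\<^sub>R (db p + grad3 (\<phi> n) p)"
    by blast
  note \<theta> = hg_sq_int(1)[OF h] and G = hg_sq_int(2)[OF h]
  have K0: "0 \<le> K" using S'b[of 0] by linarith
  have lip: "\<bar>S s - S t\<bar> \<le> K * \<bar>s - t\<bar>" for s t
    using field_differentiable_bound[of UNIV S S' K s t] S S'b by simp
  have Sc: "continuous_on UNIV S"
    using S by (meson DERIV_isCont continuous_at_imp_continuous_on)
  have bm: "b \<in> borel_measurable M" and dbm: "db \<in> borel_measurable M"
    using cont_meas b db by blast+
  have comp: "(\<lambda>p. f (b p + g p)) \<in> borel_measurable M"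
    if "continuous_on UNIV f" "sq_int M g" for f g :: "_ \<Rightarrow> real"
    by (rule measurable_compose[OF borel_measurable_add[OF bm sq_int_meas[OF that(2)]]
          borel_measurable_continuous_onI[OF that(1)]])
  have bsq: "sq_int M (\<lambda>p. b p + \<theta> p)" by (rule sq_int_add[OF cont_sq_int[OF b] \<theta>])
  have ST: "sq_int M (\<lambda>p. S (b p + \<theta> p))"
  proof (rule sq_int_bound[OF comp[OF Sc \<theta>]])
    show "integrable M (\<lambda>p. (norm (\<bar>S 0\<bar> + K * \<bar>b p + \<theta> p\<bar>))\<^sup>2)"
    proof (rule sq_int_integrable, rule sq_int_add)
      show "sq_int M (\<lambda>p. \<bar>S 0\<bar>)" by (rule cont_sq_int) (rule continuous_on_const)
      have "sq_int M (\<lambda>p. \<bar>b p + \<theta> p\<bar>)" using bsq by (auto simp: sq_int_def)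
      from sq_int_scaleR[OF this, of K] show "sq_int M (\<lambda>p. K * \<bar>b p + \<theta> p\<bar>)" by simp
    qed
    show "AE p in M. (norm (S (b p + \<theta> p)))\<^sup>2 \<le> (norm (\<bar>S 0\<bar> + K * \<bar>b p + \<theta> p\<bar>))\<^sup>2"
    proof (rule AE_I2, rule power_mono)
      fix p
      have "\<bar>S (b p + \<theta> p)\<bar> \<le> \<bar>S 0\<bar> + K * \<bar>b p + \<theta> p\<bar>"
        using lip[of "b p + \<theta> p" 0] by simp
      then show "norm (S (b p + \<theta> p)) \<le> norm (\<bar>S 0\<bar> + K * \<bar>b p + \<theta> p\<bar>)" by simp
    qed simp
  qed
  have Gsq: "sq_int M (\<lambda>p. db p + G p)" by (rule sq_int_add[OF cont_sq_int[OF db] G])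
  have S'T: "sq_int M (\<lambda>p. S' (b p + \<theta> p) *\<^sub>R (db p + G p))"
    by (rule sq_int_bdd_scaleR[OF Gsq comp[OF S'c \<theta>], where C = K]) (simp add: S'b)
  show ?thesis
  proof (rule that[OF \<psi>(1) _ _ ST S'T])
    show "\<psi> n p \<in> range S" if "p \<in> Om lx ly" for n p
      using \<psi>(2)[OF that] by simp
    show "AE p in M. (\<lambda>n. \<psi> n p) \<longlonglongrightarrow> S (b p + \<theta> p)"
      using \<phi>(4) AE_space
    proof eventually_elim
      case (elim p)
      have "isCont S (b p + \<theta> p)" by (rule DERIV_isCont[OF S])
      then have "(\<lambda>n. S (b p + \<phi> n p)) \<longlonglongrightarrow> S (b p + \<theta> p)"
        by (rule isCont_tendsto_compose) (intro tendsto_intros elim(1))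
      then show ?case using \<psi>(2) elim(2) by simp
    qed
    show "l2lim M \<psi> (\<lambda>p. S (b p + \<theta> p))"
      unfolding l2lim_iff
    proof (rule Lim_null_comparison[OF always_eventually])
      show "\<forall>n. norm (l2norm M (\<lambda>p. \<psi> n p - S (b p + \<theta> p))) \<le> K * l2norm M (\<lambda>p. \<phi> n p - \<theta> p)"
      proof
        fix n
        have "AE p in M. norm (\<psi> n p - S (b p + \<theta> p)) \<le> K * norm (\<phi> n p - \<theta> p)"
        proof (rule AE_I2)
          fix p assume "p \<in> space M"
          then show "norm (\<psi> n p - S (b p + \<theta> p)) \<le> K * norm (\<phi> n p - \<theta> p)"
            using \<psi>(2)[of p n] lip[of "b p + \<phi> n p" "b p + \<theta> p"] by simp
        qed
        then have "l2norm M (\<lambda>p. \<psi> n p - S (b p + \<theta> p)) \<le> K * l2norm M (\<lambda>p. \<phi> n p - \<theta> p)"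
          by (rule l2norm_le[OF sq_int_diff[OF test_sq_int[OF \<psi>(1)] ST]
                sq_int_diff[OF test_sq_int[OF \<phi>(1)] \<theta>] _ K0])
        then show "norm (l2norm M (\<lambda>p. \<psi> n p - S (b p + \<theta> p))) \<le> K * l2norm M (\<lambda>p. \<phi> n p - \<theta> p)" by simp
      qed
      show "(\<lambda>n. K * l2norm M (\<lambda>p. \<phi> n p - \<theta> p)) \<longlonglongrightarrow> 0"
        using \<phi>(2)[unfolded l2lim_iff] by (rule tendsto_mult_right_zero)
    qed
    \<comment> \<open>The error of the gradients splits in two: in \<open>?X\<close> the gradient
      converges and the coefficient stays bounded by \<open>K\<close>; in \<open>?Y\<close> the
      coefficient converges pointwise against a fixed L2 field, so domination applies.\<close>
    let ?X = "\<lambda>n p. S' (b p + \<phi> n p) *\<^sub>R (grad3 (\<phi> n) p - G p)"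
    let ?Y = "\<lambda>n p. (S' (b p + \<phi> n p) - S' (b p + \<theta> p)) *\<^sub>R (db p + G p)"
    have dsq: "sq_int M (\<lambda>p. grad3 (\<phi> n) p - G p)" for n
      by (rule sq_int_diff[OF test_grad_sq_int[OF \<phi>(1)] G])
    have Xsq: "sq_int M (?X n)" for n
      by (rule sq_int_bdd_scaleR[OF dsq comp[OF S'c test_sq_int[OF \<phi>(1)]], where C = K]) (simp add: S'b)
    have S'2: "\<bar>S' s - S' t\<bar> \<le> 2 * K" for s t using S'b[of s] S'b[of t] by linarith
    have Ym: "(\<lambda>p. S' (b p + \<phi> n p) - S' (b p + \<theta> p)) \<in> borel_measurable M" for n
      by (rule borel_measurable_diff[OF comp[OF S'c test_sq_int[OF \<phi>(1)]] comp[OF S'c \<theta>]])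
    have Ysq: "sq_int M (?Y n)" for n
      by (rule sq_int_bdd_scaleR[OF Gsq Ym, where C = "2 * K"]) (simp add: S'2)
    have X0: "l2lim M ?X (\<lambda>p. 0)"
      unfolding l2lim_iff
    proof (rule Lim_null_comparison[OF always_eventually])
      show "\<forall>n. norm (l2norm M (\<lambda>p. ?X n p - 0)) \<le> K * l2norm M (\<lambda>p. grad3 (\<phi> n) p - G p)"
      proof
        fix n
        have "l2norm M (?X n) \<le> K * l2norm M (\<lambda>p. grad3 (\<phi> n) p - G p)"
          by (rule l2norm_le[OF Xsq dsq _ K0]) (simp add: S'b mult_right_mono)
        then show "norm (l2norm M (\<lambda>p. ?X n p - 0)) \<le> K * l2norm M (\<lambda>p. grad3 (\<phi> n) p - G p)" by simp
      qed
      show "(\<lambda>n. K * l2norm M (\<lambda>p. grad3 (\<phi> n) p - G p)) \<longlonglongrightarrow> 0"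
        using \<phi>(3)[unfolded l2lim_iff] by (rule tendsto_mult_right_zero)
    qed
    have Y0: "l2lim M ?Y (\<lambda>p. 0)"
      unfolding l2lim_def
    proof -
      have "(\<lambda>n. LINT p|M. (norm (?Y n p - 0))\<^sup>2) \<longlonglongrightarrow> (LINT p|M. 0)"
      proof (rule integral_dominated_convergence[where w = "\<lambda>p. (2 * K)\<^sup>2 * (norm (db p + G p))\<^sup>2"])
        show "integrable M (\<lambda>p. (2 * K)\<^sup>2 * (norm (db p + G p))\<^sup>2)"
          by (intro integrable_mult_right sq_int_integrable Gsq)
        show "(\<lambda>p. (norm (?Y n p - 0))\<^sup>2) \<in> borel_measurable M" for n
          using borel_measurable_integrable[OF sq_int_integrable[OF Ysq]] by simp
        show "AE p in M. (\<lambda>n. (norm (?Y n p - 0))\<^sup>2) \<longlonglongrightarrow> 0"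
          using \<phi>(4)
        proof eventually_elim
          case (elim p)
          have "isCont S' (b p + \<theta> p)" using S'c by (simp add: continuous_on_eq_continuous_at)
          then have "(\<lambda>n. S' (b p + \<phi> n p)) \<longlonglongrightarrow> S' (b p + \<theta> p)"
            by (rule isCont_tendsto_compose) (intro tendsto_intros elim)
          then have "(\<lambda>n. (norm ((S' (b p + \<phi> n p) - S' (b p + \<theta> p)) *\<^sub>R (db p + G p) - 0))\<^sup>2)
              \<longlonglongrightarrow> (norm ((S' (b p + \<theta> p) - S' (b p + \<theta> p)) *\<^sub>R (db p + G p) - 0))\<^sup>2"
            by (intro tendsto_intros)
          then show ?case by simp
        qed
        show "AE p in M. norm ((norm (?Y n p - 0))\<^sup>2) \<le> (2 * K)\<^sup>2 * (norm (db p + G p))\<^sup>2" for n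
        proof (rule AE_I2)
          fix p
          have "\<bar>S' (b p + \<phi> n p) - S' (b p + \<theta> p)\<bar>\<^sup>2 \<le> (2 * K)\<^sup>2" by (intro power_mono S'2) simp
          from mult_right_mono[OF this, of "(norm (db p + G p))\<^sup>2"]
          show "norm ((norm (?Y n p - 0))\<^sup>2) \<le> (2 * K)\<^sup>2 * (norm (db p + G p))\<^sup>2"
            by (simp add: power_mult_distrib)
        qed
      qed simp
      then show "(\<lambda>n. LINT p|M. (norm (?Y n p - 0))\<^sup>2) \<longlonglongrightarrow> 0" by simp
    qed
    have "l2lim M (\<lambda>n p. ?X n p + ?Y n p) (\<lambda>p. 0 + 0)"
      by (rule l2lim_add[OF Xsq Ysq sq_int_zero sq_int_zero X0 Y0])
    moreover have "(LINT p|M. (norm (grad3 (\<psi> n) p - S' (b p + \<theta> p) *\<^sub>R (db p + G p)))\<^sup>2)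
        = (LINT p|M. (norm (?X n p + ?Y n p - (0 + 0)))\<^sup>2)" for n
      by (rule Bochner_Integration.integral_cong[OF refl]) (simp add: \<psi>(3) algebra_simps)
    ultimately show "l2lim M (\<lambda>n. grad3 (\<psi> n)) (\<lambda>p. S' (b p + \<theta> p) *\<^sub>R (db p + G p))"
      unfolding l2lim_def by simp
  qed
qed

text \<open>\<open>B\<close> is only integrable, so L2 convergence of the approximants does not
  suffice in the second term. Their values lie in the range of \<open>S\<close> and are bounded by
  \<open>C\<close>, which allows dominated convergence there.\<close>

lemma truncation_functional:
  assumes h: "hg \<theta> G" and b: "continuous_on UNIV b" and db: "continuous_on UNIV db"
    and S: "\<And>t. (S has_real_derivative S' t) (at t)" and S'c: "continuous_on UNIV S'" and S'b: "\<And>t. \<bar>S' t\<bar> \<le> K"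
    and adm: "admissible b db S S'"
    and Sb: "\<And>t. \<bar>S t\<bar> \<le> C"
    and A: "sq_int M A" and B: "integrable M B"
    and zero: "\<And>\<phi>. test \<phi> \<Longrightarrow> (LINT p|M. A p \<bullet> grad3 \<phi> p) + (LINT p|M. B p * \<phi> p) = 0"
  shows "(LINT p|M. A p \<bullet> (S' (b p + \<theta> p) *\<^sub>R (db p + G p))) + (LINT p|M. B p * S (b p + \<theta> p)) = 0"
proof (rule truncation_approx[OF h b db S S'c S'b adm])
  fix \<psi> assume \<psi>: "\<And>n. test (\<psi> n)" "\<And>n p. p \<in> Om lx ly \<Longrightarrow> \<psi> n p \<in> range S"
    "AE p in M. (\<lambda>n. \<psi> n p) \<longlonglongrightarrow> S (b p + \<theta> p)"
    "sq_int M (\<lambda>p. S (b p + \<theta> p))" "sq_int M (\<lambda>p. S' (b p + \<theta> p) *\<^sub>R (db p + G p))"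
    "l2lim M (\<lambda>n. grad3 (\<psi> n)) (\<lambda>p. S' (b p + \<theta> p) *\<^sub>R (db p + G p))"
  have 1: "(\<lambda>n. LINT p|M. A p \<bullet> grad3 (\<psi> n) p) \<longlonglongrightarrow> (LINT p|M. A p \<bullet> (S' (b p + \<theta> p) *\<^sub>R (db p + G p)))"
    by (rule l2lim_inner[OF test_grad_sq_int[OF \<psi>(1)] \<psi>(5) A \<psi>(6)])
  have 2: "(\<lambda>n. LINT p|M. B p * \<psi> n p) \<longlonglongrightarrow> (LINT p|M. B p * S (b p + \<theta> p))"
  proof (rule integral_dominated_convergence[where w = "\<lambda>p. C * norm (B p)"])
    show "(\<lambda>p. B p * S (b p + \<theta> p)) \<in> borel_measurable M"
      by (rule borel_measurable_times[OF borel_measurable_integrable[OF B] sq_int_meas[OF \<psi>(4)]])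
    show "(\<lambda>p. B p * \<psi> n p) \<in> borel_measurable M" for n
      by (rule borel_measurable_times[OF borel_measurable_integrable[OF B] sq_int_meas[OF test_sq_int[OF \<psi>(1)]]])
    show "integrable M (\<lambda>p. C * norm (B p))"
      by (intro integrable_mult_right integrable_norm B)
    show "AE p in M. (\<lambda>n. B p * \<psi> n p) \<longlonglongrightarrow> B p * S (b p + \<theta> p)"
      using \<psi>(3) by eventually_elim (rule tendsto_mult_left)
    show "AE p in M. norm (B p * \<psi> n p) \<le> C * norm (B p)" for n
    proof (rule AE_I2)
      fix p assume "p \<in> space M"
      then obtain t where "\<psi> n p = S t" using \<psi>(2)[of p n] by auto
      then show "norm (B p * \<psi> n p) \<le> C * norm (B p)"
        using mult_right_mono[OF Sb[of t] abs_ge_zero[of "B p"]] by (simp add: abs_mult mult.commute)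
    qed
  qed
  show ?thesis
    using tendsto_add[OF 1 2] by (simp only: zero[OF \<psi>(1)] LIMSEQ_const_iff)
qed

text \<open>The truncations \<open>sin (k \<theta>) / k\<close> are smooth, bounded and fix 0, and
  they tend to \<theta> as \<open>k\<close> tends to 0 while their derivatives
  \<open>cos (k \<theta>)\<close> tend to 1. They are dominated by \<theta>, and
  \<open>B \<theta>\<close> is integrable because \<theta> is bounded.\<close>

lemma hg_functional_bounded:
  assumes h: "hg \<theta> G" and bd: "AE p in M. \<bar>\<theta> p\<bar> \<le> C"
    and A: "sq_int M A" and B: "integrable M B"
    and zero: "\<And>\<phi>. test \<phi> \<Longrightarrow> (LINT p|M. A p \<bullet> grad3 \<phi> p) + (LINT p|M. B p * \<phi> p) = 0"
  shows "(LINT p|M. A p \<bullet> G p) + (LINT p|M. B p * \<theta> p) = 0"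
proof -
  define k where "k n = 1 / real (Suc n)" for n
  have k0: "k n > 0" for n by (simp add: k_def)
  have klim: "k \<longlonglongrightarrow> 0" unfolding k_def by (rule LIMSEQ_Suc[OF lim_1_over_n])
  have kat: "filterlim k (at 0) sequentially"
  proof -
    have "k n \<noteq> 0" for n using k0[of n] by simp
    then show ?thesis unfolding filterlim_at using klim by simp
  qed
  let ?S = "\<lambda>n t. sin (k n * t) / k n" and ?S' = "\<lambda>n t. cos (k n * t)"
  have S: "(?S n has_real_derivative ?S' n t) (at t)" for n t
    using k0[of n] by (auto intro!: derivative_eq_intros)
  have sm: "smooth1 (?S n)" for n
    using smooth1_sin_cos[of "1 / k n" "k n" 0] by simp
  have eq: "(LINT p|M. A p \<bullet> (?S' n (0 + \<theta> p) *\<^sub>R (0 + G p))) + (LINT p|M. B p * ?S n (0 + \<theta> p)) = 0" for n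
  proof (rule truncation_functional[where b = "\<lambda>p. 0" and db = "\<lambda>p. 0" and S = "?S n" and S' = "?S' n"
        and K = 1 and C = "1 / k n", OF h continuous_on_const continuous_on_const S])
    show "continuous_on UNIV (?S' n)" by (intro continuous_intros)
    show "\<bar>?S n t\<bar> \<le> 1 / k n" for t using k0[of n] by (simp add: divide_right_mono)
    show "admissible (\<lambda>p. 0) (\<lambda>p. 0) (?S n) (?S' n)"
      unfolding admissible_def
    proof (intro allI impI)
      fix \<phi> assume \<phi>: "test \<phi>"
      show "\<exists>\<psi>. test \<psi> \<and> (\<forall>p\<in>Om lx ly. \<psi> p = ?S n (0 + \<phi> p) \<and> grad3 \<psi> p = ?S' n (0 + \<phi> p) *\<^sub>R (0 + grad3 \<phi> p))"
        using test_compose[OF sm _ \<phi>, of n] grad3_compose[OF S test_smooth[OF \<phi>], of n]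
        by (intro exI[of _ "\<lambda>p. ?S n (\<phi> p)"]) simp
    qed
  qed (use A B zero in simp_all)
  note G = hg_sq_int(2)[OF h] and \<theta> = hg_sq_int(1)[OF h]
  have AG: "integrable M (\<lambda>p. A p \<bullet> G p)" by (rule integrable_sq_inner[OF A G])
  have B\<theta>: "integrable M (\<lambda>p. B p * \<theta> p)" by (rule integrable_bdd_mult[OF B sq_int_meas[OF \<theta>] bd])
  have [measurable]: "\<theta> \<in> borel_measurable M" "B \<in> borel_measurable M" "(\<lambda>p. A p \<bullet> G p) \<in> borel_measurable M"
    using \<theta> B AG by (auto simp: sq_int_def)
  have 1: "(\<lambda>n. LINT p|M. cos (k n * \<theta> p) * (A p \<bullet> G p)) \<longlonglongrightarrow> (LINT p|M. A p \<bullet> G p)"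
  proof (rule integral_dominated_convergence[where w = "\<lambda>p. norm (A p \<bullet> G p)"])
    show "AE p in M. (\<lambda>n. cos (k n * \<theta> p) * (A p \<bullet> G p)) \<longlonglongrightarrow> A p \<bullet> G p"
    proof (rule AE_I2)
      fix p
      have "(\<lambda>n. cos (k n * \<theta> p) * (A p \<bullet> G p)) \<longlonglongrightarrow> cos (0 * \<theta> p) * (A p \<bullet> G p)"
        by (intro tendsto_intros klim)
      then show "(\<lambda>n. cos (k n * \<theta> p) * (A p \<bullet> G p)) \<longlonglongrightarrow> A p \<bullet> G p" by simp
    qed
    show "AE p in M. norm (cos (k n * \<theta> p) * (A p \<bullet> G p)) \<le> norm (A p \<bullet> G p)" for n
      by (rule AE_I2) (simp add: abs_mult mult_left_le_one_le)
  qed (use AG in simp_all)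
  have 2: "(\<lambda>n. LINT p|M. B p * (sin (k n * \<theta> p) / k n)) \<longlonglongrightarrow> (LINT p|M. B p * \<theta> p)"
  proof (rule integral_dominated_convergence[where w = "\<lambda>p. norm (B p * \<theta> p)"])
    show "AE p in M. (\<lambda>n. B p * (sin (k n * \<theta> p) / k n)) \<longlonglongrightarrow> B p * \<theta> p"
    proof (rule AE_I2)
      fix p
      have "((\<lambda>h. sin (h * \<theta> p)) has_real_derivative cos (0 * \<theta> p) * \<theta> p) (at 0)"
        by (auto intro!: derivative_eq_intros)
      then have "(\<lambda>h. sin (h * \<theta> p) / h) \<midarrow>0\<rightarrow> \<theta> p" by (simp add: DERIV_def)
      then have "(\<lambda>n. sin (k n * \<theta> p) / k n) \<longlonglongrightarrow> \<theta> p"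
        by (rule filterlim_compose[OF _ kat])
      then show "(\<lambda>n. B p * (sin (k n * \<theta> p) / k n)) \<longlonglongrightarrow> B p * \<theta> p" by (rule tendsto_mult_left)
    qed
    show "AE p in M. norm (B p * (sin (k n * \<theta> p) / k n)) \<le> norm (B p * \<theta> p)" for n
    proof (rule AE_I2)
      fix p
      have "\<bar>sin (k n * \<theta> p)\<bar> \<le> \<bar>k n * \<theta> p\<bar>" by (rule abs_sin_x_le_abs_x)
      then have "\<bar>sin (k n * \<theta> p) / k n\<bar> \<le> \<bar>\<theta> p\<bar>"
        using k0[of n] by (simp add: abs_mult field_simps)
      then show "norm (B p * (sin (k n * \<theta> p) / k n)) \<le> norm (B p * \<theta> p)"
        unfolding real_norm_def abs_mult by (rule mult_left_mono) simp
    qed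
  qed (use B\<theta> in simp_all)
  have "(\<lambda>n. (LINT p|M. cos (k n * \<theta> p) * (A p \<bullet> G p)) + (LINT p|M. B p * (sin (k n * \<theta> p) / k n)))
      \<longlonglongrightarrow> (LINT p|M. A p \<bullet> G p) + (LINT p|M. B p * \<theta> p)"
    by (rule tendsto_add[OF 1 2])
  moreover have "(LINT p|M. cos (k n * \<theta> p) * (A p \<bullet> G p)) + (LINT p|M. B p * (sin (k n * \<theta> p) / k n)) = 0" for n
    using eq[of n] by simp
  ultimately show ?thesis by (simp only: LIMSEQ_const_iff)
qed

end

section \<open>The maximum principle\<close>

text \<open>Cubing \<open>y / 3 <= exp (y / 3)\<close> produces the constant
  \<open>27 = 3^3\<close>.\<close>

lemma exp_cube_bound: "0 \<le> y \<Longrightarrow> y ^ 3 * exp (- y) \<le> (27::real)"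
proof -
  assume "0 \<le> y"
  then have "y / 3 \<le> exp (y / 3)" using exp_ge_add_one_self[of "y / 3"] by linarith
  then have "(y / 3) ^ 3 \<le> exp (y / 3) ^ 3" using \<open>0 \<le> y\<close> by (intro power_mono) auto
  also have "exp (y / 3) ^ 3 = exp y" by (simp flip: exp_of_nat_mult)
  finally have "y ^ 3 \<le> 27 * exp y" by (simp add: power_divide)
  then have "y ^ 3 * exp (- y) \<le> (27 * exp y) * exp (- y)" by (intro mult_right_mono) auto
  also have "(27 * exp y) * exp (- y) = 27" by (simp add: exp_minus)
  finally show ?thesis .
qed

lemma flat_eq_0: "t \<le> 0 \<Longrightarrow> flat q t = 0"
  by (simp add: flat_def)

lemma flat_lin_bounds: "0 \<le> flat [:1, 1:] t" "flat [:1, 1:] t \<le> 1"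
proof -
  have "(1 + y) * exp (- y) \<le> exp y * exp (- y)" for y :: real
    using exp_ge_add_one_self[of y] by (intro mult_right_mono) auto
  then show "flat [:1, 1:] t \<le> 1" by (simp add: flat_def exp_minus)
qed (simp add: flat_def)

lemma flat_cubic_bounds: "0 \<le> flat [:0, 0, 0, 1:] t" "flat [:0, 0, 0, 1:] t \<le> 27"
  using exp_cube_bound[of "inverse t"] by (auto simp: flat_def power3_eq_cube)

lemma flat_lin_deriv: "(flat [:1, 1:] has_real_derivative flat [:0, 0, 0, 1:] t) (at t)"
  using flat_deriv[of "[:1, 1:]" t] by (simp add: pderiv_pCons)

text \<open>The origin of the polynomial \<open>1 + s\<close>: the derivative of
  \<open>t exp (- 1 / t)\<close> is \<open>(1 + s) exp (- s)\<close> with \<open>s = 1 / t\<close>.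
  It is bounded by 1, and its own derivative \<open>s^3 exp (- s)\<close> is bounded as well, so
  both levels of the truncation are admissible with an explicit primitive.\<close>

lemma flat_prim_deriv: "((\<lambda>t. t * flat 1 t) has_real_derivative flat [:1, 1:] t) (at t)"
proof -
  have "((\<lambda>t. t * flat 1 t) has_real_derivative (1 * flat 1 t + flat [:0, 0, 1:] t * t)) (at t)"
    using DERIV_mult[OF DERIV_ident flat_deriv[of 1 t]] by (simp add: one_pCons pderiv_pCons)
  moreover have "1 * flat 1 t + flat [:0, 0, 1:] t * t = flat [:1, 1:] t"
    by (simp add: flat_def field_simps)
  ultimately show ?thesis by simp
qed

text \<open>The truncation \<open>excess\<close> is bounded and increasing, and vanishes exactly on \<open>[0,1]\<close>. All three
  functions are explicit, so that the primitive of \<open>excess\<close> is visibly smooth.\<close>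

definition excess_prim :: "real \<Rightarrow> real" where
  "excess_prim t = (t - 1) * flat 1 (t - 1) + (- t) * flat 1 (- t)"

definition excess :: "real \<Rightarrow> real" where
  "excess t = flat [:1, 1:] (t - 1) - flat [:1, 1:] (- t)"

definition excess_deriv :: "real \<Rightarrow> real" where
  "excess_deriv t = flat [:0, 0, 0, 1:] (t - 1) + flat [:0, 0, 0, 1:] (- t)"

lemma excess_prim_DERIV: "(excess_prim has_real_derivative excess t) (at t)"
proof -
  have "((\<lambda>t. (t - 1) * flat 1 (t - 1)) has_real_derivative flat [:1, 1:] (t - 1) * 1) (at t)"
    by (rule DERIV_chain2[OF flat_prim_deriv]) (auto intro!: derivative_eq_intros)
  moreover have "((\<lambda>t. (- t) * flat 1 (- t)) has_real_derivative flat [:1, 1:] (- t) * (- 1)) (at t)"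
    by (rule DERIV_chain2[OF flat_prim_deriv]) (auto intro!: derivative_eq_intros)
  ultimately have "((\<lambda>t. (t - 1) * flat 1 (t - 1) + (- t) * flat 1 (- t)) has_real_derivative
      flat [:1, 1:] (t - 1) * 1 + flat [:1, 1:] (- t) * (- 1)) (at t)"
    by (rule DERIV_add)
  then show ?thesis by (simp add: excess_prim_def[abs_def] excess_def)
qed

lemma excess_DERIV: "(excess has_real_derivative excess_deriv t) (at t)"
proof -
  have "((\<lambda>t. flat [:1, 1:] (t - 1)) has_real_derivative flat [:0, 0, 0, 1:] (t - 1) * 1) (at t)"
    by (rule DERIV_chain2[OF flat_lin_deriv]) (auto intro!: derivative_eq_intros)
  moreover have "((\<lambda>t. flat [:1, 1:] (- t)) has_real_derivative flat [:0, 0, 0, 1:] (- t) * (- 1)) (at t)"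
    by (rule DERIV_chain2[OF flat_lin_deriv]) (auto intro!: derivative_eq_intros)
  ultimately have "((\<lambda>t. flat [:1, 1:] (t - 1) - flat [:1, 1:] (- t)) has_real_derivative
      flat [:0, 0, 0, 1:] (t - 1) * 1 - flat [:0, 0, 0, 1:] (- t) * (- 1)) (at t)"
    by (rule DERIV_diff)
  then show ?thesis by (simp add: excess_def[abs_def] excess_deriv_def)
qed

lemma excess_zero: "0 \<le> t \<Longrightarrow> t \<le> 1 \<Longrightarrow> excess t = 0"
  and excess_prim_zero: "0 \<le> t \<Longrightarrow> t \<le> 1 \<Longrightarrow> excess_prim t = 0"
  and excess_deriv_zero: "0 \<le> t \<Longrightarrow> t \<le> 1 \<Longrightarrow> excess_deriv t = 0"
  by (simp_all add: excess_def excess_prim_def excess_deriv_def flat_def)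

lemma excess_bounded: "\<bar>excess t\<bar> \<le> 1"
  using flat_lin_bounds[of "t - 1"] flat_lin_bounds[of "- t"] by (simp add: excess_def abs_le_iff)

text \<open>Each of the two cubic terms contributes at most 27.\<close>

lemma excess_deriv_bounds: "0 \<le> excess_deriv t" "\<bar>excess_deriv t\<bar> \<le> 54"
  using flat_cubic_bounds[of "t - 1"] flat_cubic_bounds[of "- t"] by (simp_all add: excess_deriv_def)

lemma excess_eq_zero_imp:
  assumes "excess t = 0" shows "0 \<le> t \<and> t \<le> 1"
proof -
  have pos: "flat [:1, 1:] s > 0" if "s > 0" for s
    using that by (simp add: flat_def add_pos_pos)
  show ?thesis
  proof (rule ccontr)
    assume "\<not> ?thesis"
    then consider "t < 0" | "t > 1" by linarith
    then show False
    proof cases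
      case 1
      then show False using assms pos[of "- t"] flat_eq_0[of "t - 1"] by (simp add: excess_def)
    next
      case 2
      then show False using assms pos[of "t - 1"] flat_eq_0[of "- t"] by (simp add: excess_def)
    qed
  qed
qed

lemma excess_deriv_cont: "continuous_on UNIV excess_deriv"
  unfolding excess_deriv_def[abs_def]
  by (intro continuous_intros continuous_on_compose2[OF flat_continuous[of UNIV]]) auto

lemma excess_cont: "continuous_on UNIV excess"
  using excess_DERIV by (meson DERIV_isCont continuous_at_imp_continuous_on)

abbreviation ez :: pt where "ez \<equiv> (0, 0, 1)"

lemma inner_ez: "p \<bullet> ez = zc p"
  by (cases p) (simp add: inner_Pair zc_def)

lemma has_grad_zc: "has_grad zc ez p"
  by (auto simp: has_grad_def inner_pt zc_def[abs_def] intro!: derivative_eq_intros)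

lemma grad3_zc: "grad3 zc p = ez"
  by (rule has_grad_imp_grad3[OF has_grad_zc])

context slab
begin

lemma per_smooth_excess: "per_smooth f \<Longrightarrow> per_smooth (\<lambda>p. excess (f p))"
  and per_smooth_excess_prim: "per_smooth f \<Longrightarrow> per_smooth (\<lambda>p. excess_prim (f p))"
proof -
  assume f: "per_smooth f"
  have 1: "per_smooth (\<lambda>p. f p - 1)" using per_smooth_add[OF f per_smooth_const[of "-1"]] by simp
  have 2: "per_smooth (\<lambda>p. - f p)" using per_smooth_mult[OF per_smooth_const[of "-1"] f] by simp
  note c = per_smooth_compose[OF smooth1_flat]
  show "per_smooth (\<lambda>p. excess_prim (f p))"
    unfolding excess_prim_def
    by (rule per_smooth_add[OF per_smooth_mult[OF 1 c[OF 1]] per_smooth_mult[OF 2 c[OF 2]]])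
  have "per_smooth (\<lambda>p. flat [:1, 1:] (f p - 1) + (-1) * flat [:1, 1:] (- f p))"
    by (rule per_smooth_add[OF c[OF 1] per_smooth_mult[OF per_smooth_const c[OF 2]]])
  then show "per_smooth (\<lambda>p. excess (f p))" by (simp add: excess_def)
qed

lemma truncation_hg:
  assumes h: "hg \<theta> G" and b: "continuous_on UNIV b" and db: "continuous_on UNIV db"
    and S: "\<And>t. (S has_real_derivative S' t) (at t)" and S'c: "continuous_on UNIV S'" and S'b: "\<And>t. \<bar>S' t\<bar> \<le> K"
    and adm: "admissible b db S S'"
  shows "hg (\<lambda>p. S (b p + \<theta> p)) (\<lambda>p. S' (b p + \<theta> p) *\<^sub>R (db p + G p))"
proof (rule truncation_approx[OF h b db S S'c S'b adm])
  fix \<psi> assume "sq_int M (\<lambda>p. S (b p + \<theta> p))" "sq_int M (\<lambda>p. S' (b p + \<theta> p) *\<^sub>R (db p + G p))"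
    "\<And>n. test (\<psi> n)" "l2lim M \<psi> (\<lambda>p. S (b p + \<theta> p))"
    "l2lim M (\<lambda>n. grad3 (\<psi> n)) (\<lambda>p. S' (b p + \<theta> p) *\<^sub>R (db p + G p))"
  then show ?thesis by (rule hgI)
qed

text \<open>Near the plates inside the slab \<phi> vanishes and \<open>1 - z\<close> lies in
  \<open>[0,1]\<close>, where \<open>S\<close> is 0. Beyond the plates \<open>1 - z\<close> leaves
  that interval, so \<open>S (1 - z + \<phi>)\<close> is cut off there without loss of
  smoothness.\<close>

lemma cut_admissible:
  assumes sm: "\<And>f. per_smooth f \<Longrightarrow> per_smooth (\<lambda>p. S (f p))"
    and S: "\<And>t. (S has_real_derivative S' t) (at t)"
    and S0: "\<And>t. 0 \<le> t \<Longrightarrow> t \<le> 1 \<Longrightarrow> S t = 0" and S'0: "\<And>t. 0 \<le> t \<Longrightarrow> t \<le> 1 \<Longrightarrow> S' t = 0"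
  shows "admissible (\<lambda>p. 1 - zc p) (\<lambda>p. - ez) S S'"
  unfolding admissible_def
proof (intro allI impI)
  fix \<phi> assume \<phi>: "test \<phi>"
  define f where "f p = (1 - zc p) + \<phi> p" for p
  have "per_smooth (\<lambda>p. (1 + (-1) * zc p) + \<phi> p)"
    by (rule per_smooth_add[OF per_smooth_add[OF per_smooth_const
            per_smooth_mult[OF per_smooth_const per_smooth_zc]] test_per_smooth[OF \<phi>]])
  then have f: "per_smooth f" by (simp add: f_def[abs_def])
  have grad_f: "has_grad f (- ez + grad3 \<phi> p) p" for p
  proof -
    have "has_grad (\<lambda>p. (1 + (-1) * zc p) + \<phi> p) ((0 + (zc p *\<^sub>R 0 + (-1) *\<^sub>R ez)) + grad3 \<phi> p) p"
      by (intro has_grad_add has_grad_mult has_grad_const has_grad_zc smooth3_has_grad test_smooth \<phi>)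
    then show ?thesis by (simp add: f_def[abs_def])
  qed
  define F where "F p = S (f p)" for p
  have F: "per_smooth F" unfolding F_def[abs_def] by (rule sm[OF f])
  have grad_F: "has_grad F (S' (f p) *\<^sub>R (- ez + grad3 \<phi> p)) p" for p
    unfolding F_def[abs_def] by (rule has_grad_compose[OF S grad_f])
  obtain d where d: "d > 0" "\<And>x y z. z \<le> d \<or> 1 - d \<le> z \<Longrightarrow> \<phi> (x, y, z) = 0"
    using \<phi> unfolding test_iff by blast
  \<comment> \<open>The cap at 1 keeps both boundary strips inside the slab, where
    \<open>1 - z\<close> lies in \<open>[0,1]\<close>.\<close>
  define \<delta> where "\<delta> = min d 1"
  have \<delta>1: "\<delta> > 0" "\<delta> \<le> 1" using d(1) by (simp_all add: \<delta>_def)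
  have \<delta>: "\<phi> (x, y, z) = 0" if "z \<le> \<delta> \<or> 1 - \<delta> \<le> z" for x y z
    using d(2)[of z x y] that by (auto simp: \<delta>_def min_def split: if_splits)
  have F0: "F p = 0" if "0 \<le> zc p" "zc p \<le> 1" "zc p \<le> \<delta> \<or> 1 - \<delta> \<le> zc p" for p
  proof -
    have "\<phi> p = 0" using \<delta>[of "zc p" "fst p" "fst (snd p)"] that(3) by (simp add: zc_def)
    then show ?thesis using that by (simp add: F_def f_def S0)
  qed
  define \<psi> where "\<psi> p = (if 0 < snd (snd p) \<and> snd (snd p) < 1 then F p else 0)" for p
  have sm\<psi>: "smooth3 \<psi>"
    unfolding \<psi>_def[abs_def]
    by (rule smooth3_cut[OF per_smooth_smooth[OF F] \<delta>1(1)]) (use F0 \<delta>1 in \<open>auto simp: zc_def\<close>)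
  have \<psi>0: "\<psi> p = 0" if "zc p \<le> \<delta> \<or> 1 - \<delta> \<le> zc p" for p
    using F0[of p] that by (auto simp: \<psi>_def zc_def)
  have "test \<psi>"
    unfolding test_iff
  proof (intro conjI exI[of _ \<delta>] allI impI)
    show "per_smooth \<psi>" using F sm\<psi> by (simp add: per_smooth_def \<psi>_def)
  qed (use \<delta>1(1) \<psi>0 in \<open>auto simp: zc_def\<close>)
  moreover have "\<psi> p = S ((1 - zc p) + \<phi> p) \<and> grad3 \<psi> p = S' ((1 - zc p) + \<phi> p) *\<^sub>R (- ez + grad3 \<phi> p)"
    if "p \<in> Om lx ly" for p
  proof -
    have z: "0 \<le> zc p" "zc p \<le> 1" using that by (cases p; auto simp: mem_Om zc_def)+
    show ?thesis
    proof (cases "0 < zc p \<and> zc p < 1")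
      case True
      then have p: "p \<in> {p. 0 < snd (snd p) \<and> snd (snd p) < 1}" by (simp add: zc_def)
      have "has_grad \<psi> (S' (f p) *\<^sub>R (- ez + grad3 \<phi> p)) p"
        by (rule has_grad_transform_open[OF grad_F open_zstrip p]) (simp add: \<psi>_def)
      then have "grad3 \<psi> p = S' (f p) *\<^sub>R (- ez + grad3 \<phi> p)" by (rule has_grad_imp_grad3)
      moreover have "\<psi> p = S (f p)" using p by (simp add: \<psi>_def F_def)
      ultimately show ?thesis by (simp add: f_def)
    next
      \<comment> \<open>On a plate \<psi> vanishes in a full neighbourhood, so its gradient is 0; on
        the other side \<phi> is 0 and \<open>1 - z\<close> is 0 or 1, a zero of \<open>S\<close>
        and \<open>S'\<close>.\<close>
      case False
      then have ends: "zc p = 0 \<or> zc p = 1" using z by linarith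
      then have dz: "zc p < \<delta> \<or> 1 - \<delta> < zc p" using \<delta>1(1) by auto
      then have "\<phi> p = 0" using \<delta>[of "zc p" "fst p" "fst (snd p)"] by (auto simp: zc_def)
      moreover have "\<psi> p = 0" using \<psi>0[of p] dz by auto
      moreover have "has_grad \<psi> 0 p"
      proof -
        have "open ({p::pt. snd (snd p) < \<delta>} \<union> {p. 1 - \<delta> < snd (snd p)})"
          by (intro open_Un open_z_below open_z_above)
        moreover have "p \<in> {p. snd (snd p) < \<delta>} \<union> {p. 1 - \<delta> < snd (snd p)}" using dz by (simp add: zc_def)
        ultimately show ?thesis
          by (rule has_grad_transform_open[OF has_grad_const]) (use \<psi>0 in \<open>auto simp: zc_def\<close>)
      qed
      then have "grad3 \<psi> p = 0" by (rule has_grad_imp_grad3)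
      ultimately show ?thesis using z by (simp add: S0 S'0)
    qed
  qed
  ultimately show "\<exists>\<psi>. test \<psi> \<and> (\<forall>p\<in>Om lx ly. \<psi> p = S ((1 - zc p) + \<phi> p) \<and>
      grad3 \<psi> p = S' ((1 - zc p) + \<phi> p) *\<^sub>R (- ez + grad3 \<phi> p))" by blast
qed

lemma sq_int_bounded_inner:
  assumes "sq_int M u" "h \<in> borel_measurable M" "AE p in M. norm (h p) \<le> C" "0 \<le> C"
  shows "sq_int M (\<lambda>p. u p \<bullet> h p)"
proof (rule sq_int_bound)
  show "(\<lambda>p. u p \<bullet> h p) \<in> borel_measurable M"
    using sq_int_meas[OF assms(1)] assms(2) by (rule borel_measurable_inner)
  show "integrable M (\<lambda>p. C\<^sup>2 * (norm (u p))\<^sup>2)"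
    by (intro integrable_mult_right sq_int_integrable assms)
  show "AE p in M. (norm (u p \<bullet> h p))\<^sup>2 \<le> C\<^sup>2 * (norm (u p))\<^sup>2"
    using assms(3)
  proof eventually_elim
    case (elim p)
    have "norm (u p \<bullet> h p) \<le> norm (u p) * norm (h p)" unfolding real_norm_def by (rule Cauchy_Schwarz_ineq2)
    also have "\<dots> \<le> norm (u p) * C" using elim by (rule mult_left_mono) simp
    finally have "(norm (u p \<bullet> h p))\<^sup>2 \<le> (norm (u p) * C)\<^sup>2" by (intro power_mono) auto
    then show ?case by (simp add: power_mult_distrib mult.commute)
  qed
qed

lemma sq_int_inner_grad:
  assumes "sq_int M u" "per_smooth f" shows "sq_int M (\<lambda>p. u p \<bullet> grad3 f p)"
proof -
  note c = smooth3_grad_continuous[OF per_smooth_smooth[OF assms(2)], of UNIV]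
  obtain C where "C > 0" "\<And>p. p \<in> Om lx ly \<Longrightarrow> norm (grad3 f p) \<le> C" using cont_bounded[OF c] by blast
  then show ?thesis by (intro sq_int_bounded_inner[OF assms(1) cont_meas[OF c], of C] AE_I2) auto
qed

lemma sq_int_per_smooth_scaleR:
  assumes "sq_int M u" "per_smooth f" shows "sq_int M (\<lambda>p. f p *\<^sub>R u p)"
proof -
  note c = smooth3_continuous[OF per_smooth_smooth[OF assms(2)], of UNIV]
  obtain C where "C > 0" "\<And>p. p \<in> Om lx ly \<Longrightarrow> norm (f p) \<le> C" using cont_bounded[OF c] by blast
  then show ?thesis by (intro sq_int_bdd_scaleR[OF assms(1) cont_meas[OF c], of C] AE_I2) auto
qed

end

section \<open>Divergence-free drift and transport identities\<close>

locale slab_flow = slab +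
  fixes u :: "pt \<Rightarrow> pt"
  assumes u: "sq_int M u"
    and div0: "\<And>\<phi>. test \<phi> \<Longrightarrow> (LINT p|M. u p \<bullet> grad3 \<phi> p) = 0"
begin

text \<open>For a test function \<phi> this is weak incompressibility applied to the test function
  \<open>f * \<phi>\<close>. The coefficients \<open>f u\<close> and
  \<open>u \<bullet> grad3 f\<close> are in L2, so it extends to H1_0.\<close>

lemma transport:
  assumes f: "per_smooth f" and h: "hg \<xi> g"
  shows "(LINT p|M. f p * (u p \<bullet> g p)) + (LINT p|M. (u p \<bullet> grad3 f p) * \<xi> p) = 0"
proof -
  have "(LINT p|M. (f p *\<^sub>R u p) \<bullet> g p) + (LINT p|M. (u p \<bullet> grad3 f p) * \<xi> p) = 0"
  proof (rule hg_functional[OF sq_int_per_smooth_scaleR[OF u f] sq_int_inner_grad[OF u f] _ h])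
    fix \<phi> assume \<phi>: "test \<phi>"
    have i1: "integrable M (\<lambda>p. (f p *\<^sub>R u p) \<bullet> grad3 \<phi> p)"
      by (rule integrable_sq_inner[OF sq_int_per_smooth_scaleR[OF u f] test_grad_sq_int[OF \<phi>]])
    have i2: "integrable M (\<lambda>p. (u p \<bullet> grad3 f p) * \<phi> p)"
      by (rule integrable_sq_mult[OF sq_int_inner_grad[OF u f] test_sq_int[OF \<phi>]])
    have "u p \<bullet> grad3 (\<lambda>p. f p * \<phi> p) p = (f p *\<^sub>R u p) \<bullet> grad3 \<phi> p + (u p \<bullet> grad3 f p) * \<phi> p" for p
      by (simp add: grad3_mult[OF per_smooth_smooth[OF f] test_smooth[OF \<phi>]] inner_add_right)
    then show "(LINT p|M. (f p *\<^sub>R u p) \<bullet> grad3 \<phi> p) + (LINT p|M. (u p \<bullet> grad3 f p) * \<phi> p) = 0"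
      using div0[OF test_mult[OF f \<phi>]] Bochner_Integration.integral_add[OF i1 i2] by (simp only:)
  qed
  then show ?thesis by (simp only: inner_scaleR_left)
qed

text \<open>\<open>transport\<close> with a test function in the role of \<open>f\<close> can be
  read as an identity in that test function, with the L2 field \<open>\<xi> u\<close> and the
  integrable density \<open>u \<bullet> g\<close> as coefficients. Bounded \<xi> may be inserted for
  it, and then both terms coincide.\<close>

lemma self_transport:
  assumes h: "hg \<xi> g" and bd: "AE p in M. \<bar>\<xi> p\<bar> \<le> C"
  shows "(LINT p|M. (u p \<bullet> g p) * \<xi> p) = 0"
proof -
  have "(LINT p|M. (\<xi> p *\<^sub>R u p) \<bullet> g p) + (LINT p|M. (u p \<bullet> g p) * \<xi> p) = 0"
  proof (rule hg_functional_bounded[OF h bd])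
    show "sq_int M (\<lambda>p. \<xi> p *\<^sub>R u p)" by (rule sq_int_bdd_scaleR[OF u sq_int_meas[OF hg_sq_int(1)[OF h]] bd])
    show "integrable M (\<lambda>p. u p \<bullet> g p)" by (rule integrable_sq_inner[OF u hg_sq_int(2)[OF h]])
    fix \<phi> assume \<phi>: "test \<phi>"
    from transport[OF test_per_smooth[OF \<phi>] h]
    show "(LINT p|M. (\<xi> p *\<^sub>R u p) \<bullet> grad3 \<phi> p) + (LINT p|M. (u p \<bullet> g p) * \<phi> p) = 0"
      by (simp add: mult.commute)
  qed
  then show ?thesis by (simp add: mult.commute)
qed

text \<open>The equation of the deviation from the linear profile \<open>1 - z\<close>. Boundedness
  is to be derived and not assumed, since the solutions built by projection are known only to lie in
  H1_0.\<close>

definition sol :: "(pt \<Rightarrow> real) \<Rightarrow> (pt \<Rightarrow> pt) \<Rightarrow> bool" where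
  "sol \<theta> G \<longleftrightarrow> hg \<theta> G \<and> (\<forall>\<phi>. test \<phi> \<longrightarrow>
    (LINT p|M. G p \<bullet> grad3 \<phi> p) + (LINT p|M. (u p \<bullet> G p) * \<phi> p) = (LINT p|M. zc (u p) * \<phi> p))"

lemma integrable_inner_test:
  assumes "sq_int M g" "test \<phi>" shows "integrable M (\<lambda>p. (u p \<bullet> g p) * \<phi> p)"
proof -
  obtain C where "C > 0" "AE p in M. \<bar>\<phi> p\<bar> \<le> C" using test_AE_bounded[OF assms(2)] by blast
  then show ?thesis
    using integrable_bdd_mult[OF integrable_sq_inner[OF u assms(1)] sq_int_meas[OF test_sq_int[OF assms(2)]]] by blast
qed

lemma ez_sq_int: "sq_int M (\<lambda>p. ez)"
  by (rule cont_sq_int) (rule continuous_on_const)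

text \<open>\<open>G - ez\<close> is the gradient of the full temperature. The constant
  \<open>ez\<close> is orthogonal to gradients of test functions, and its drift contribution
  \<open>u \<bullet> ez\<close> is the source \<open>w\<close>.\<close>

lemma shifted_equation:
  assumes G: "sq_int M G" and \<phi>: "test \<phi>"
  shows "(LINT p|M. (G p - ez) \<bullet> grad3 \<phi> p) + (LINT p|M. (u p \<bullet> (G p - ez)) * \<phi> p)
    = (LINT p|M. G p \<bullet> grad3 \<phi> p) + (LINT p|M. (u p \<bullet> G p) * \<phi> p) - (LINT p|M. zc (u p) * \<phi> p)"
proof -
  note t = test_grad_sq_int[OF \<phi>]
  have "(LINT p|M. ez \<bullet> grad3 \<phi> p) = ez \<bullet> (LINT p|M. grad3 \<phi> p)"
    by (rule integral_inner_right) (rule sq_int_imp_integrable[OF t])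
  then have e: "(LINT p|M. ez \<bullet> grad3 \<phi> p) = 0" by (simp add: LINT_grad_test[OF \<phi>])
  have 1: "(LINT p|M. (G p - ez) \<bullet> grad3 \<phi> p) = (LINT p|M. G p \<bullet> grad3 \<phi> p) - (LINT p|M. ez \<bullet> grad3 \<phi> p)"
    using Bochner_Integration.integral_diff[OF integrable_sq_inner[OF G t] integrable_sq_inner[OF ez_sq_int t]]
    by (simp only: inner_diff_left)
  have "(u p \<bullet> (G p - ez)) * \<phi> p = (u p \<bullet> G p) * \<phi> p - (u p \<bullet> ez) * \<phi> p" for p
    by (simp only: inner_diff_right left_diff_distrib)
  then have 2: "(LINT p|M. (u p \<bullet> (G p - ez)) * \<phi> p) = (LINT p|M. (u p \<bullet> G p) * \<phi> p) - (LINT p|M. (u p \<bullet> ez) * \<phi> p)"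
    using Bochner_Integration.integral_diff[OF integrable_inner_test[OF G \<phi>] integrable_inner_test[OF ez_sq_int \<phi>]]
    by (simp only:)
  show ?thesis unfolding 1 2 e inner_ez by simp
qed

text \<open>Testing the equation for the temperature \<open>T = 1 - z + \<theta>\<close> with \<open>excess T\<close> removes the drift
  term, since \<open>u \<cdot> \<nabla>T excess T\<close> is the divergence of \<open>u excess_prim T\<close>.\<close>

lemma maximum_principle:
  assumes s: "sol \<theta> G"
  shows "AE p in M. \<bar>\<theta> p\<bar> \<le> 1"
proof -
  have h: "hg \<theta> G" and eq: "\<And>\<phi>. test \<phi> \<Longrightarrow> (LINT p|M. G p \<bullet> grad3 \<phi> p) + (LINT p|M. (u p \<bullet> G p) * \<phi> p) = (LINT p|M. zc (u p) * \<phi> p)"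
    using s by (simp_all add: sol_def)
  note G = hg_sq_int(2)[OF h]
  let ?T = "\<lambda>p. (1 - zc p) + \<theta> p" and ?K = "\<lambda>p. - ez + G p"
  have Keq: "- ez + G p = G p - ez" for p by simp
  have K: "sq_int M ?K" by (rule sq_int_add[OF sq_int_minus[OF ez_sq_int] G])
  have b: "continuous_on UNIV (\<lambda>p. 1 - zc p)"
    unfolding zc_def by (intro continuous_intros)
  note db = continuous_on_const[of UNIV "- ez"]
  note adm = cut_admissible[OF per_smooth_excess excess_DERIV excess_zero excess_deriv_zero]
  note adm' = cut_admissible[OF per_smooth_excess_prim excess_prim_DERIV excess_prim_zero excess_zero]
  have 1: "(LINT p|M. ?K p \<bullet> (excess_deriv (?T p) *\<^sub>R ?K p)) + (LINT p|M. (u p \<bullet> ?K p) * excess (?T p)) = 0"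
  proof (rule truncation_functional[OF h b db excess_DERIV excess_deriv_cont excess_deriv_bounds(2) adm excess_bounded K
        integrable_sq_inner[OF u K]])
    fix \<phi> assume \<phi>: "test \<phi>"
    show "(LINT p|M. ?K p \<bullet> grad3 \<phi> p) + (LINT p|M. (u p \<bullet> ?K p) * \<phi> p) = 0"
      unfolding Keq shifted_equation[OF G \<phi>] eq[OF \<phi>] by simp
  qed
  \<comment> \<open>\<open>excess_prim\<close> of the temperature lies in H1_0 with gradient
    \<open>excess (?T p) *\<^sub>R ?K p\<close>, so incompressibility extended to H1_0 annihilates
    the drift term of the previous identity.\<close>
  have hP: "hg (\<lambda>p. excess_prim (?T p)) (\<lambda>p. excess (?T p) *\<^sub>R ?K p)"
    by (rule truncation_hg[OF h b db excess_prim_DERIV excess_cont excess_bounded adm'])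
  from hg_functional_grad[OF u div0 hP]
  have "(LINT p|M. u p \<bullet> (excess (?T p) *\<^sub>R ?K p)) = 0" .
  then have 2: "(LINT p|M. (u p \<bullet> ?K p) * excess (?T p)) = 0" by (simp add: mult.commute)
  have hT: "hg (\<lambda>p. excess (?T p)) (\<lambda>p. excess_deriv (?T p) *\<^sub>R ?K p)"
    by (rule truncation_hg[OF h b db excess_DERIV excess_deriv_cont excess_deriv_bounds(2) adm])
  have i: "integrable M (\<lambda>p. ?K p \<bullet> (excess_deriv (?T p) *\<^sub>R ?K p))"
    by (rule integrable_sq_inner[OF K hg_sq_int(2)[OF hT]])
  have "(LINT p|M. ?K p \<bullet> (excess_deriv (?T p) *\<^sub>R ?K p)) = 0" using 1 2 by simp
  then have "AE p in M. ?K p \<bullet> (excess_deriv (?T p) *\<^sub>R ?K p) = 0"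
    using integral_nonneg_eq_0_iff_AE[OF i] excess_deriv_bounds(1) by simp
  \<comment> \<open>At each such point either \<open>excess_deriv\<close> or the temperature
    gradient is 0. Thus the truncation, which has zero boundary values, has zero gradient.\<close>
  then have "AE p in M. excess_deriv (?T p) *\<^sub>R ?K p = 0"
    by eventually_elim auto
  then have "AE p in M. excess (?T p) = 0" by (rule hg_zero_grad[OF hT])
  \<comment> \<open>The temperature and \<open>1 - z\<close> both lie in \<open>[0,1]\<close>, so
    their difference \<theta> is at most 1 in absolute value.\<close>
  then show ?thesis
    using AE_space
  proof eventually_elim
    case (elim p)
    have "0 \<le> zc p" "zc p \<le> 1" using elim(2) by (cases p; auto simp: mem_Om zc_def)+
    then show ?case using excess_eq_zero_imp[OF elim(1)] by (simp add: abs_le_iff)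
  qed
qed

end

section \<open>The Nusselt number and the maximiser\<close>

text \<open>Two gradient fields are packed into one vector-valued function so that the projection
  theorem applies to them jointly.\<close>

lemma sq_int_Pair:
  assumes "sq_int M f" "sq_int M g" shows "sq_int M (\<lambda>p. (f p, g p))"
proof (rule sq_int_bound)
  show "(\<lambda>p. (f p, g p)) \<in> borel_measurable M"
    using assms by (auto simp: sq_int_def borel_prod[symmetric])
  show "integrable M (\<lambda>p. (norm (f p))\<^sup>2 + (norm (g p))\<^sup>2)"
    using assms by (auto simp: sq_int_def)
qed (simp add: norm_Pair)

lemma norm_fst_snd_le: "norm (fst q) \<le> norm q" "norm (snd q) \<le> norm q"
  by (cases q; simp add: norm_fst_le norm_snd_le)+

lemma l2lim_fst_snd:
  assumes "\<And>n. sq_int M (F n)" "sq_int M f" "l2lim M F f"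
    and sq1: "\<And>n. sq_int M (\<lambda>p. fst (F n p))" "sq_int M (\<lambda>p. fst (f p))"
    and sq2: "\<And>n. sq_int M (\<lambda>p. snd (F n p))" "sq_int M (\<lambda>p. snd (f p))"
  shows "l2lim M (\<lambda>n p. fst (F n p)) (\<lambda>p. fst (f p))"
    and "l2lim M (\<lambda>n p. snd (F n p)) (\<lambda>p. snd (f p))"
proof -
  note d = sq_int_diff[OF assms(1,2)]
  have fst: "norm (l2norm M (\<lambda>p. fst (F n p) - fst (f p))) \<le> l2norm M (\<lambda>p. F n p - f p)" for n
    using l2norm_le[where K = 1, OF sq_int_diff[OF sq1] d, of n n] by (simp add: norm_fst_snd_le flip: fst_diff)
  show "l2lim M (\<lambda>n p. fst (F n p)) (\<lambda>p. fst (f p))"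
    unfolding l2lim_iff
    by (rule Lim_null_comparison[OF always_eventually[OF allI[OF fst]] assms(3)[unfolded l2lim_iff]])
  have snd: "norm (l2norm M (\<lambda>p. snd (F n p) - snd (f p))) \<le> l2norm M (\<lambda>p. F n p - f p)" for n
    using l2norm_le[where K = 1, OF sq_int_diff[OF sq2] d, of n n] by (simp add: norm_fst_snd_le flip: snd_diff)
  show "l2lim M (\<lambda>n p. snd (F n p)) (\<lambda>p. snd (f p))"
    unfolding l2lim_iff
    by (rule Lim_null_comparison[OF always_eventually[OF allI[OF snd]] assms(3)[unfolded l2lim_iff]])
qed

lemma sq_int_fst_snd:
  assumes "sq_int M f"
  shows "sq_int M (\<lambda>p. fst (f p))" "sq_int M (\<lambda>p. snd (f p))"
proof -
  have m: "f \<in> borel_measurable M" and i: "integrable M (\<lambda>p. (norm (f p))\<^sup>2)"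
    using assms by (auto simp: sq_int_def)
  have "(\<lambda>p. fst (f p)) \<in> borel_measurable M" "(\<lambda>p. snd (f p)) \<in> borel_measurable M"
    using m by (auto simp: borel_prod[symmetric])
  then show "sq_int M (\<lambda>p. fst (f p))" "sq_int M (\<lambda>p. snd (f p))"
    by (auto intro!: sq_int_bound[OF _ i] AE_I2 power_mono norm_fst_snd_le)
qed

context slab_flow
begin

text \<open>By the maximum principle the difference of two solutions is bounded by 2. It may
  therefore be tested with itself, and its drift term is zero by
  \<open>self_transport\<close>.\<close>

lemma sol_unique:
  assumes "sol \<theta> G" "sol \<theta>' G'"
  shows "AE p in M. G p = G' p"
proof -
  have h: "hg \<theta> G" "hg \<theta>' G'" using assms by (simp_all add: sol_def)
  note sq = hg_sq_int(2)[OF h(1)] hg_sq_int(2)[OF h(2)]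
  have hd: "hg (\<lambda>p. \<theta> p - \<theta>' p) (\<lambda>p. G p - G' p)" by (rule hg_diff[OF h])
  have bd: "AE p in M. \<bar>\<theta> p - \<theta>' p\<bar> \<le> 2"
    using maximum_principle[OF assms(1)] maximum_principle[OF assms(2)] by eventually_elim linarith
  note sqd = sq_int_diff[OF sq]
  have "(LINT p|M. (G p - G' p) \<bullet> (G p - G' p)) + (LINT p|M. (u p \<bullet> (G p - G' p)) * (\<theta> p - \<theta>' p)) = 0"
  proof (rule hg_functional_bounded[OF hd bd sqd integrable_sq_inner[OF u sqd]])
    fix \<phi> assume \<phi>: "test \<phi>"
    note t = test_grad_sq_int[OF \<phi>]
    have 1: "(LINT p|M. (G p - G' p) \<bullet> grad3 \<phi> p) = (LINT p|M. G p \<bullet> grad3 \<phi> p) - (LINT p|M. G' p \<bullet> grad3 \<phi> p)"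
      using Bochner_Integration.integral_diff[OF integrable_sq_inner[OF sq(1) t] integrable_sq_inner[OF sq(2) t]]
      by (simp only: inner_diff_left)
    have 2: "(LINT p|M. (u p \<bullet> (G p - G' p)) * \<phi> p) = (LINT p|M. (u p \<bullet> G p) * \<phi> p) - (LINT p|M. (u p \<bullet> G' p) * \<phi> p)"
      using Bochner_Integration.integral_diff[OF integrable_inner_test[OF sq(1) \<phi>] integrable_inner_test[OF sq(2) \<phi>]]
      by (simp only: inner_diff_right left_diff_distrib)
    have "(LINT p|M. G p \<bullet> grad3 \<phi> p) + (LINT p|M. (u p \<bullet> G p) * \<phi> p) = (LINT p|M. zc (u p) * \<phi> p)"
      "(LINT p|M. G' p \<bullet> grad3 \<phi> p) + (LINT p|M. (u p \<bullet> G' p) * \<phi> p) = (LINT p|M. zc (u p) * \<phi> p)"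
      using assms \<phi> unfolding sol_def by blast+
    then show "(LINT p|M. (G p - G' p) \<bullet> grad3 \<phi> p) + (LINT p|M. (u p \<bullet> (G p - G' p)) * \<phi> p) = 0"
      unfolding 1 2 by linarith
  qed
  then have "(LINT p|M. (norm (G p - G' p))\<^sup>2) = 0"
    unfolding self_transport[OF hd bd] by (simp add: power2_norm_eq_inner)
  then have "AE p in M. G p - G' p = 0" by (rule l2_zero_AE[OF sqd])
  then show ?thesis by simp
qed

text \<open>The profile \<open>1 - z\<close> does not vanish at \<open>z = 0\<close>; its part of
  the identity is integration by parts against a test function, and the rest is
  \<open>hg_weak_grad\<close>.\<close>

lemma conduction_weak_grad:
  assumes h: "hg \<theta> G"
  shows "weak_grad lx ly (\<lambda>p. (1 - zc p) + \<theta> p) (\<lambda>p. G p - ez)"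
  unfolding weak_grad_def
proof (intro allI impI)
  fix \<phi> assume \<phi>: "test \<phi>"
  note t = test_sq_int[OF \<phi>] test_grad_sq_int[OF \<phi>]
  have c: "continuous_on UNIV (\<lambda>p. 1 - zc p)" unfolding zc_def by (intro continuous_intros)
  have ps: "per_smooth (\<lambda>p. 1 + (-1) * zc p)"
    by (rule per_smooth_add[OF per_smooth_const per_smooth_mult[OF per_smooth_const per_smooth_zc]])
  have "has_grad (\<lambda>p. 1 + (-1) * zc p) (0 + (zc p *\<^sub>R 0 + (-1) *\<^sub>R ez)) p" for p
    by (intro has_grad_add has_grad_mult has_grad_const has_grad_zc)
  from has_grad_imp_grad3[OF this]
  have g: "grad3 (\<lambda>p. 1 + (-1) * zc p) p = - ez" for p by simp
  have 1: "(LINT p|M. (1 - zc p) *\<^sub>R grad3 \<phi> p) = (LINT p|M. \<phi> p *\<^sub>R ez)"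
  proof -
    have e: "1 + (-1) * zc p = 1 - zc p" for p by simp
    show ?thesis
      using test_by_parts[OF ps \<phi>]
      unfolding g unfolding e scaleR_minus_right Bochner_Integration.integral_minus minus_minus .
  qed
  have 2: "(LINT p|M. \<theta> p *\<^sub>R grad3 \<phi> p) = - (LINT p|M. \<phi> p *\<^sub>R G p)"
    using hg_weak_grad[OF h] \<phi> unfolding weak_grad_def by blast
  have "(LINT p|M. ((1 - zc p) + \<theta> p) *\<^sub>R grad3 \<phi> p)
      = (LINT p|M. (1 - zc p) *\<^sub>R grad3 \<phi> p) + (LINT p|M. \<theta> p *\<^sub>R grad3 \<phi> p)"
    using Bochner_Integration.integral_add[OF integrable_sq_scaleR[OF cont_sq_int[OF c] t(2)]
        integrable_sq_scaleR[OF hg_sq_int(1)[OF h] t(2)]]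
    by (simp only: scaleR_add_left)
  moreover have "(LINT p|M. \<phi> p *\<^sub>R (G p - ez)) = (LINT p|M. \<phi> p *\<^sub>R G p) - (LINT p|M. \<phi> p *\<^sub>R ez)"
    using Bochner_Integration.integral_diff[OF integrable_sq_scaleR[OF t(1) hg_sq_int(2)[OF h]]
        integrable_sq_scaleR[OF t(1) ez_sq_int]]
    by (simp only: scaleR_diff_right)
  ultimately show "(LINT p|M. ((1 - zc p) + \<theta> p) *\<^sub>R grad3 \<phi> p) = - (LINT p|M. \<phi> p *\<^sub>R (G p - ez))"
    unfolding 1 2 by simp
qed

lemma sol_imp_steady_sol:
  assumes s: "sol \<theta> G"
  shows "steady_sol lx ly u (\<lambda>p. (1 - zc p) + \<theta> p) (\<lambda>p. G p - ez)"
proof -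
  have h: "hg \<theta> G" and eq: "\<And>\<phi>. test \<phi> \<Longrightarrow> (LINT p|M. G p \<bullet> grad3 \<phi> p) + (LINT p|M. (u p \<bullet> G p) * \<phi> p) = (LINT p|M. zc (u p) * \<phi> p)"
    using s by (simp_all add: sol_def)
  have c: "continuous_on UNIV (\<lambda>p. 1 - zc p)" unfolding zc_def by (intro continuous_intros)
  have T: "sq_int M (\<lambda>p. (1 - zc p) + \<theta> p)" by (rule sq_int_add[OF cont_sq_int[OF c] hg_sq_int(1)[OF h]])
  have K: "sq_int M (\<lambda>p. G p - ez)" by (rule sq_int_diff[OF hg_sq_int(2)[OF h] ez_sq_int])
  have wg: "weak_grad lx ly (\<lambda>p. (1 - zc p) + \<theta> p) (\<lambda>p. G p - ez)" by (rule conduction_weak_grad[OF h])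
  have "AE p in M. \<bar>(1 - zc p) + \<theta> p\<bar> \<le> 2"
    using maximum_principle[OF s] AE_space
  proof eventually_elim
    case (elim p)
    have "0 \<le> zc p" "zc p \<le> 1" using elim(2) by (cases p; auto simp: mem_Om zc_def)+
    then show ?case using elim(1) by linarith
  qed
  then have "Linf lx ly (\<lambda>p. (1 - zc p) + \<theta> p)" using sq_int_meas[OF T] unfolding Linf_def by blast
  moreover have "H10 lx ly (\<lambda>p. (1 - zc p) + \<theta> p - (1 - zc p))"
    using h by (auto simp: H10_iff_hg)
  moreover have "(LINT p|M. (G p - ez) \<bullet> grad3 \<phi> p) + (LINT p|M. (u p \<bullet> (G p - ez)) * \<phi> p) = 0" if "test \<phi>" for \<phi>
    using shifted_equation[OF hg_sq_int(2)[OF h] that] eq[OF that] by simp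
  ultimately show ?thesis
    unfolding steady_sol_def H1_def L2_sq_int using T K wg by blast
qed

text \<open>The gradient given with \<open>T\<close> and the one supplied by membership in H1_0 are
  two weak gradients up to the shift \<open>ez\<close>, so they can be identified a.e. only.\<close>

lemma steady_sol_imp_sol:
  assumes s: "steady_sol lx ly u T g"
  obtains \<theta> G where "sol \<theta> G" "AE p in M. g p = G p - ez"
proof -
  let ?\<theta> = "\<lambda>p. T p - (1 - zc p)"
  have "H10 lx ly ?\<theta>" using s by (simp add: steady_sol_def)
  then obtain G where h: "hg ?\<theta> G" unfolding H10_iff_hg by blast
  have g: "sq_int M g" "weak_grad lx ly T g" using s by (simp_all add: steady_sol_def L2_sq_int)
  have eqg: "(LINT p|M. g p \<bullet> grad3 \<phi> p) + (LINT p|M. (u p \<bullet> g p) * \<phi> p) = 0" if "test \<phi>" for \<phi>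
    using s that by (simp add: steady_sol_def)
  note G = hg_sq_int(2)[OF h]
  have K: "sq_int M (\<lambda>p. G p - ez)" by (rule sq_int_diff[OF G ez_sq_int])
  have "weak_grad lx ly T (\<lambda>p. G p - ez)"
    using conduction_weak_grad[OF h] by simp
  then have AE: "AE p in M. g p = G p - ez" by (rule weak_grad_unique[OF g(1) K g(2)])
  have "sol ?\<theta> G"
    unfolding sol_def
  proof (intro conjI allI impI h)
    fix \<phi> assume \<phi>: "test \<phi>"
    note t = test_grad_sq_int[OF \<phi>]
    have "(LINT p|M. g p \<bullet> grad3 \<phi> p) = (LINT p|M. (G p - ez) \<bullet> grad3 \<phi> p)"
      by (rule integral_cong_AE)
        (use AE borel_measurable_integrable[OF integrable_sq_inner[OF g(1) t]]
          borel_measurable_integrable[OF integrable_sq_inner[OF K t]] in auto)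
    moreover have "(LINT p|M. (u p \<bullet> g p) * \<phi> p) = (LINT p|M. (u p \<bullet> (G p - ez)) * \<phi> p)"
      by (rule integral_cong_AE)
        (use AE borel_measurable_integrable[OF integrable_inner_test[OF g(1) \<phi>]]
          borel_measurable_integrable[OF integrable_inner_test[OF K \<phi>]] in auto)
    ultimately show "(LINT p|M. G p \<bullet> grad3 \<phi> p) + (LINT p|M. (u p \<bullet> G p) * \<phi> p) = (LINT p|M. zc (u p) * \<phi> p)"
      using shifted_equation[OF G \<phi>] eqg[OF \<phi>] by simp
  qed
  then show ?thesis using that AE by blast
qed

text \<open>Expanding the square of \<open>G - ez\<close>, the mixed term vanishes because a
  constant field is orthogonal to gradients from H1_0; the summand 1 is the mean of
  \<open>(norm ez)^2\<close>. Uniqueness of \<open>G\<close> a.e. settles the definite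
  description.\<close>

lemma Nu_eq:
  assumes s: "sol \<theta> G"
  shows "Nu lx ly u = (LINT p|M. (norm (G p))\<^sup>2) / (lx * ly) + 1"
proof -
  have h: "hg \<theta> G" using s by (simp add: sol_def)
  note G = hg_sq_int(2)[OF h]
  have K: "sq_int M (\<lambda>p. G p - ez)" by (rule sq_int_diff[OF G ez_sq_int])
  have ez0: "(LINT p|M. ez \<bullet> G p) = 0"
  proof (rule hg_functional_grad[OF ez_sq_int _ h])
    fix \<phi> assume \<phi>: "test \<phi>"
    have "(LINT p|M. ez \<bullet> grad3 \<phi> p) = ez \<bullet> (LINT p|M. grad3 \<phi> p)"
      by (rule integral_inner_right) (rule sq_int_imp_integrable[OF test_grad_sq_int[OF \<phi>]])
    then show "(LINT p|M. ez \<bullet> grad3 \<phi> p) = 0" by (simp add: LINT_grad_test[OF \<phi>])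
  qed
  have "(LINT p|M. (norm (G p - ez))\<^sup>2) = (LINT p|M. (norm (G p))\<^sup>2) + lx * ly"
  proof -
    have "(LINT p|M. (norm ez)\<^sup>2) = lx * ly"
      using measure_Om by (simp add: norm_Pair)
    moreover have "(LINT p|M. G p \<bullet> ez) = 0" using ez0 by (simp only: inner_commute)
    ultimately show ?thesis using l2_sq_diff[OF G ez_sq_int] by simp
  qed
  then have val: "avg lx ly (\<lambda>p. (norm (G p - ez))\<^sup>2) = (LINT p|M. (norm (G p))\<^sup>2) / (lx * ly) + 1"
    using lx ly by (simp add: avg_def add_divide_distrib)
  have "Nu lx ly u = avg lx ly (\<lambda>p. (norm (G p - ez))\<^sup>2)"
    unfolding Nu_def
  proof (rule the_equality)
    show "\<exists>T g. steady_sol lx ly u T g \<and> avg lx ly (\<lambda>p. (norm (G p - ez))\<^sup>2) = avg lx ly (\<lambda>p. (norm (g p))\<^sup>2)"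
      using sol_imp_steady_sol[OF s] by blast
    fix c assume "\<exists>T g. steady_sol lx ly u T g \<and> c = avg lx ly (\<lambda>p. (norm (g p))\<^sup>2)"
    then obtain T g where T: "steady_sol lx ly u T g" "c = avg lx ly (\<lambda>p. (norm (g p))\<^sup>2)" by blast
    obtain \<theta>' G' where s': "sol \<theta>' G'" "AE p in M. g p = G' p - ez" by (rule steady_sol_imp_sol[OF T(1)])
    have g: "sq_int M g" using T(1) by (simp add: steady_sol_def L2_sq_int)
    have AE: "AE p in M. g p = G p - ez"
      using s'(2) sol_unique[OF s s'(1)] by eventually_elim simp
    have "(LINT p|M. (norm (g p))\<^sup>2) = (LINT p|M. (norm (G p - ez))\<^sup>2)"
      by (rule integral_cong_AE)
        (use AE borel_measurable_integrable[OF sq_int_integrable[OF g]]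
          borel_measurable_integrable[OF sq_int_integrable[OF K]] in auto)
    then show "c = avg lx ly (\<lambda>p. (norm (G p - ez))\<^sup>2)" using T(2) by (simp add: avg_def)
  qed
  then show ?thesis using val by simp
qed


section \<open>The quadratic form and its Riesz representer\<close>

definition potential :: "(pt \<Rightarrow> real) \<Rightarrow> (pt \<Rightarrow> pt) \<Rightarrow> bool" where
  "potential \<xi> k \<longleftrightarrow> (\<forall>\<phi>. test \<phi> \<longrightarrow> (LINT p|M. grad3 \<phi> p \<bullet> k p) = (LINT p|M. (u p \<bullet> grad3 \<phi> p) * \<xi> p))"

text \<open>The graph of the map from \<xi> to the solution \<eta> of
  \<open>\<Delta>\<eta> = div (u \<xi>)\<close>, stored by gradients so that its squared L2 norm is
  the quadratic form. Unbounded \<xi> are included, and \<open>u \<xi>\<close> may then fail to be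
  in L2. This is why \<open>potential\<close> groups \<open>u\<close> with the gradient of the test
  function: that factor is in L2 and pairs with every \<xi> in L2.\<close>

definition pairs :: "(pt \<Rightarrow> pt \<times> pt) set" where
  "pairs = {X. \<exists>\<xi> \<eta>. hg \<xi> (\<lambda>p. fst (X p)) \<and> hg \<eta> (\<lambda>p. snd (X p)) \<and> potential \<xi> (\<lambda>p. snd (X p))}"

lemma pairs_sq_int: "X \<in> pairs \<Longrightarrow> sq_int M X"
  unfolding pairs_def using sq_int_Pair[of M "\<lambda>p. fst (X p)" "\<lambda>p. snd (X p)"] hg_sq_int(2) by auto

lemma potential_add:
  assumes "hg \<xi> g" "hg \<xi>' g'" "sq_int M k" "sq_int M k'" "potential \<xi> k" "potential \<xi>' k'"
  shows "potential (\<lambda>p. \<xi> p + \<xi>' p) (\<lambda>p. k p + k' p)"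
  unfolding potential_def
proof (intro allI impI)
  fix \<phi> assume \<phi>: "test \<phi>"
  note t = test_grad_sq_int[OF \<phi>] and s = sq_int_inner_grad[OF u test_per_smooth[OF \<phi>]]
  have 1: "(LINT p|M. grad3 \<phi> p \<bullet> (k p + k' p)) = (LINT p|M. grad3 \<phi> p \<bullet> k p) + (LINT p|M. grad3 \<phi> p \<bullet> k' p)"
    using Bochner_Integration.integral_add[OF integrable_sq_inner[OF t assms(3)] integrable_sq_inner[OF t assms(4)]]
    by (simp only: inner_add_right)
  have 2: "(LINT p|M. (u p \<bullet> grad3 \<phi> p) * (\<xi> p + \<xi>' p))
      = (LINT p|M. (u p \<bullet> grad3 \<phi> p) * \<xi> p) + (LINT p|M. (u p \<bullet> grad3 \<phi> p) * \<xi>' p)"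
    using Bochner_Integration.integral_add[OF integrable_sq_mult[OF s hg_sq_int(1)[OF assms(1)]]
        integrable_sq_mult[OF s hg_sq_int(1)[OF assms(2)]]]
    by (simp only: distrib_left)
  show "(LINT p|M. grad3 \<phi> p \<bullet> (k p + k' p)) = (LINT p|M. (u p \<bullet> grad3 \<phi> p) * (\<xi> p + \<xi>' p))"
    unfolding 1 2 using assms(5,6) \<phi> unfolding potential_def by auto
qed

lemma potential_scale:
  assumes "potential \<xi> k" shows "potential (\<lambda>p. c * \<xi> p) (\<lambda>p. c *\<^sub>R k p)"
  using assms unfolding potential_def by (simp add: mult.left_commute)

text \<open>Closedness is the only substantial clause: convergence of the gradients brings
  convergence of \<xi>, and both sides of the potential equation are L2 pairings with fixed
  functions.\<close>

lemma pairs_subspace: "l2_subspace M pairs"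
proof (rule l2_subspaceI)
  show "sq_int M X" if "X \<in> pairs" for X using that by (rule pairs_sq_int)
  have z: "hg (\<lambda>p. 0) (\<lambda>p. 0)" using hg_test[OF test_zero] unfolding grad3_const[abs_def] .
  then show "(\<lambda>p. 0) \<in> pairs" by (force simp: pairs_def potential_def)
  show "(\<lambda>p. X p + Y p) \<in> pairs" if XY: "X \<in> pairs" "Y \<in> pairs" for X Y
  proof -
    obtain \<xi> \<eta> \<xi>' \<eta>' where *: "hg \<xi> (\<lambda>p. fst (X p))" "hg \<eta> (\<lambda>p. snd (X p))" "potential \<xi> (\<lambda>p. snd (X p))"
      "hg \<xi>' (\<lambda>p. fst (Y p))" "hg \<eta>' (\<lambda>p. snd (Y p))" "potential \<xi>' (\<lambda>p. snd (Y p))"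
      using XY unfolding pairs_def by blast
    have "hg (\<lambda>p. \<xi> p + \<xi>' p) (\<lambda>p. fst (X p + Y p))" "hg (\<lambda>p. \<eta> p + \<eta>' p) (\<lambda>p. snd (X p + Y p))"
      "potential (\<lambda>p. \<xi> p + \<xi>' p) (\<lambda>p. snd (X p + Y p))"
      using hg_add[OF *(1,4)] hg_add[OF *(2,5)]
        potential_add[OF *(1,4) hg_sq_int(2)[OF *(2)] hg_sq_int(2)[OF *(5)] *(3,6)] by simp_all
    then show ?thesis unfolding pairs_def by blast
  qed
  show "(\<lambda>p. c *\<^sub>R X p) \<in> pairs" if X: "X \<in> pairs" for X c
  proof -
    obtain \<xi> \<eta> where *: "hg \<xi> (\<lambda>p. fst (X p))" "hg \<eta> (\<lambda>p. snd (X p))" "potential \<xi> (\<lambda>p. snd (X p))"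
      using X unfolding pairs_def by blast
    have "hg (\<lambda>p. c * \<xi> p) (\<lambda>p. fst (c *\<^sub>R X p))" "hg (\<lambda>p. c * \<eta> p) (\<lambda>p. snd (c *\<^sub>R X p))"
      "potential (\<lambda>p. c * \<xi> p) (\<lambda>p. snd (c *\<^sub>R X p))"
      using hg_scale[OF *(1)] hg_scale[OF *(2)] potential_scale[OF *(3)] by simp_all
    then show ?thesis unfolding pairs_def by blast
  qed
  fix F X assume F: "\<And>n. F n \<in> pairs" and X: "sq_int M X" "l2lim M F X"
  have "\<forall>n. \<exists>q. hg (fst q) (\<lambda>p. fst (F n p)) \<and> hg (snd q) (\<lambda>p. snd (F n p)) \<and> potential (fst q) (\<lambda>p. snd (F n p))"
    using F unfolding pairs_def by auto
  from choice[OF this] obtain q where q: "\<And>n. hg (fst (q n)) (\<lambda>p. fst (F n p))"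
    "\<And>n. hg (snd (q n)) (\<lambda>p. snd (F n p))" "\<And>n. potential (fst (q n)) (\<lambda>p. snd (F n p))" by blast
  note Xs = sq_int_fst_snd[OF X(1)]
  note lim = l2lim_fst_snd[OF pairs_sq_int[OF F] X hg_sq_int(2)[OF q(1)] Xs(1) hg_sq_int(2)[OF q(2)] Xs(2)]
  obtain \<xi> where \<xi>: "hg \<xi> (\<lambda>p. fst (X p))" "l2lim M (\<lambda>n. fst (q n)) \<xi>"
    by (rule hg_complete[OF q(1) Xs(1) lim(1)])
  obtain \<eta> where \<eta>: "hg \<eta> (\<lambda>p. snd (X p))" by (rule hg_complete[OF q(2) Xs(2) lim(2)])
  have "potential \<xi> (\<lambda>p. snd (X p))"
    unfolding potential_def
  proof (intro allI impI)
    fix \<phi> assume \<phi>: "test \<phi>"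
    note t = test_grad_sq_int[OF \<phi>] and s = sq_int_inner_grad[OF u test_per_smooth[OF \<phi>]]
    have 1: "(\<lambda>n. LINT p|M. grad3 \<phi> p \<bullet> snd (F n p)) \<longlonglongrightarrow> (LINT p|M. grad3 \<phi> p \<bullet> snd (X p))"
      by (rule l2lim_inner[OF hg_sq_int(2)[OF q(2)] Xs(2) t lim(2)])
    have 2: "(\<lambda>n. LINT p|M. (u p \<bullet> grad3 \<phi> p) * fst (q n) p) \<longlonglongrightarrow> (LINT p|M. (u p \<bullet> grad3 \<phi> p) * \<xi> p)"
      using l2lim_inner[OF hg_sq_int(1)[OF q(1)] hg_sq_int(1)[OF \<xi>(1)] s \<xi>(2)] by (simp only: inner_real_def)
    have "(LINT p|M. grad3 \<phi> p \<bullet> snd (F n p)) = (LINT p|M. (u p \<bullet> grad3 \<phi> p) * fst (q n) p)" for n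
      using q(3) \<phi> unfolding potential_def by blast
    with 1 have "(\<lambda>n. LINT p|M. (u p \<bullet> grad3 \<phi> p) * fst (q n) p) \<longlonglongrightarrow> (LINT p|M. grad3 \<phi> p \<bullet> snd (X p))"
      by (simp only:)
    from LIMSEQ_unique[OF this 2]
    show "(LINT p|M. grad3 \<phi> p \<bullet> snd (X p)) = (LINT p|M. (u p \<bullet> grad3 \<phi> p) * \<xi> p)" .
  qed
  with \<xi>(1) \<eta> show "X \<in> pairs" unfolding pairs_def by blast
qed

text \<open>For bounded \<xi> the field \<open>\<xi> u\<close> is in L2 and can be projected onto
  gradients. The last conclusion keeps the identity for all gradients from H1_0, as the first
  variation later inserts a gradient that is not that of a test function.\<close>

lemma potential_exists:
  assumes h: "hg \<xi> g" and bd: "AE p in M. \<bar>\<xi> p\<bar> \<le> C"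
  shows "\<exists>\<eta> k. hg \<eta> k \<and> potential \<xi> k \<and>
    (\<forall>f h. hg f h \<longrightarrow> (LINT p|M. (\<xi> p *\<^sub>R u p) \<bullet> h p) = (LINT p|M. k p \<bullet> h p))"
proof -
  have s: "sq_int M (\<lambda>p. \<xi> p *\<^sub>R u p)" by (rule sq_int_bdd_scaleR[OF u sq_int_meas[OF hg_sq_int(1)[OF h]] bd])
  obtain \<eta> k where k: "hg \<eta> k" "\<And>f h. hg f h \<Longrightarrow> (LINT p|M. (\<xi> p *\<^sub>R u p) \<bullet> h p) = (LINT p|M. k p \<bullet> h p)"
    using inv_lap_div_exists[OF s] by blast
  have "potential \<xi> k"
    unfolding potential_def
  proof (intro allI impI)
    fix \<phi> assume \<phi>: "test \<phi>"
    from k(2)[OF hg_test[OF \<phi>]]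
    show "(LINT p|M. grad3 \<phi> p \<bullet> k p) = (LINT p|M. (u p \<bullet> grad3 \<phi> p) * \<xi> p)"
      by (simp add: inner_commute mult.commute)
  qed
  with k show ?thesis by (intro exI conjI allI impI)
qed

lemma energy_eq:
  assumes "hg \<eta> k" "potential \<xi> k"
  shows "inv_lap_div_energy lx ly (\<lambda>p. \<xi> p *\<^sub>R u p) = (LINT p|M. (norm (k p))\<^sup>2)"
proof (rule inv_lap_div_energy_eq[OF assms(1)])
  fix \<phi> assume "test \<phi>"
  then have "(LINT p|M. grad3 \<phi> p \<bullet> k p) = (LINT p|M. (u p \<bullet> grad3 \<phi> p) * \<xi> p)"
    using assms(2) unfolding potential_def by blast
  then show "(LINT p|M. k p \<bullet> grad3 \<phi> p) = (LINT p|M. (\<xi> p *\<^sub>R u p) \<bullet> grad3 \<phi> p)"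
    by (simp add: inner_commute mult.commute)
qed

lemma Jfun_eq:
  assumes "hg \<xi> g" "hg \<eta> k" "potential \<xi> k"
  shows "Jfun lx ly u \<xi> = (2 * (LINT p|M. zc (u p) * \<xi> p) - (LINT p|M. (norm (g p))\<^sup>2)
    - (LINT p|M. (norm (k p))\<^sup>2)) / (lx * ly)"
  unfolding Jfun_def energy_eq[OF assms(2,3)] dirichlet_eq[OF hg_sq_int(2)[OF assms(1)] hg_weak_grad[OF assms(1)]]
  by (simp add: mult.assoc)

text \<open>\<open>transport\<close> with the multiplier \<open>z\<close>, whose gradient is
  \<open>ez\<close>. It expresses the work as an L2 pairing with the gradient, the form that the
  projection requires.\<close>

lemma work_eq:
  assumes "hg \<xi> g" shows "(LINT p|M. zc (u p) * \<xi> p) = (LINT p|M. (- zc p *\<^sub>R u p) \<bullet> g p)"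
  using transport[OF per_smooth_zc assms] unfolding grad3_zc inner_ez by simp

text \<open>The maximiser: the Riesz representer of \<open>\<xi> \<mapsto> \<integral> w \<xi>\<close> for the quadratic form
  \<open>\<integral> |\<nabla>\<xi>|\<^sup>2 + |\<nabla>\<eta>|\<^sup>2\<close> with \<open>\<Delta>\<eta> = div (u \<xi>)\<close>. Its Euler--Lagrange equations are the
  symmetric and antisymmetric parts of the equations of \<open>u\<close> and \<open>- u\<close>.\<close>

lemma maximizer_exists:
  obtains \<xi> g \<eta> k where "hg \<xi> g" "hg \<eta> k" "potential \<xi> k" "AE p in M. \<bar>\<xi> p\<bar> \<le> 1"
    "sol (\<lambda>p. \<xi> p + \<eta> p) (\<lambda>p. g p + k p)"
    "\<forall>\<zeta> h \<kappa> l. hg \<zeta> h \<longrightarrow> hg \<kappa> l \<longrightarrow> potential \<zeta> l \<longrightarrow>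
      (LINT p|M. zc (u p) * \<zeta> p) = (LINT p|M. g p \<bullet> h p) + (LINT p|M. k p \<bullet> l p)"
proof -
  have zu: "sq_int M (\<lambda>p. - zc p *\<^sub>R u p)"
    using sq_int_minus[OF sq_int_per_smooth_scaleR[OF u per_smooth_zc]] by simp
  \<comment> \<open>The second component is 0 because the linear form does not see \<eta>; only
    membership in \<open>pairs\<close> couples the two.\<close>
  obtain X where X: "X \<in> pairs"
    "\<And>Y. Y \<in> pairs \<Longrightarrow> (LINT p|M. (- zc p *\<^sub>R u p, 0) \<bullet> Y p) = (LINT p|M. X p \<bullet> Y p)"
    using l2_projection[OF pairs_subspace sq_int_Pair[OF zu sq_int_zero]] by blast
  obtain \<xi> \<eta> where h0: "hg \<xi> (\<lambda>p. fst (X p))" "hg \<eta> (\<lambda>p. snd (X p))" "potential \<xi> (\<lambda>p. snd (X p))"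
    using X(1) unfolding pairs_def by blast
  define g k where "g = (\<lambda>p. fst (X p))" and "k = (\<lambda>p. snd (X p))"
  have h: "hg \<xi> g" "hg \<eta> k" "potential \<xi> k" using h0 by (simp_all add: g_def k_def)
  note gs = hg_sq_int(2)[OF h(1)] and ks = hg_sq_int(2)[OF h(2)]
  have work: "(LINT p|M. zc (u p) * \<zeta> p) = (LINT p|M. g p \<bullet> h p) + (LINT p|M. k p \<bullet> l p)"
    if "hg \<zeta> h" "hg \<kappa> l" "potential \<zeta> l" for \<zeta> h \<kappa> l
  proof -
    have "(\<lambda>p. (h p, l p)) \<in> pairs" using that unfolding pairs_def by auto
    from X(2)[OF this] have "(LINT p|M. (- zc p *\<^sub>R u p) \<bullet> h p) = (LINT p|M. X p \<bullet> (h p, l p))"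
      by (simp add: inner_Pair)
    moreover have "X p \<bullet> (h p, l p) = g p \<bullet> h p + k p \<bullet> l p" for p
      by (cases "X p") (simp add: g_def k_def inner_Pair)
    ultimately show ?thesis
      unfolding work_eq[OF that(1)]
      using Bochner_Integration.integral_add[OF integrable_sq_inner[OF gs hg_sq_int(2)[OF that(1)]]
          integrable_sq_inner[OF ks hg_sq_int(2)[OF that(2)]]]
      by (simp only:)
  qed
  \<comment> \<open>The variation runs along a test function \<phi> with potential gradient
    \<open>l\<close>. Pairing the defining property of \<open>l\<close> with \<open>k\<close> trades
    the implicit \<open>l\<close> for the explicit drift term \<open>u \<bullet> k\<close>.\<close>
  have E1: "(LINT p|M. g p \<bullet> grad3 \<phi> p) + (LINT p|M. (u p \<bullet> k p) * \<phi> p) = (LINT p|M. zc (u p) * \<phi> p)"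
    if \<phi>: "test \<phi>" for \<phi>
  proof -
    obtain C where C: "AE p in M. \<bar>\<phi> p\<bar> \<le> C" using test_AE_bounded[OF \<phi>] by blast
    obtain \<kappa> l where l: "hg \<kappa> l" "potential \<phi> l"
      and l3: "\<forall>f h. hg f h \<longrightarrow> (LINT p|M. (\<phi> p *\<^sub>R u p) \<bullet> h p) = (LINT p|M. l p \<bullet> h p)"
      using potential_exists[OF hg_test[OF \<phi>] C] by blast
    have "(LINT p|M. k p \<bullet> l p) = (LINT p|M. (u p \<bullet> k p) * \<phi> p)"
      using l3[rule_format, OF h(2)] by (simp add: inner_commute mult.commute)
    then show ?thesis using work[OF hg_test[OF \<phi>] l(1,2)] by simp
  qed
  \<comment> \<open>The potential equation of \<xi>, with the derivative moved from the test
    function to \<xi> by \<open>transport\<close>.\<close>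
  have E2: "(LINT p|M. k p \<bullet> grad3 \<phi> p) + (LINT p|M. (u p \<bullet> g p) * \<phi> p) = 0" if \<phi>: "test \<phi>" for \<phi>
  proof -
    have "(LINT p|M. grad3 \<phi> p \<bullet> k p) = (LINT p|M. (u p \<bullet> grad3 \<phi> p) * \<xi> p)"
      using h(3) \<phi> unfolding potential_def by blast
    then show ?thesis
      using transport[OF test_per_smooth[OF \<phi>] h(1)] by (simp add: inner_commute mult.commute)
  qed
  have lin: "(LINT p|M. (a *\<^sub>R g p + b *\<^sub>R k p) \<bullet> grad3 \<phi> p)
        = a * (LINT p|M. g p \<bullet> grad3 \<phi> p) + b * (LINT p|M. k p \<bullet> grad3 \<phi> p)"
      "(LINT p|M. (u p \<bullet> (a *\<^sub>R g p + b *\<^sub>R k p)) * \<phi> p)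
        = a * (LINT p|M. (u p \<bullet> g p) * \<phi> p) + b * (LINT p|M. (u p \<bullet> k p) * \<phi> p)"
    if \<phi>: "test \<phi>" for \<phi> a b
  proof -
    note t = test_grad_sq_int[OF \<phi>]
    have "(a *\<^sub>R g p + b *\<^sub>R k p) \<bullet> grad3 \<phi> p = a * (g p \<bullet> grad3 \<phi> p) + b * (k p \<bullet> grad3 \<phi> p)" for p
      by (simp add: inner_add_left)
    then show "(LINT p|M. (a *\<^sub>R g p + b *\<^sub>R k p) \<bullet> grad3 \<phi> p)
        = a * (LINT p|M. g p \<bullet> grad3 \<phi> p) + b * (LINT p|M. k p \<bullet> grad3 \<phi> p)"
      using integrable_sq_inner[OF gs t] integrable_sq_inner[OF ks t] by simp
    have "(u p \<bullet> (a *\<^sub>R g p + b *\<^sub>R k p)) * \<phi> p = a * ((u p \<bullet> g p) * \<phi> p) + b * ((u p \<bullet> k p) * \<phi> p)" for p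
      by (simp add: inner_add_right algebra_simps)
    then show "(LINT p|M. (u p \<bullet> (a *\<^sub>R g p + b *\<^sub>R k p)) * \<phi> p)
        = a * (LINT p|M. (u p \<bullet> g p) * \<phi> p) + b * (LINT p|M. (u p \<bullet> k p) * \<phi> p)"
      using integrable_inner_test[OF gs \<phi>] integrable_inner_test[OF ks \<phi>] by simp
  qed
  have s1: "sol (\<lambda>p. \<xi> p + \<eta> p) (\<lambda>p. g p + k p)"
    unfolding sol_def
  proof (intro conjI allI impI hg_add h)
    fix \<phi> assume \<phi>: "test \<phi>"
    show "(LINT p|M. (g p + k p) \<bullet> grad3 \<phi> p) + (LINT p|M. (u p \<bullet> (g p + k p)) * \<phi> p) = (LINT p|M. zc (u p) * \<phi> p)"
      using lin[OF \<phi>, of 1 1] E1[OF \<phi>] E2[OF \<phi>] by simp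
  qed
  interpret neg: slab_flow lx ly "\<lambda>p. - u p"
    by unfold_locales (use sq_int_minus[OF u] div0 in simp_all)
  have s2: "neg.sol (\<lambda>p. \<eta> p - \<xi> p) (\<lambda>p. k p - g p)"
    unfolding neg.sol_def
  \<comment> \<open>The order \<open>\<eta> - \<xi>\<close> matches the source: reversing
    \<open>u\<close> also reverses the sign of \<open>w\<close>.\<close>
  proof (intro conjI allI impI hg_diff h)
    fix \<phi> assume \<phi>: "test \<phi>"
    have "zc (- u p) = - zc (u p)" for p by (simp add: zc_def)
    then show "(LINT p|M. (k p - g p) \<bullet> grad3 \<phi> p) + (LINT p|M. (- u p \<bullet> (k p - g p)) * \<phi> p) = (LINT p|M. zc (- u p) * \<phi> p)"
      using lin[OF \<phi>, of "-1" 1] E1[OF \<phi>] E2[OF \<phi>] by simp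
  qed
  \<comment> \<open>\<xi> is half the difference of the two solutions, each bounded by 1.\<close>
  have "AE p in M. \<bar>\<xi> p\<bar> \<le> 1"
    using maximum_principle[OF s1] neg.maximum_principle[OF s2] by eventually_elim linarith
  moreover have "\<forall>\<zeta> h \<kappa> l. hg \<zeta> h \<longrightarrow> hg \<kappa> l \<longrightarrow> potential \<zeta> l \<longrightarrow>
      (LINT p|M. zc (u p) * \<zeta> p) = (LINT p|M. g p \<bullet> h p) + (LINT p|M. k p \<bullet> l p)"
    by (intro allI impI work)
  ultimately show ?thesis by (rule that[OF h _ s1])
qed

text \<open>Completing the square: by the Riesz identity, \<open>lx * ly\<close> times the
  functional at \<zeta> is the sum of the energies of \<open>g\<close> and \<open>k\<close>, minus
  the squared distances of the gradients of \<zeta> and its potential from \<open>g\<close> and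
  \<open>k\<close>. That sum is \<open>lx * ly\<close> times \<open>Nu - 1\<close> because
  \<open>g\<close> and \<open>k\<close> are orthogonal.\<close>

lemma Jfun_maximum:
  shows "\<exists>\<xi>. H10 lx ly \<xi> \<and> Linf lx ly \<xi> \<and> Jfun lx ly u \<xi> = Nu lx ly u - 1"
    and "H10 lx ly \<zeta> \<Longrightarrow> Linf lx ly \<zeta> \<Longrightarrow> Jfun lx ly u \<zeta> \<le> Nu lx ly u - 1"
proof -
  obtain \<xi> g \<eta> k where h: "hg \<xi> g" "hg \<eta> k" "potential \<xi> k" and bd: "AE p in M. \<bar>\<xi> p\<bar> \<le> 1"
    and s: "sol (\<lambda>p. \<xi> p + \<eta> p) (\<lambda>p. g p + k p)"
    and all: "\<forall>\<zeta> h \<kappa> l. hg \<zeta> h \<longrightarrow> hg \<kappa> l \<longrightarrow> potential \<zeta> l \<longrightarrow>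
      (LINT p|M. zc (u p) * \<zeta> p) = (LINT p|M. g p \<bullet> h p) + (LINT p|M. k p \<bullet> l p)"
    using maximizer_exists by blast
  note work = all[rule_format]
  note gs = hg_sq_int(2)[OF h(1)] and ks = hg_sq_int(2)[OF h(2)]
  \<comment> \<open>The potential equation tested with the bounded \<xi> itself;
    \<open>self_transport\<close> removes the drift term and leaves the orthogonality.\<close>
  have "(LINT p|M. k p \<bullet> g p) + (LINT p|M. (u p \<bullet> g p) * \<xi> p) = 0"
  proof (rule hg_functional_bounded[OF h(1) bd ks integrable_sq_inner[OF u gs]])
    fix \<phi> assume \<phi>: "test \<phi>"
    have "(LINT p|M. grad3 \<phi> p \<bullet> k p) = (LINT p|M. (u p \<bullet> grad3 \<phi> p) * \<xi> p)"
      using h(3) \<phi> unfolding potential_def by blast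
    then show "(LINT p|M. k p \<bullet> grad3 \<phi> p) + (LINT p|M. (u p \<bullet> g p) * \<phi> p) = 0"
      using transport[OF test_per_smooth[OF \<phi>] h(1)] by (simp add: inner_commute mult.commute)
  qed
  then have "(LINT p|M. g p \<bullet> k p) = 0"
    unfolding self_transport[OF h(1) bd] by (simp add: inner_commute)
  then have Nu: "Nu lx ly u - 1 = ((LINT p|M. (norm (g p))\<^sup>2) + (LINT p|M. (norm (k p))\<^sup>2)) / (lx * ly)"
    using Nu_eq[OF s] l2_sq_add[OF gs ks] by simp
  have "H10 lx ly \<xi>" using h(1) by (auto simp: H10_iff_hg)
  moreover have "Linf lx ly \<xi>" using bd sq_int_meas[OF hg_sq_int(1)[OF h(1)]] unfolding Linf_def by blast
  moreover have "Jfun lx ly u \<xi> = Nu lx ly u - 1"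
    unfolding Jfun_eq[OF h] Nu work[OF h] by (simp add: power2_norm_eq_inner)
  ultimately show "\<exists>\<xi>. H10 lx ly \<xi> \<and> Linf lx ly \<xi> \<and> Jfun lx ly u \<xi> = Nu lx ly u - 1" by blast
  assume \<zeta>: "H10 lx ly \<zeta>" "Linf lx ly \<zeta>"
  then obtain h' where h': "hg \<zeta> h'" unfolding H10_iff_hg by blast
  obtain C where C: "AE p in M. \<bar>\<zeta> p\<bar> \<le> C" using \<zeta>(2) unfolding Linf_def by blast
  obtain \<kappa> l where l: "hg \<kappa> l" "potential \<zeta> l" using potential_exists[OF h' C] by blast
  have "0 \<le> (LINT p|M. (norm (g p - h' p))\<^sup>2)" "0 \<le> (LINT p|M. (norm (k p - l p))\<^sup>2)" by simp_all
  then have "2 * (LINT p|M. zc (u p) * \<zeta> p) - (LINT p|M. (norm (h' p))\<^sup>2) - (LINT p|M. (norm (l p))\<^sup>2)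
      \<le> (LINT p|M. (norm (g p))\<^sup>2) + (LINT p|M. (norm (k p))\<^sup>2)"
    unfolding work[OF h' l] l2_sq_diff[OF gs hg_sq_int(2)[OF h']] l2_sq_diff[OF ks hg_sq_int(2)[OF l(1)]]
    by (simp add: algebra_simps)
  then show "Jfun lx ly u \<zeta> \<le> Nu lx ly u - 1"
    unfolding Jfun_eq[OF h' l] Nu using lx ly by (intro divide_right_mono) auto
qed

end

theorem theorem3p1:
  fixes lx ly :: real and u :: "pt \<Rightarrow> pt"
  assumes "lx > 0" and "ly > 0"
    and "L2 lx ly u" and "div_free lx ly u"
  shows "(\<exists>\<xi>. H10 lx ly \<xi> \<and> Linf lx ly \<xi> \<and> Jfun lx ly u \<xi> = Nu lx ly u - 1) \<and>
         (\<forall>\<xi>. H10 lx ly \<xi> \<and> Linf lx ly \<xi> \<longrightarrow> Jfun lx ly u \<xi> \<le> Nu lx ly u - 1)"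
proof -
  interpret slab lx ly by unfold_locales (use assms in auto)
  interpret slab_flow lx ly u
    by unfold_locales (use assms in \<open>auto simp: L2_sq_int div_free_def\<close>)
  show ?thesis using Jfun_maximum by blast
qed

end
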